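(* Let $Q\in C^r([0,b],\mathcal M_2)$ for some $r\in\mathbb N_0=\{0,1,2,\dots\}$. For every $N>r$ let the coefficients $\{a_n,b_n,c_n,d_n\}_{n=0}^N\subset\mathbb C$ be the least squares solution (a minimizer) of $$\min_{\{a_n,b_n,c_n,d_n\}_{n=0}^N\subset\mathbb C}\Bigl\|\frac12Q(x)+\sum_{n=0}^N\mathcal N_n(x)\begin{pmatrix}a_n&b_n\\ c_n&d_n\end{pmatrix}\Bigr\|^2_{L_2(0,b)},$$ and define the approximate solutions $$C_N(x,\lambda)=\begin{pmatrix}\cos\lambda x\\ \sin\lambda x\end{pmatrix}+\sum_{n=0}^N\mathcal K_n(x)\int_{-x}^x\begin{pmatrix}t^n\cos\lambda t\\ t^n\sin\lambda t\end{pmatrix}dt,$$ $$S_N(x,\lambda)=\begin{pmatrix}-\sin\lambda x\\ \cos\lambda x\end{pmatrix}+\sum_{n=0}^N\mathcal K_n(x)\int_{-x}^x\begin{pmatrix}-t^n\sin\lambda t\\ t^n\cos\lambda t\end{pmatrix}dt.$$ Then there is a constant $M$, independent of $N$, $\lambda$ and $x$, such that for every $N>r$, $x\in[0,b]$ and $\lambda\in\mathbb R$ $$|C(x,\lambda)-C_N(x,\lambda)|\le\frac{2M\sqrt x}{N^r}\qquad\text{and}\qquad|S(x,\lambda)-S_N(x,\lambda)|\le\frac{2M\sqrt x}{N^r}.$$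
   Context: $b>0$; $\mathcal M_2$ is the space of complex $2\times2$ matrices with Frobenius norm $|\cdot|$ (Euclidean norm for vectors in $\mathbb C^2$); the $L_2(0,b)$-norm of a matrix function $F$ is $(\int_0^b|F|^2)^{1/2}$; $B=\begin{pmatrix}0&1\\ -1&0\end{pmatrix}$, $Q(x)=\begin{pmatrix}p(x)&q(x)\\ q(x)&-p(x)\end{pmatrix}$ with complex-valued $p,q$. $C(x,\lambda)$ and $S(x,\lambda)$ are the solutions of the Dirac equation $BY'+Q(x)Y=\lambda Y$ on $[0,b]$ with $C(0,\lambda)=(1,0)^T$, $S(0,\lambda)=(0,1)^T$. Formal powers: $(f,g)^T$ is a complex-valued absolutely continuous solution of $g'+pf+qg=0$, $-f'+qf-pg=0$ on $[0,b]$, with $f,g$ non-vanishing on $[0,b]$ and $f(0)g(0)=1$. Put $X^{(0)}(x)=-\int_0^x\frac{p}{f^2}ds$, $Y^{(0)}(x)=1+\int_0^x\frac{p}{g^2}ds$, and for $n\ge0$ $Z^{(n)}(x)=\int_0^x(f^2X^{(n)}+g^2Y^{(n)})ds$, $X^{(n+1)}(x)=-(n+1)\int_0^x\bigl(\frac{p}{f^2}Z^{(n)}+\frac gfY^{(n)}\bigr)ds$, $Y^{(n+1)}(x)=(n+1)\int_0^x\bigl(\frac{p}{g^2}Z^{(n)}+\frac fgX^{(n)}\bigr)ds$. The functions $\widetilde X^{(n)},\widetilde Y^{(n)},\widetilde Z^{(n)}$ are defined by the same recurrences starting with $\widetilde X^{(0)}(x)=1+\int_0^x\frac{p}{f^2}ds$,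 $\widetilde Y^{(0)}(x)=-\int_0^x\frac{p}{g^2}ds$. Define $\Phi_k=(-1)^{(k+1)/2}f(0)(fX^{(k)},gY^{(k)})^T$ for $k$ odd, $\Phi_k=(-1)^{k/2}g(0)(f\widetilde X^{(k)},g\widetilde Y^{(k)})^T$ for $k$ even; $\Psi_k=(-1)^{(k-1)/2}g(0)(f\widetilde X^{(k)},g\widetilde Y^{(k)})^T$ for $k$ odd, $\Psi_k=(-1)^{k/2}f(0)(fX^{(k)},gY^{(k)})^T$ for $k$ even. For $m\ge0$ (empty sums are $0$) $\mathcal U_{2m-1}(x,t)=\sum_{\text{even }k=0}^m\binom mk\Phi_{m-k}(x)t^k$, $\ \mathcal U_{2m}(x,t)=\sum_{\text{odd }k=1}^m\binom mk\Phi_{m-k}(x)t^k$, $\mathcal V_{2m-1}(x,t)=\sum_{\text{even }k=0}^m\binom mk\Psi_{m-k}(x)t^k$, $\ \mathcal V_{2m}(x,t)=\sum_{\text{odd }k=1}^m\binom mk\Psi_{m-k}(x)t^k$, and (by columns) $\mathcal N_n(x)=[\,-\mathcal V_{2n}(x,x)+B\,\mathcal U_{2n-1}(x,x)\ \ \ \mathcal U_{2n}(x,x)+B\,\mathcal V_{2n-1}(x,x)\,]$. With $C_n=\begin{pmatrix}a_n&b_n\\ c_n&d_n\end{pmatrix}$, the matrix functions $\mathcal K_n$, $0\le n\le N$, are $\mathcal K_{2n}(x)=\sum_{k=0}^{N-2n}\binom{2n+k}{2n}[\Phi_k(x)\ \Psi_k(x)]\,C_{2n+k}$, $\ \mathcal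 K_{2n+1}(x)=\sum_{k=0}^{N-2n-1}\binom{2n+1+k}{2n+1}[\Phi_k(x)\ \Psi_k(x)]\,B\,C_{2n+1+k}\,B$. *)

theory Defs
  imports "HOL-Analysis.Analysis"
begin

text \<open>\<open>Cr_on r I F\<close>: \<open>F\<close> is \<open>r\<close> times continuously differentiable on \<open>I\<close>; derivatives are
  taken within \<open>I\<close>, so they are one-sided at the end points of a closed interval.\<close>

fun Cr_on :: "nat \<Rightarrow> real set \<Rightarrow> (real \<Rightarrow> 'a::real_normed_vector) \<Rightarrow> bool" where
  "Cr_on 0 I F \<longleftrightarrow> continuous_on I F"
| "Cr_on (Suc r) I F \<longleftrightarrow>
     (\<exists>F'. (\<forall>x\<in>I. (F has_vector_derivative F' x) (at x within I)) \<and> Cr_on r I F')"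

definition absolutely_continuous_fun :: "real \<Rightarrow> real \<Rightarrow> (real \<Rightarrow> 'a::real_normed_vector) \<Rightarrow> bool" where
  "absolutely_continuous_fun a b F \<longleftrightarrow>
     (\<forall>\<epsilon>>0. \<exists>\<delta>>0. \<forall>(n::nat) u v.
        (\<forall>i<n. a \<le> u i \<and> u i \<le> v i \<and> v i \<le> b) \<longrightarrow>
        disjoint_family_on (\<lambda>i. {u i<..<v i}) {..<n} \<longrightarrow>
        (\<Sum>i<n. v i - u i) < \<delta> \<longrightarrow>
        (\<Sum>i<n. norm (F (v i) - F (u i))) < \<epsilon>)"

text \<open>\<open>columns2 u v\<close> is the matrix \<open>[u v]\<close> with columns \<open>u\<close> and \<open>v\<close>, whereas
  \<^const>\<open>vector\<close> below lists the rows of a matrix.\<close>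

definition columns2 :: "complex^2 \<Rightarrow> complex^2 \<Rightarrow> complex^2^2" where
  "columns2 u v = transpose (vector [u, v])"

definition matB :: "complex^2^2" where
  "matB = vector [vector [0, 1], vector [-1, 0]]"

definition matQ :: "(real \<Rightarrow> complex) \<Rightarrow> (real \<Rightarrow> complex) \<Rightarrow> real \<Rightarrow> complex^2^2" where
  "matQ p q x = vector [vector [p x, q x], vector [q x, - p x]]"

text \<open>Absolutely continuous solutions of \<open>B Y' + Q Y = \<lambda> Y\<close> on \<open>[0,b]\<close>, the equation being
  required almost everywhere.  For \<open>\<lambda> = 0\<close> and \<open>Y = (f,g)\<close> the equation reads
  \<open>g' + p f + q g = 0\<close>, \<open>- f' + q f - p g = 0\<close>.\<close>

definition dirac_solution ::
  "real \<Rightarrow> (real \<Rightarrow> complex) \<Rightarrow> (real \<Rightarrow> complex) \<Rightarrow> complex \<Rightarrow> (real \<Rightarrow> complex^2) \<Rightarrow> bool" where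
  "dirac_solution b p q lam Y \<longleftrightarrow>
     absolutely_continuous_fun 0 b Y \<and>
     (AE x in lebesgue_on {0..b}. \<exists>Y'.
        (Y has_vector_derivative Y') (at x within {0..b}) \<and>
        matB *v Y' + matQ p q x *v Y x = lam *s Y x)"

text \<open>The recurrences for the formal powers, with the starting functions \<open>X0\<close>, \<open>Y0\<close> as
  parameters, so that they serve both families.\<close>

function (sequential)
  fpX :: "(real \<Rightarrow> complex) \<Rightarrow> (real \<Rightarrow> complex) \<Rightarrow> (real \<Rightarrow> complex) \<Rightarrow>
          (real \<Rightarrow> complex) \<Rightarrow> (real \<Rightarrow> complex) \<Rightarrow> nat \<Rightarrow> real \<Rightarrow> complex" and
  fpY :: "(real \<Rightarrow> complex) \<Rightarrow> (real \<Rightarrow> complex) \<Rightarrow> (real \<Rightarrow> complex) \<Rightarrow>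
          (real \<Rightarrow> complex) \<Rightarrow> (real \<Rightarrow> complex) \<Rightarrow> nat \<Rightarrow> real \<Rightarrow> complex" and
  fpZ :: "(real \<Rightarrow> complex) \<Rightarrow> (real \<Rightarrow> complex) \<Rightarrow> (real \<Rightarrow> complex) \<Rightarrow>
          (real \<Rightarrow> complex) \<Rightarrow> (real \<Rightarrow> complex) \<Rightarrow> nat \<Rightarrow> real \<Rightarrow> complex" where
  "fpX p f g X0 Y0 0 = X0"
| "fpX p f g X0 Y0 (Suc n) = (\<lambda>x. - of_nat (n + 1) *
     integral {0..x} (\<lambda>s. p s / (f s)^2 * fpZ p f g X0 Y0 n s + g s / f s * fpY p f g X0 Y0 n s))"
| "fpY p f g X0 Y0 0 = Y0"
| "fpY p f g X0 Y0 (Suc n) = (\<lambda>x. of_nat (n + 1) *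
     integral {0..x} (\<lambda>s. p s / (g s)^2 * fpZ p f g X0 Y0 n s + f s / g s * fpX p f g X0 Y0 n s))"
| "fpZ p f g X0 Y0 n = (\<lambda>x.
     integral {0..x} (\<lambda>s. (f s)^2 * fpX p f g X0 Y0 n s + (g s)^2 * fpY p f g X0 Y0 n s))"
  by pat_completeness auto
termination
  by (relation "Wellfounded.measure (\<lambda>a. case a of
        Inl (_, _, _, _, _, n) \<Rightarrow> 2 * n
      | Inr (Inl (_, _, _, _, _, n)) \<Rightarrow> 2 * n
      | Inr (Inr (_, _, _, _, _, n)) \<Rightarrow> 2 * n + 1)") auto

definition powX ::
  "(real \<Rightarrow> complex) \<Rightarrow> (real \<Rightarrow> complex) \<Rightarrow> (real \<Rightarrow> complex) \<Rightarrow> nat \<Rightarrow> real \<Rightarrow> complex" where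
  "powX p f g = fpX p f g (\<lambda>x. - integral {0..x} (\<lambda>s. p s / (f s)^2))
                          (\<lambda>x. 1 + integral {0..x} (\<lambda>s. p s / (g s)^2))"

definition powY ::
  "(real \<Rightarrow> complex) \<Rightarrow> (real \<Rightarrow> complex) \<Rightarrow> (real \<Rightarrow> complex) \<Rightarrow> nat \<Rightarrow> real \<Rightarrow> complex" where
  "powY p f g = fpY p f g (\<lambda>x. - integral {0..x} (\<lambda>s. p s / (f s)^2))
                          (\<lambda>x. 1 + integral {0..x} (\<lambda>s. p s / (g s)^2))"

definition powX_tilde ::
  "(real \<Rightarrow> complex) \<Rightarrow> (real \<Rightarrow> complex) \<Rightarrow> (real \<Rightarrow> complex) \<Rightarrow> nat \<Rightarrow> real \<Rightarrow> complex" where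
  "powX_tilde p f g = fpX p f g (\<lambda>x. 1 + integral {0..x} (\<lambda>s. p s / (f s)^2))
                                (\<lambda>x. - integral {0..x} (\<lambda>s. p s / (g s)^2))"

definition powY_tilde ::
  "(real \<Rightarrow> complex) \<Rightarrow> (real \<Rightarrow> complex) \<Rightarrow> (real \<Rightarrow> complex) \<Rightarrow> nat \<Rightarrow> real \<Rightarrow> complex" where
  "powY_tilde p f g = fpY p f g (\<lambda>x. 1 + integral {0..x} (\<lambda>s. p s / (f s)^2))
                                (\<lambda>x. - integral {0..x} (\<lambda>s. p s / (g s)^2))"

definition Phi ::
  "(real \<Rightarrow> complex) \<Rightarrow> (real \<Rightarrow> complex) \<Rightarrow> (real \<Rightarrow> complex) \<Rightarrow> nat \<Rightarrow> real \<Rightarrow> complex^2" where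
  "Phi p f g k x =
     (if odd k
      then ((-1)^((k + 1) div 2) * f 0) *s vector [f x * powX p f g k x, g x * powY p f g k x]
      else ((-1)^(k div 2) * g 0) *s vector [f x * powX_tilde p f g k x, g x * powY_tilde p f g k x])"

definition Psi ::
  "(real \<Rightarrow> complex) \<Rightarrow> (real \<Rightarrow> complex) \<Rightarrow> (real \<Rightarrow> complex) \<Rightarrow> nat \<Rightarrow> real \<Rightarrow> complex^2" where
  "Psi p f g k x =
     (if odd k
      then ((-1)^((k - 1) div 2) * g 0) *s vector [f x * powX_tilde p f g k x, g x * powY_tilde p f g k x]
      else ((-1)^(k div 2) * f 0) *s vector [f x * powX p f g k x, g x * powY p f g k x])"

text \<open>For a sequence \<open>F\<close> of vector functions, the even and the odd part (in \<open>k\<close>) of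
  \<open>\<Sum>k\<le>m. (m choose k) F\<^sub>m\<^sub>-\<^sub>k(x) t\<^sup>k\<close>.  With \<open>F = \<Phi>\<close> these are \<open>U\<^sub>2\<^sub>m\<^sub>-\<^sub>1\<close> and \<open>U\<^sub>2\<^sub>m\<close>, with \<open>F = \<Psi>\<close>
  they are \<open>V\<^sub>2\<^sub>m\<^sub>-\<^sub>1\<close> and \<open>V\<^sub>2\<^sub>m\<close>; indexing by \<open>m\<close> avoids the index \<open>-1\<close>.\<close>

definition wave_even :: "(nat \<Rightarrow> real \<Rightarrow> complex^2) \<Rightarrow> nat \<Rightarrow> real \<Rightarrow> real \<Rightarrow> complex^2" where
  "wave_even F m x t = (\<Sum>k | k \<le> m \<and> even k. (of_nat (m choose k) * of_real t ^ k) *s F (m - k) x)"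

definition wave_odd :: "(nat \<Rightarrow> real \<Rightarrow> complex^2) \<Rightarrow> nat \<Rightarrow> real \<Rightarrow> real \<Rightarrow> complex^2" where
  "wave_odd F m x t = (\<Sum>k | k \<le> m \<and> odd k. (of_nat (m choose k) * of_real t ^ k) *s F (m - k) x)"

definition matN ::
  "(real \<Rightarrow> complex) \<Rightarrow> (real \<Rightarrow> complex) \<Rightarrow> (real \<Rightarrow> complex) \<Rightarrow> nat \<Rightarrow> real \<Rightarrow> complex^2^2" where
  "matN p f g n x = columns2
     (- wave_odd (Psi p f g) n x x + matB *v wave_even (Phi p f g) n x x)
     (wave_odd (Phi p f g) n x x + matB *v wave_even (Psi p f g) n x x)"

text \<open>The norm of \<^typ>\<open>complex^2^2\<close> is the Frobenius norm.\<close>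

definition L2_norm_on :: "real \<Rightarrow> (real \<Rightarrow> complex^2^2) \<Rightarrow> real" where
  "L2_norm_on b F = sqrt (integral {0..b} (\<lambda>x. (norm (F x))^2))"

text \<open>The coefficients \<open>a\<^sub>n, b\<^sub>n, c\<^sub>n, d\<^sub>n\<close> are the entries of the matrix \<open>c n\<close>; the values
  \<open>c n\<close> for \<open>n > N\<close> are irrelevant here and below.\<close>

definition least_squares_solution ::
  "real \<Rightarrow> (real \<Rightarrow> complex) \<Rightarrow> (real \<Rightarrow> complex) \<Rightarrow> (real \<Rightarrow> complex) \<Rightarrow> (real \<Rightarrow> complex) \<Rightarrow>
   nat \<Rightarrow> (nat \<Rightarrow> complex^2^2) \<Rightarrow> bool" where
  "least_squares_solution b p q f g N c \<longleftrightarrow>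
     is_arg_min
       (\<lambda>c. (L2_norm_on b (\<lambda>x. (1/2) *\<^sub>R matQ p q x + (\<Sum>n=0..N. matN p f g n x ** c n)))^2)
       (\<lambda>_. True) c"

definition matK ::
  "(real \<Rightarrow> complex) \<Rightarrow> (real \<Rightarrow> complex) \<Rightarrow> (real \<Rightarrow> complex) \<Rightarrow>
   nat \<Rightarrow> (nat \<Rightarrow> complex^2^2) \<Rightarrow> nat \<Rightarrow> real \<Rightarrow> complex^2^2" where
  "matK p f g N c j x =
     (\<Sum>k=0..N-j. real ((j + k) choose j) *\<^sub>R
        (columns2 (Phi p f g k x) (Psi p f g k x) **
         (if even j then c (j + k) else matB ** c (j + k) ** matB)))"

definition approxC ::
  "(real \<Rightarrow> complex) \<Rightarrow> (real \<Rightarrow> complex) \<Rightarrow> (real \<Rightarrow> complex) \<Rightarrow>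
   nat \<Rightarrow> (nat \<Rightarrow> complex^2^2) \<Rightarrow> real \<Rightarrow> complex \<Rightarrow> complex^2" where
  "approxC p f g N c x lam =
     vector [cos (lam * of_real x), sin (lam * of_real x)] +
     (\<Sum>n=0..N. matK p f g N c n x *v
        integral {-x..x} (\<lambda>t. vector [of_real t ^ n * cos (lam * of_real t),
                                      of_real t ^ n * sin (lam * of_real t)]))"

definition approxS ::
  "(real \<Rightarrow> complex) \<Rightarrow> (real \<Rightarrow> complex) \<Rightarrow> (real \<Rightarrow> complex) \<Rightarrow>
   nat \<Rightarrow> (nat \<Rightarrow> complex^2^2) \<Rightarrow> real \<Rightarrow> complex \<Rightarrow> complex^2" where
  "approxS p f g N c x lam =
     vector [- sin (lam * of_real x), cos (lam * of_real x)] +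
     (\<Sum>n=0..N. matK p f g N c n x *v
        integral {-x..x} (\<lambda>t. vector [- (of_real t ^ n * sin (lam * of_real t)),
                                      of_real t ^ n * cos (lam * of_real t)]))"

end

theory Submission
  imports Defs
begin

text \<open>
Let \<open>K\<^sub>N(x,t) = \<Sum> K\<^sub>n(x) t\<^sup>n\<close>.  It satisfies \<open>B K\<^sub>x + Q K + K\<^sub>t B = 0\<close>, so integration by parts shows that
\<open>C\<^sub>N\<close> and \<open>S\<^sub>N\<close> solve the Dirac equation up to the residual
\<open>(G + B G B) \<phi>(x) + (G - B G B) \<phi>(-x)\<close>, where \<open>G = Q/2 + \<Sum> N\<^sub>n C\<^sub>n\<close> is exactly the function whose
mean square is minimised and \<open>\<bar>\<phi>\<bar> = 1\<close>.  For real \<open>\<lambda>\<close> the term \<open>\<lambda> B\<close> is skew, and Gronwall's inequality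
bounds the error by a constant times \<open>sqrt x\<close> times the norm of \<open>G\<close>, uniformly in \<open>\<lambda>\<close>.  It remains to
find coefficients for which the norm of \<open>G\<close> is of order \<open>N\<^sup>-\<^sup>r\<close>.

Diagonalising \<open>B\<close> from both sides, the columns of the kernel decouple into two scalar systems
\<open>a\<^sub>x = - a\<^sub>t + u d\<close>, \<open>d\<^sub>x = d\<^sub>t + v a\<close> with \<open>u, v = q \<plusminus> \<i> p\<close>, polynomial Cauchy data on \<open>x = 0\<close>, and prescribed
traces \<open>d(x,x)\<close> and \<open>a(x,-x)\<close>.  An energy estimate in the characteristic triangle shows that the map
from Cauchy data to traces is a Volterra perturbation of a dilation, so polynomial data reach every
continuous trace up to an arbitrarily small error with norm control.  Differentiation in \<open>t\<close>
turns solutions into solutions and acts on the traces as a first-order differential operator;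
combined with a mean-square Jackson inequality for polynomials this gains one factor \<open>1/N\<close> per
derivative, and induction on \<open>r\<close> gives the rate.
\<close>

text \<open>The matrices \<open>c n\<close> have as many entries as four scalar polynomials of
  degree at most \<open>N\<close> have coefficients, and these polynomials are the Cauchy data of
  the two scalar systems. The task is therefore to approximate given traces by traces of solutions
  with polynomial data, and two obstacles shape it. A trace at x sees directly only half of the data
  on [-2x, 2x], the half carried along the characteristics that end there; the other half enters
  through the coupling and has to be made small in mean square, although the ideal data then jump at
  0. Moreover, mere density would give no rate: the degree is cut down afterwards, by the Jackson
  inequality, at a cost proportional to the size of the data of the t-derivative. Density is
  therefore needed with a bound on the data that does not depend on the accuracy, and it is applied
  to the trace of the derivative, whose data are then integrated back. The factor sqrt x comes from
  running Gronwall's inequality on [0, x] with the extra rate 1/x, which costs only a factor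
  e.\<close>

abbreviation msq :: "real \<Rightarrow> real \<Rightarrow> (real \<Rightarrow> 'a::real_normed_vector) \<Rightarrow> real" where
  "msq l h F \<equiv> integral {l..h} (\<lambda>x. (norm (F x))\<^sup>2)"

section \<open>Differential inequalities and moving integrals\<close>

lemma gronwall_derivative:
  fixes \<phi> \<phi>' \<psi> :: "real \<Rightarrow> real"
  assumes "0 \<le> c" "0 \<le> X"
    and deriv: "\<And>s. s \<in> {0..X} \<Longrightarrow> (\<phi> has_vector_derivative \<phi>' s) (at s within {0..X})"
    and bound: "\<And>s. s \<in> {0..X} \<Longrightarrow> \<phi>' s \<le> c * \<phi> s + \<psi> s"
    and cont: "continuous_on {0..X} \<psi>"
    and nonneg: "\<And>s. s \<in> {0..X} \<Longrightarrow> 0 \<le> \<psi> s"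
  shows "\<phi> X \<le> exp (c * X) * (\<phi> 0 + integral {0..X} \<psi>)"
proof -
  define h where "h s = exp (- c * s) * \<phi> s - integral {0..s} \<psi>" for s
  define h' where "h' s = exp (- c * s) * \<phi>' s - c * exp (- c * s) * \<phi> s - \<psi> s" for s
  have dh: "(h has_vector_derivative h' s) (at s within {0..X})" if "s \<in> {0..X}" for s
  proof -
    have 1: "((\<lambda>s. integral {0..s} \<psi>) has_vector_derivative \<psi> s) (at s within {0..X})"
      by (rule integral_has_vector_derivative[OF cont that])
    have 2: "((\<lambda>s. exp (- c * s)) has_real_derivative - c * exp (- c * s)) (at s within {0..X})"
      by (auto intro!: derivative_eq_intros)
    have 3: "(\<phi> has_real_derivative \<phi>' s) (at s within {0..X})"
      using deriv[OF that] by (simp add: has_real_derivative_iff_has_vector_derivative)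
    have 4: "((\<lambda>s. integral {0..s} \<psi>) has_real_derivative \<psi> s) (at s within {0..X})"
      using 1 by (simp add: has_real_derivative_iff_has_vector_derivative)
    show ?thesis unfolding h_def has_real_derivative_iff_has_vector_derivative[symmetric]
      by (rule derivative_eq_intros 2 3 4 refl)+ (simp add: h'_def algebra_simps)
  qed
  have neg: "h' s \<le> 0" if s: "s \<in> {0..X}" for s
  proof -
    have "exp (- c * s) \<le> 1" using s assms(1) by simp
    then have "exp (- c * s) * \<psi> s \<le> \<psi> s"
      using nonneg[OF s] by (simp add: mult_left_le_one_le)
    moreover have "exp (- c * s) * \<phi>' s \<le> exp (- c * s) * (c * \<phi> s + \<psi> s)"
      using bound[OF s] by (intro mult_left_mono) auto
    ultimately show ?thesis by (simp add: h'_def algebra_simps)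
  qed
  have "h X \<le> h 0"
  proof -
    obtain x where "x \<in> {0..X}" "h X - h 0 = (X - 0) * h' x"
      using mvt_very_simple[OF assms(2), of h "\<lambda>x y. y * h' x"] dh
      by (auto simp: has_vector_derivative_def)
    then show ?thesis using neg[of x] mult_nonneg_nonpos[OF assms(2), of "h' x"] by simp
  qed
  then have "exp (- c * X) * \<phi> X \<le> \<phi> 0 + integral {0..X} \<psi>" by (simp add: h_def)
  then have "exp (c * X) * (exp (- c * X) * \<phi> X) \<le> exp (c * X) * (\<phi> 0 + integral {0..X} \<psi>)"
    by (intro mult_left_mono) auto
  then show ?thesis by (simp add: mult.assoc[symmetric] exp_add[symmetric])
qed

text \<open>Total differentiability at the point of the curve follows from the x-derivative at s and
  continuity of the y-derivative on the whole rectangle; the rest is the chain rule. It is applied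
  to solutions along characteristics and to integrals whose upper limit is the second
  variable.\<close>

lemma has_vector_derivative_along_curve:
  fixes F :: "real \<Rightarrow> real \<Rightarrow> 'a::real_normed_vector"
  assumes Fx: "\<And>y. y \<in> T \<Longrightarrow> ((\<lambda>x. F x y) has_vector_derivative Fx s y) (at s within S)"
    and Fy: "\<And>x y. x \<in> S \<Longrightarrow> y \<in> T \<Longrightarrow> (F x has_vector_derivative Fy x y) (at y within T)"
    and cont: "continuous_on (S \<times> T) (\<lambda>(x, y). Fy x y)"
    and \<gamma>: "(\<gamma> has_vector_derivative \<gamma>') (at s within S)" "\<And>x. x \<in> S \<Longrightarrow> \<gamma> x \<in> T"
    and s: "s \<in> S" and "convex T"
  shows "((\<lambda>x. F x (\<gamma> x)) has_vector_derivative Fx s (\<gamma> s) + \<gamma>' *\<^sub>R Fy s (\<gamma> s)) (at s within S)"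
proof -
  have 1: "((\<lambda>(x, y). F x y) has_derivative
     (\<lambda>(tx, ty). tx *\<^sub>R Fx s (\<gamma> s) + blinfun_scaleR_left (Fy s (\<gamma> s)) ty)) (at (s, \<gamma> s) within S \<times> T)"
  proof (rule has_derivative_partialsI)
    show "((\<lambda>x. F x (\<gamma> s)) has_derivative (\<lambda>tx. tx *\<^sub>R Fx s (\<gamma> s))) (at s within S)"
      using Fx[of "\<gamma> s"] \<gamma>(2)[OF s] by (simp add: has_vector_derivative_def)
    show "((\<lambda>y. F x y) has_derivative blinfun_apply (blinfun_scaleR_left (Fy x y))) (at y within T)"
      if "x \<in> S" "y \<in> T" for x y
      using Fy[OF that] by (simp add: has_vector_derivative_def)
    have "continuous_on (S \<times> T) (\<lambda>z. blinfun_scaleR_left ((\<lambda>(x, y). Fy x y) z))"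
      by (intro continuous_intros cont)
    then show "continuous (at (s, \<gamma> s) within S \<times> T) (\<lambda>(x, y). blinfun_scaleR_left (Fy x y))"
      using s \<gamma>(2)[OF s] by (simp add: continuous_on_eq_continuous_within split_beta')
  qed (use \<gamma>(2)[OF s] assms in auto)
  have 2: "((\<lambda>x. (x, \<gamma> x)) has_derivative (\<lambda>h. (h, h *\<^sub>R \<gamma>'))) (at s within S)"
    using \<gamma>(1) by (auto simp: has_vector_derivative_def intro!: derivative_eq_intros)
  have "((\<lambda>x. (\<lambda>(x, y). F x y) (x, \<gamma> x)) has_derivative
    (\<lambda>h. (\<lambda>(tx, ty). tx *\<^sub>R Fx s (\<gamma> s) + blinfun_scaleR_left (Fy s (\<gamma> s)) ty) (h, h *\<^sub>R \<gamma>'))) (at s within S)"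
    by (rule has_derivative_in_compose[OF 2 has_derivative_subset[OF 1]]) (use \<gamma>(2) in auto)
  then show ?thesis
    by (simp add: has_vector_derivative_def scaleR_right_distrib)
qed

text \<open>The integral from the fixed point L makes the upper end point an independent variable,
  so the derivative along a curve can be taken for \<beta> and for \<alpha> separately and
  subtracted. The interval from L to U contains all moving intervals and provides a rectangle to
  work on.\<close>

lemma integral_moving_bounds_derivative:
  fixes e :: "real \<Rightarrow> real \<Rightarrow> 'a::banach"
  assumes ex: "\<And>y t. y \<in> S \<Longrightarrow> t \<in> {L..U} \<Longrightarrow> ((\<lambda>y. e y t) has_vector_derivative ex y t) (at y within S)"
    and ce: "continuous_on (S \<times> {L..U}) (\<lambda>(y, t). e y t)"
    and cex: "continuous_on (S \<times> {L..U}) (\<lambda>(y, t). ex y t)"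
    and \<alpha>: "(\<alpha> has_vector_derivative \<alpha>') (at s within S)"
    and \<beta>: "(\<beta> has_vector_derivative \<beta>') (at s within S)"
    and range: "\<And>y. y \<in> S \<Longrightarrow> L \<le> \<alpha> y \<and> \<alpha> y \<le> \<beta> y \<and> \<beta> y \<le> U"
    and s: "s \<in> S" and "convex S"
  shows "((\<lambda>y. integral {\<alpha> y..\<beta> y} (e y)) has_vector_derivative
     integral {\<alpha> s..\<beta> s} (ex s) + \<beta>' *\<^sub>R e s (\<beta> s) - \<alpha>' *\<^sub>R e s (\<alpha> s)) (at s within S)"
proof -
  define H where "H y z = integral {L..z} (e y)" for y z
  have slice: "continuous_on {L..U} (f y)" if "continuous_on (S \<times> {L..U}) (\<lambda>(y, t). f y t)" "y \<in> S"
    for f :: "real \<Rightarrow> real \<Rightarrow> 'a" and y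
  proof -
    have "continuous_on {L..U} (\<lambda>t. (y, t))" by (intro continuous_intros)
    from continuous_on_compose2[OF that(1) this] that(2) show ?thesis by auto
  qed
  have sub: "continuous_on (S \<times> {L..z}) (\<lambda>(y, t). ex y t)" "continuous_on {L..z} (e y)" 
     "continuous_on {L..z} (ex y)" if "z \<in> {L..U}" "y \<in> S" for z y
    using that slice[OF ce that(2)] slice[OF cex that(2)] by (auto intro: continuous_on_subset[OF cex] continuous_on_subset)
  have Hx: "((\<lambda>y. H y z) has_vector_derivative integral {L..z} (ex s)) (at s within S)"
    if z: "z \<in> {L..U}" for z
  proof -
    have "e y integrable_on {L..z}" if "y \<in> S" for y
      using sub(2)[OF z that] by (rule integrable_continuous_real)
    then show ?thesis
      using leibniz_rule_vector_derivative[of S L z e ex s] ex sub(1)[OF z s] z s \<open>convex S\<close>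
      by (simp add: H_def)
  qed
  have Hz: "(H y has_vector_derivative e y z) (at z within {L..U})"
    if "z \<in> {L..U}" "y \<in> S" for y z
    unfolding H_def by (rule integral_has_vector_derivative[OF slice[OF ce that(2)] that(1)])
  have curve: "((\<lambda>y. H y (\<gamma> y)) has_vector_derivative integral {L..\<gamma> s} (ex s) + \<gamma>' *\<^sub>R e s (\<gamma> s)) (at s within S)"
    if "(\<gamma> has_vector_derivative \<gamma>') (at s within S)" "\<And>y. y \<in> S \<Longrightarrow> \<gamma> y \<in> {L..U}" for \<gamma> \<gamma>'
    using has_vector_derivative_along_curve[where F=H and Fx="\<lambda>s z. integral {L..z} (ex s)" and Fy=e
       and T="{L..U}" and S=S and s=s and \<gamma>=\<gamma> and \<gamma>'=\<gamma>'] Hx Hz ce that s by auto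
  have split: "integral {\<alpha> y..\<beta> y} (f y) = integral {L..\<beta> y} (f y) - integral {L..\<alpha> y} (f y)"
    if y: "y \<in> S" and cf: "continuous_on (S \<times> {L..U}) (\<lambda>(y, t). f y t)" for y and f :: "real \<Rightarrow> real \<Rightarrow> 'a"
  proof -
    have "f y integrable_on {L..\<beta> y}"
      using slice[OF cf y] range[OF y] by (auto intro!: integrable_continuous_real elim: continuous_on_subset)
    from Henstock_Kurzweil_Integration.integral_combine[OF _ _ this, of "\<alpha> y"] range[OF y]
    show ?thesis by (simp add: algebra_simps)
  qed
  have "((\<lambda>y. H y (\<beta> y) - H y (\<alpha> y)) has_vector_derivative
     (integral {L..\<beta> s} (ex s) + \<beta>' *\<^sub>R e s (\<beta> s)) - (integral {L..\<alpha> s} (ex s) + \<alpha>' *\<^sub>R e s (\<alpha> s))) (at s within S)"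
    by (intro has_vector_derivative_diff curve \<alpha> \<beta>) (use range in force)+
  then have "((\<lambda>y. H y (\<beta> y) - H y (\<alpha> y)) has_vector_derivative
     integral {\<alpha> s..\<beta> s} (ex s) + \<beta>' *\<^sub>R e s (\<beta> s) - \<alpha>' *\<^sub>R e s (\<alpha> s)) (at s within S)"
    by (simp add: split[OF s cex] algebra_simps)
  then show ?thesis
    by (rule has_vector_derivative_transform[OF s, rotated]) (simp add: split[OF _ ce] H_def)
qed

section \<open>Absolutely continuous functions\<close>

text \<open>A gauge argument. Tags outside E use differentiability at the tag; tags in E are forced
  into an open set of small measure, on which absolute continuity makes the total increment of F
  small.\<close>

lemma absolutely_continuous_fun_has_integral:
  fixes F h :: "real \<Rightarrow> 'a::euclidean_space"
  assumes "a \<le> b" and ac: "absolutely_continuous_fun a b F" and E: "negligible E"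
    and deriv: "\<And>x. x \<in> {a..b} - E \<Longrightarrow> (F has_vector_derivative h x) (at x within {a..b})"
  shows "(h has_integral F b - F a) {a..b}"
proof -
  define g where "g x = (if x \<in> E then 0 else h x)" for x
  have "(g has_integral F b - F a) {a..b}"
    unfolding has_integral_real
  proof (intro allI impI)
    fix e :: real assume "e > 0"
    obtain \<delta> where "\<delta> > 0" and \<delta>: "\<And>(n::nat) u v. (\<forall>i<n. a \<le> u i \<and> u i \<le> v i \<and> v i \<le> b) \<Longrightarrow>
        disjoint_family_on (\<lambda>i. {u i<..<v i}) {..<n} \<Longrightarrow> (\<Sum>i<n. v i - u i) < \<delta> \<Longrightarrow>
        (\<Sum>i<n. norm (F (v i) - F (u i))) < e / 2"
      using ac[unfolded absolutely_continuous_fun_def, rule_format, of "e / 2"] \<open>e > 0\<close> by auto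
    have "E \<in> lmeasurable" "measure lebesgue E = 0"
      using E by (auto simp: negligible_iff_measure)
    then obtain U where U: "open U" "E \<subseteq> U" "U \<in> lmeasurable" "measure lebesgue U < \<delta>"
    proof -
      obtain U where U: "open U" "E \<subseteq> U" "U - E \<in> lmeasurable" "emeasure lebesgue (U - E) < ennreal \<delta>"
        using sets_lebesgue_outer_open[of E \<delta>] \<open>\<delta> > 0\<close> \<open>E \<in> lmeasurable\<close> by blast
      have *: "U = (U - E) \<union> E" using U(2) by auto
      have "U \<in> lmeasurable"
        by (subst *) (intro fmeasurable.Un U(3) \<open>E \<in> lmeasurable\<close>)
      moreover have "measure lebesgue U \<le> measure lebesgue (U - E)"
        using measure_Un_le[of "U - E" lebesgue E] U(3) \<open>E \<in> lmeasurable\<close> \<open>measure lebesgue E = 0\<close> *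
        by (simp add: fmeasurableD)
      moreover have "measure lebesgue (U - E) < \<delta>"
        using U(3,4) \<open>\<delta> > 0\<close> by (simp add: emeasure_eq_measure2 ennreal_less_iff)
      ultimately show ?thesis using that[of U] U by simp
    qed
    \<comment> \<open>The summand 1 covers a = b and makes the total error over the good cells
      strictly less than e / 2.\<close>
    define e' where "e' = e / (2 * (b - a + 1))"
    have "e' > 0" using \<open>e > 0\<close> \<open>a \<le> b\<close> by (simp add: e'_def)
    have "\<exists>d>0. \<forall>y\<in>{a..b}. norm (y - x) < d \<longrightarrow> norm (F y - F x - (y - x) *\<^sub>R h x) \<le> e' * norm (y - x)"
      if "x \<in> {a..b} - E" for x
      using deriv[OF that] \<open>e' > 0\<close> unfolding has_vector_derivative_def has_derivative_within_alt by blast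
    then obtain d where d: "\<And>x. x \<in> {a..b} - E \<Longrightarrow> d x > 0"
      "\<And>x y. x \<in> {a..b} - E \<Longrightarrow> y \<in> {a..b} \<Longrightarrow> norm (y - x) < d x \<Longrightarrow>
         norm (F y - F x - (y - x) *\<^sub>R h x) \<le> e' * norm (y - x)"
      by metis
    define \<gamma> where "\<gamma> x = (if x \<in> E then U else if x \<in> {a..b} then ball x (d x) else UNIV)" for x
    have G1: "gauge \<gamma>"
      using U d by (auto simp: gauge_def \<gamma>_def)
    have G2: "norm ((\<Sum>(x, K)\<in>p. measure lborel K *\<^sub>R g x) - (F b - F a)) < e"
      if p: "p tagged_division_of {a..b}" and fine: "\<gamma> fine p" for p
    proof -
      have fin: "finite p" using p by auto
      have K: "\<exists>c d. K = {c..d} \<and> c \<le> d \<and> x \<in> K \<and> a \<le> c \<and> d \<le> b \<and> K \<subseteq> \<gamma> x" if xK: "(x, K) \<in> p" for x K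
      proof -
        have "x \<in> K" "K \<subseteq> {a..b}" "\<exists>c d. K = cbox c d" using tagged_division_ofD(2,3,4)[OF p xK] by auto
        moreover have "K \<subseteq> \<gamma> x" using fine xK by (auto simp: fine_def)
        ultimately show ?thesis by (metis atLeastatMost_subset_iff atLeastAtMost_iff cbox_interval order_trans)
      qed
      define pE where "pE = {xK \<in> p. fst xK \<in> E}"
      have finE: "finite pE" "pE \<subseteq> p" using fin by (auto simp: pE_def)
      \<comment> \<open>Absolute continuity is formulated for finite sequences of intervals, so the
        cells with tag in E are enumerated.\<close>
      obtain k and n :: nat where k: "bij_betw k {0..<n} pE"
        using ex_bij_betw_nat_finite[OF finE(1)] by blast
      define u v where "u i = Inf (snd (k i))" and "v i = Sup (snd (k i))" for i
      have ki: "k i \<in> pE" if "i < n" for i using k that by (auto simp: bij_betw_def)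
      have kuv: "snd (k i) = {u i..v i} \<and> a \<le> u i \<and> u i \<le> v i \<and> v i \<le> b \<and> {u i..v i} \<subseteq> U" if "i < n" for i
        using K[of "fst (k i)" "snd (k i)"] ki[OF that]
        by (auto simp: pE_def u_def v_def \<gamma>_def)
      have disj: "disjoint_family_on (\<lambda>i. {u i<..<v i}) {..<n}"
        unfolding disjoint_family_on_def
      proof (intro ballI impI)
        fix i j assume ij: "i \<in> {..<n}" "j \<in> {..<n}" "i \<noteq> j"
        then have "k i \<noteq> k j" using k by (auto simp: bij_betw_def inj_on_def)
        then have "interior (snd (k i)) \<inter> interior (snd (k j)) = {}"
          using tagged_division_ofD(5)[OF p, of "fst (k i)" "snd (k i)" "fst (k j)" "snd (k j)"]
            ki[of i] ki[of j] ij finE(2) by (auto simp: prod_eq_iff)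
        then show "{u i<..<v i} \<inter> {u j<..<v j} = {}"
          using kuv[of i] kuv[of j] ij by (simp add: interior_atLeastAtMost_real)
      qed
      have "(\<Sum>i<n. v i - u i) = (\<Sum>i<n. measure lebesgue {u i<..<v i})"
        using kuv by (intro sum.cong) auto
      also have "\<dots> = measure lebesgue (\<Union>i<n. {u i<..<v i})"
        by (rule measure_finite_Union[symmetric]) (use disj kuv in \<open>auto simp: emeasure_lborel_Ioo\<close>)
      also have "\<dots> \<le> measure lebesgue U"
        using kuv U by (intro measure_mono_fmeasurable) fastforce+
      finally have "(\<Sum>i<n. v i - u i) < \<delta>" using U by simp
      with \<delta>[of n u v] disj kuv have "(\<Sum>i<n. norm (F (v i) - F (u i))) < e / 2" by auto
      moreover have "(\<Sum>(x, K)\<in>pE. norm (F (Sup K) - F (Inf K))) = (\<Sum>i<n. norm (F (v i) - F (u i)))"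
        using sum.reindex_bij_betw[OF k, of "\<lambda>(x, K). norm (F (Sup K) - F (Inf K))"]
        by (simp add: u_def v_def split_beta atLeast0LessThan)
      ultimately have bad: "(\<Sum>(x, K)\<in>pE. norm (F (Sup K) - F (Inf K))) < e / 2" by simp
      let ?D = "\<lambda>(x, K). measure lborel K *\<^sub>R g x - (F (Sup K) - F (Inf K))"
      have "norm (?D (x, K)) \<le> e' * (Sup K - Inf K)" if xK: "(x, K) \<in> p - pE" for x K
      proof -
        from xK have "x \<notin> E" by (auto simp: pE_def)
        from K[of x K] xK obtain c d' where c: "K = {c..d'}" "c \<le> x" "x \<le> d'" "a \<le> c" "d' \<le> b" "K \<subseteq> \<gamma> x"
          by auto
        have x: "x \<in> {a..b} - E" using c \<open>x \<notin> E\<close> by auto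
        have "{c..d'} \<subseteq> ball x (d x)" using c x by (simp add: \<gamma>_def)
        moreover have "c \<in> {c..d'}" "d' \<in> {c..d'}" using c by auto
        ultimately have "c \<in> ball x (d x)" "d' \<in> ball x (d x)" by blast+
        then have n1: "norm (F c - F x - (c - x) *\<^sub>R h x) \<le> e' * (x - c)"
           and n2: "norm (F d' - F x - (d' - x) *\<^sub>R h x) \<le> e' * (d' - x)"
          using d(2)[OF x, of c] d(2)[OF x, of d'] c by (auto simp: dist_real_def)
        \<comment> \<open>The tag splits the cell, and the differentiability estimate is used from x
          to each end point.\<close>
        have eq: "?D (x, K) = (F c - F x - (c - x) *\<^sub>R h x) - (F d' - F x - (d' - x) *\<^sub>R h x)"
          using c \<open>x \<notin> E\<close> by (simp add: g_def algebra_simps)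
        have "norm (?D (x, K)) \<le> e' * (x - c) + e' * (d' - x)"
          unfolding eq by (rule order_trans[OF norm_triangle_ineq4 add_mono[OF n1 n2]])
        then show ?thesis using c by (simp add: algebra_simps)
      qed
      then have "(\<Sum>xK\<in>p - pE. norm (?D xK)) \<le> (\<Sum>(x, K)\<in>p - pE. e' * (Sup K - Inf K))"
        by (intro sum_mono) (simp only: split_paired_all prod.case)
      also have "\<dots> \<le> (\<Sum>(x, K)\<in>p. e' * (Sup K - Inf K))"
      proof (rule sum_mono2)
        fix xK assume "xK \<in> p - (p - pE)"
        then have "Inf (snd xK) \<le> Sup (snd xK)" using K[of "fst xK" "snd xK"] by auto
        then show "0 \<le> (case xK of (x, K) \<Rightarrow> e' * (Sup K - Inf K))"
          using \<open>e' > 0\<close> by (simp add: split_beta)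
      qed (use fin in auto)
      also have "\<dots> = e' * (b - a)"
        using additive_tagged_division_1[OF \<open>a \<le> b\<close> p, of "\<lambda>x. x"]
        by (simp add: sum_distrib_left[symmetric] split_beta)
      also have "\<dots> < e / 2"
        using \<open>e > 0\<close> \<open>a \<le> b\<close> by (simp add: e'_def field_simps)
      finally have good: "(\<Sum>xK\<in>p - pE. norm (?D xK)) < e / 2" .
      have "(\<Sum>xK\<in>pE. norm (?D xK)) = (\<Sum>(x, K)\<in>pE. norm (F (Sup K) - F (Inf K)))"
        by (intro sum.cong) (auto simp: pE_def g_def norm_minus_commute)
      then have "(\<Sum>xK\<in>p. norm (?D xK)) < e"
        using sum.subset_diff[OF finE(2) fin, of "\<lambda>xK. norm (?D xK)"] bad good by simp
      moreover have "(\<Sum>(x, K)\<in>p. measure lborel K *\<^sub>R g x) - (F b - F a) = (\<Sum>xK\<in>p. ?D xK)"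
        using additive_tagged_division_1[OF \<open>a \<le> b\<close> p, of F]
        by (simp add: sum_subtractf split_beta)
      ultimately show ?thesis
        by (simp only:) (rule order_le_less_trans[OF norm_sum])
    qed
    show "\<exists>\<gamma>. gauge \<gamma> \<and> (\<forall>p. p tagged_division_of {a..b} \<and> \<gamma> fine p \<longrightarrow>
        norm ((\<Sum>(x, K)\<in>p. measure lborel K *\<^sub>R g x) - (F b - F a)) < e)"
      by (intro exI[of _ \<gamma>] conjI allI impI G1) (elim conjE, rule G2)
  qed
  then show ?thesis
    by (rule has_integral_spike[OF E, rotated]) (simp add: g_def)
qed

section \<open>Functions of class C^r\<close>

lemma Cr_on_imp_continuous_on: "Cr_on r I F \<Longrightarrow> continuous_on I F"
  by (cases r) (auto intro: continuous_on_vector_derivative)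

lemma Cr_on_SucD: "Cr_on (Suc r) I F \<Longrightarrow> Cr_on r I F"
proof (induction r arbitrary: F)
  case 0
  then show ?case using Cr_on_imp_continuous_on[OF 0] by simp
next
  case (Suc r)
  from Suc.prems obtain F' where F': "\<forall>x\<in>I. (F has_vector_derivative F' x) (at x within I)" "Cr_on (Suc r) I F'"
    unfolding Cr_on.simps(2)[of "Suc r"] by blast
  show ?case unfolding Cr_on.simps by (intro exI[of _ F'] conjI F'(1) Suc.IH F'(2))
qed

lemma Cr_on_const: "Cr_on r I (\<lambda>x. c)"
proof (induction r arbitrary: c)
  case (Suc r)
  then show ?case by (auto intro!: exI[of _ "\<lambda>x. 0"] derivative_eq_intros)
qed simp

lemma Cr_on_add: "Cr_on r I F \<Longrightarrow> Cr_on r I G \<Longrightarrow> Cr_on r I (\<lambda>x. F x + G x)"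
proof (induction r arbitrary: F G)
  case 0
  then show ?case by (simp add: continuous_on_add)
next
  case (Suc r)
  then obtain F' G' where d: "\<forall>x\<in>I. (F has_vector_derivative F' x) (at x within I)" "Cr_on r I F'"
    "\<forall>x\<in>I. (G has_vector_derivative G' x) (at x within I)" "Cr_on r I G'" by auto
  have "\<forall>x\<in>I. ((\<lambda>x. F x + G x) has_vector_derivative F' x + G' x) (at x within I)"
    using d(1,3) by (simp add: has_vector_derivative_add)
  then show ?case
    unfolding Cr_on.simps by (intro exI[of _ "\<lambda>x. F' x + G' x"] conjI Suc.IH d(2,4))
qed

lemma Cr_on_bounded_linear: "bounded_linear L \<Longrightarrow> Cr_on r I F \<Longrightarrow> Cr_on r I (\<lambda>x. L (F x))"
proof (induction r arbitrary: F)
  case 0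
  then show ?case by (simp add: bounded_linear.continuous_on)
next
  case (Suc r)
  then obtain F' where F': "\<forall>x\<in>I. (F has_vector_derivative F' x) (at x within I)" "Cr_on r I F'" by auto
  have "\<forall>x\<in>I. ((\<lambda>x. L (F x)) has_vector_derivative L (F' x)) (at x within I)"
    using F'(1) by (simp add: bounded_linear.has_vector_derivative[OF Suc.prems(1)])
  then show ?case
    unfolding Cr_on.simps by (intro exI[of _ "\<lambda>x. L (F' x)"] conjI Suc.IH Suc.prems(1) F'(2))
qed

lemma Cr_on_mult:
  fixes F G :: "real \<Rightarrow> 'a::real_normed_algebra"
  shows "Cr_on r I F \<Longrightarrow> Cr_on r I G \<Longrightarrow> Cr_on r I (\<lambda>x. F x * G x)"
proof (induction r arbitrary: F G)
  case 0
  then show ?case by (simp add: continuous_on_mult)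
next
  case (Suc r)
  from Suc.prems obtain F' G' where "\<forall>x\<in>I. (F has_vector_derivative F' x) (at x within I)" "Cr_on r I F'"
    "\<forall>x\<in>I. (G has_vector_derivative G' x) (at x within I)" "Cr_on r I G'" by auto
  note d = this
  have c1: "Cr_on r I (\<lambda>x. F x * G' x + F' x * G x)"
    using d(2,4) Cr_on_SucD[OF Suc.prems(1)] Cr_on_SucD[OF Suc.prems(2)] by (intro Cr_on_add Suc.IH)
  have c2: "\<forall>x\<in>I. ((\<lambda>x. F x * G x) has_vector_derivative F x * G' x + F' x * G x) (at x within I)"
    using d(1,3) by (simp add: has_vector_derivative_mult)
  show ?case
    unfolding Cr_on.simps
    by (rule exI[of _ "\<lambda>x. F x * G' x + F' x * G x"], rule conjI, rule c2, rule c1)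
qed

lemma Cr_on_Pair: 
  assumes "Cr_on r I F" "Cr_on r I G" shows "Cr_on r I (\<lambda>x. (F x, G x))"
proof -
  have "bounded_linear (\<lambda>x. (x, 0))" "bounded_linear (\<lambda>x. (0, x))"
    by (intro bounded_linear_Pair bounded_linear_ident bounded_linear_zero)+
  from Cr_on_add[OF Cr_on_bounded_linear[OF this(1) assms(1)] Cr_on_bounded_linear[OF this(2) assms(2)]]
  show ?thesis by simp
qed

section \<open>A Jackson inequality in the mean square\<close>

definition cos_poly :: "nat \<Rightarrow> (real \<Rightarrow> complex) \<Rightarrow> bool" where
  "cos_poly D f \<longleftrightarrow> (\<exists>a. \<forall>\<theta>. f \<theta> = (\<Sum>n\<le>D. cos (real n * \<theta>) *\<^sub>R a n))"

lemma cos_poly_cos: "n \<le> D \<Longrightarrow> cos_poly D (\<lambda>\<theta>. cos (real n * \<theta>) *\<^sub>R z)"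
  unfolding cos_poly_def
  by (rule exI[of _ "\<lambda>m. if m = n then z else 0"]) (simp add: if_distrib cong: if_cong)

lemma cos_poly_add: "cos_poly D f \<Longrightarrow> cos_poly D g \<Longrightarrow> cos_poly D (\<lambda>\<theta>. f \<theta> + g \<theta>)"
  unfolding cos_poly_def
proof (elim exE)
  fix a c assume "\<forall>\<theta>. f \<theta> = (\<Sum>n\<le>D. cos (real n * \<theta>) *\<^sub>R a n)" "\<forall>\<theta>. g \<theta> = (\<Sum>n\<le>D. cos (real n * \<theta>) *\<^sub>R c n)"
  then show "\<exists>a. \<forall>\<theta>. f \<theta> + g \<theta> = (\<Sum>n\<le>D. cos (real n * \<theta>) *\<^sub>R a n)"
    by (intro exI[of _ "\<lambda>n. a n + c n"]) (simp add: scaleR_right_distrib sum.distrib)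
qed

lemma cos_poly_sum: "(\<And>i. i \<in> A \<Longrightarrow> cos_poly D (f i)) \<Longrightarrow> cos_poly D (\<lambda>\<theta>. \<Sum>i\<in>A. f i \<theta>)"
proof (induction A rule: infinite_finite_induct)
  case (insert x A)
  then show ?case by (simp add: cos_poly_add)
qed (use cos_poly_cos[of 0 D 0] in simp_all)

lemma cos_poly_mult_cos:
  assumes "cos_poly D f" shows "cos_poly (Suc D) (\<lambda>\<theta>. of_real (c * cos \<theta>) * f \<theta>)"
proof -
  obtain a where a: "\<And>\<theta>. f \<theta> = (\<Sum>n\<le>D. cos (real n * \<theta>) *\<^sub>R a n)"
    using assms by (auto simp: cos_poly_def)
  \<comment> \<open>At n = 0 the lower frequency n - 1 is -1; cosine is even, so it is replaced by
    1.\<close>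
  have *: "c * cos \<theta> * cos (real n * \<theta>) = c / 2 * cos (real (Suc n) * \<theta>) + c / 2 * cos (real (if n = 0 then 1 else n - 1) * \<theta>)"
    for n \<theta>
    by (cases n) (simp_all add: cos_times_cos algebra_simps)
  have "(\<lambda>\<theta>. of_real (c * cos \<theta>) * f \<theta>) = (\<lambda>\<theta>. \<Sum>n\<le>D. cos (real (Suc n) * \<theta>) *\<^sub>R ((c / 2) *\<^sub>R a n)
      + cos (real (if n = 0 then 1 else n - 1) * \<theta>) *\<^sub>R ((c / 2) *\<^sub>R a n))"
  proof
    fix \<theta>
    have "of_real (c * cos \<theta>) * f \<theta> = (\<Sum>n\<le>D. (c * cos \<theta> * cos (real n * \<theta>)) *\<^sub>R a n)"
      by (simp add: a sum_distrib_left scaleR_conv_of_real mult.assoc)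
    also have "\<dots> = (\<Sum>n\<le>D. cos (real (Suc n) * \<theta>) *\<^sub>R ((c / 2) *\<^sub>R a n)
      + cos (real (if n = 0 then 1 else n - 1) * \<theta>) *\<^sub>R ((c / 2) *\<^sub>R a n))"
      unfolding * by (simp add: scaleR_left_distrib mult.commute)
    finally show "of_real (c * cos \<theta>) * f \<theta> = \<dots>" .
  qed
  moreover have "cos_poly (Suc D) (\<lambda>\<theta>. cos (real (Suc n) * \<theta>) *\<^sub>R ((c / 2) *\<^sub>R a n)
      + cos (real (if n = 0 then 1 else n - 1) * \<theta>) *\<^sub>R ((c / 2) *\<^sub>R a n))" if "n \<le> D" for n
    using that by (intro cos_poly_add cos_poly_cos) auto
  ultimately show ?thesis by (simp only:) (rule cos_poly_sum, simp)
qed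

lemma cos_poly_of_poly:
  fixes S :: "complex poly"
  shows "\<exists>D. cos_poly D (\<lambda>\<theta>. poly S (of_real (c * cos \<theta>)))"
proof (induction S)
  case 0
  then show ?case using cos_poly_cos[of 0 0 0] by auto
next
  case (pCons a S)
  then obtain D where "cos_poly D (\<lambda>\<theta>. poly S (of_real (c * cos \<theta>)))" by blast
  from cos_poly_add[OF cos_poly_cos[of 0 "Suc D" a] cos_poly_mult_cos[OF this, of c]]
  show ?case by auto
qed

text \<open>These are the Chebyshev polynomials rescaled to [-c, c], obtained from their three-term
  recurrence.\<close>

lemma cos_multiple_poly:
  assumes "c \<noteq> 0"
  shows "\<exists>T::complex poly. degree T \<le> n \<and> (\<forall>\<theta>. poly T (of_real (c * cos \<theta>)) = of_real (cos (real n * \<theta>)))"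
proof (induction n rule: induct_nat_012)
  case 0
  show ?case by (rule exI[of _ 1]) simp
next
  case 1
  show ?case by (rule exI[of _ "[:0, of_real (1 / c):]"]) (use assms in simp)
next
  case (ge2 n)
  then obtain T U :: "complex poly" where T: "degree T \<le> n" "\<And>\<theta>. poly T (of_real (c * cos \<theta>)) = of_real (cos (real n * \<theta>))"
    and U: "degree U \<le> Suc n" "\<And>\<theta>. poly U (of_real (c * cos \<theta>)) = of_real (cos (real (Suc n) * \<theta>))"
    by blast
  have "cos (real (Suc (Suc n)) * \<theta>) = 2 * cos \<theta> * cos (real (Suc n) * \<theta>) - cos (real n * \<theta>)" for \<theta>
    using cos_times_cos[of "real (Suc n) * \<theta>" \<theta>] by (simp add: algebra_simps)
  moreover have "degree ([:0, of_real (2 / c):] * U - T) \<le> Suc (Suc n)"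
    using T(1) U(1) by (intro degree_diff_le) (auto intro: order_trans[OF degree_mult_le] simp: degree_pCons_le)
  ultimately show ?case
    using T(2) U(2) assms by (intro exI[of _ "[:0, of_real (2 / c):] * U - T"]) auto
qed

lemma integral_cos_multiple:
  fixes k :: int
  assumes "k \<noteq> 0" shows "((\<lambda>\<theta>. cos (of_int k * \<theta>)) has_integral 0) {0..pi}"
proof -
  have "((\<lambda>\<theta>. cos (of_int k * \<theta>)) has_integral (sin (of_int k * pi) / of_int k - sin (of_int k * 0) / of_int k)) {0..pi}"
    by (rule fundamental_theorem_of_calculus)
      (use assms in \<open>auto simp: has_real_derivative_iff_has_vector_derivative[symmetric] intro!: derivative_eq_intros\<close>)
  then show ?thesis by (simp add: sin_int_times_real mult.commute)
qed

text \<open>Frequency 0 is left out because the constant has square norm pi instead of pi / 2. Only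
  positive frequencies occur later: truncation removes the constant term and so does
  differentiation.\<close>

lemma integral_cos_cos_sin_sin:
  fixes m n :: nat
  assumes "n > 0"
  shows "((\<lambda>\<theta>. cos (real n * \<theta>) * cos (real m * \<theta>)) has_integral (if m = n then pi / 2 else 0)) {0..pi}"
    and "((\<lambda>\<theta>. sin (real n * \<theta>) * sin (real m * \<theta>)) has_integral (if m = n then pi / 2 else 0)) {0..pi}"
proof -
  have p: "((\<lambda>\<theta>. cos (of_int (int n + int m) * \<theta>)) has_integral 0) {0..pi}"
    by (rule integral_cos_multiple) (use assms in simp)
  have sym: "cos (\<theta> * real n - \<theta> * real m) = cos (\<theta> * real m - \<theta> * real n)" for \<theta>
    using cos_minus[of "\<theta> * real n - \<theta> * real m"] by simp
  have d: "((\<lambda>\<theta>. cos (of_int (int n - int m) * \<theta>)) has_integral (if m = n then pi else 0)) {0..pi}"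
    using integral_cos_multiple[of "int n - int m"] has_integral_const_real[of "1::real" 0 pi] by auto
  show "((\<lambda>\<theta>. cos (real n * \<theta>) * cos (real m * \<theta>)) has_integral (if m = n then pi / 2 else 0)) {0..pi}"
    using has_integral_divide[OF has_integral_add[OF d p], of 2]
    by (auto simp: cos_times_cos algebra_simps sym split: if_splits)
  show "((\<lambda>\<theta>. sin (real n * \<theta>) * sin (real m * \<theta>)) has_integral (if m = n then pi / 2 else 0)) {0..pi}"
    using has_integral_divide[OF has_integral_diff[OF d p], of 2]
    by (auto simp: sin_times_sin algebra_simps sym split: if_splits)
qed

lemma parseval_finite:
  fixes a :: "nat \<Rightarrow> 'a::real_inner" and \<phi> :: "nat \<Rightarrow> real \<Rightarrow> real"
  assumes "finite A"
    and orth: "\<And>n m. n \<in> A \<Longrightarrow> m \<in> A \<Longrightarrow> ((\<lambda>\<theta>. \<phi> n \<theta> * \<phi> m \<theta>) has_integral (if m = n then w else 0)) {l..h}"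
  shows "((\<lambda>\<theta>. (norm (\<Sum>n\<in>A. \<phi> n \<theta> *\<^sub>R a n))\<^sup>2) has_integral w * (\<Sum>n\<in>A. (norm (a n))\<^sup>2)) {l..h}"
proof -
  have "((\<lambda>\<theta>. \<Sum>n\<in>A. \<Sum>m\<in>A. (\<phi> n \<theta> * \<phi> m \<theta>) * (a m \<bullet> a n)) has_integral
     (\<Sum>n\<in>A. \<Sum>m\<in>A. (if m = n then w else 0) * (a m \<bullet> a n))) {l..h}"
    by (intro has_integral_sum has_integral_mult_left orth assms(1))
  moreover have "(\<Sum>n\<in>A. \<Sum>m\<in>A. (if m = n then w else 0) * (a m \<bullet> a n)) = w * (\<Sum>n\<in>A. (norm (a n))\<^sup>2)"
    using assms(1) by (simp add: if_distrib[of "\<lambda>x. x * _"] sum_distrib_left power2_norm_eq_inner cong: if_cong)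
  moreover have "(norm (\<Sum>n\<in>A. \<phi> n \<theta> *\<^sub>R a n))\<^sup>2 = (\<Sum>n\<in>A. \<Sum>m\<in>A. (\<phi> n \<theta> * \<phi> m \<theta>) * (a m \<bullet> a n))" for \<theta>
    by (simp add: power2_norm_eq_inner inner_sum_left inner_sum_right sum_distrib_left mult.assoc)
  ultimately show ?thesis by simp
qed

lemma integral_cos_substitution:
  fixes G :: "real \<Rightarrow> real"
  assumes "c > 0" "continuous_on {-c..c} G"
  shows "integral {0..pi} (\<lambda>\<theta>. c * sin \<theta> * G (c * cos \<theta>)) = integral {-c..c} G"
proof -
  have "((\<lambda>x. (- c * sin x) *\<^sub>R G (c * cos x)) has_integral
     (integral {c * cos 0..c * cos pi} G - integral {c * cos pi..c * cos 0} G)) {0..pi}"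
  proof (rule has_integral_substitution_general[where s="{}" and c="-c" and d=c])
    show "(\<lambda>x. c * cos x) ` {0..pi} \<subseteq> {- c..c}"
    proof safe
      fix x :: real
      have "\<bar>c * cos x\<bar> \<le> c"
        using assms(1) mult_left_mono[of "\<bar>cos x\<bar>" 1 c] by (simp add: abs_mult)
      then show "c * cos x \<in> {-c..c}" by auto
    qed
  qed (use assms in \<open>auto intro!: continuous_intros derivative_eq_intros\<close>)
  then have "((\<lambda>x. - ((- c * sin x) *\<^sub>R G (c * cos x))) has_integral
     - (integral {c * cos 0..c * cos pi} G - integral {c * cos pi..c * cos 0} G)) {0..pi}"
    by (rule has_integral_neg)
  then show ?thesis using assms(1) by (auto simp: integral_unique)
qed

text \<open>With \<open>t = c cos \<theta>\<close> the polynomial becomes a finite cosine sum, which is truncated; the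
  weight \<open>sin \<theta> \<le> 1\<close> of the substitution is favourable on both sides.\<close>

lemma jackson_L2:
  fixes S :: "complex poly"
  assumes "c > 0"
  shows "\<exists>T. degree T \<le> N \<and> msq (-c) c (\<lambda>t. poly (S - T) (of_real t))
     \<le> (c / real (N + 1))\<^sup>2 * msq (-c) c (\<lambda>t. poly (pderiv S) (of_real t))"
proof -
  obtain D a where a: "\<And>\<theta>. poly S (of_real (c * cos \<theta>)) = (\<Sum>n\<le>D. cos (real n * \<theta>) *\<^sub>R a n)"
    using cos_poly_of_poly[of S c] by (auto simp: cos_poly_def)
  have "\<forall>n. \<exists>T::complex poly. degree T \<le> n \<and> (\<forall>\<theta>. poly T (of_real (c * cos \<theta>)) = of_real (cos (real n * \<theta>)))"
    using assms by (intro allI cos_multiple_poly) simp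
  then obtain Ch :: "nat \<Rightarrow> complex poly" where Ch: "\<And>n. degree (Ch n) \<le> n"
     "\<And>n \<theta>. poly (Ch n) (of_real (c * cos \<theta>)) = of_real (cos (real n * \<theta>))"
    by metis
  define T where "T = (\<Sum>n | n \<le> D \<and> n \<le> N. smult (a n) (Ch n))"
  define A where "A = {n. n \<le> D \<and> N < n}"
  have "finite A" by (simp add: A_def)
  have deg: "degree T \<le> N"
    unfolding T_def by (intro degree_sum_le) (auto intro: order_trans[OF degree_smult_le] order_trans[OF Ch(1)])
  have diff: "poly (S - T) (of_real (c * cos \<theta>)) = (\<Sum>n\<in>A. cos (real n * \<theta>) *\<^sub>R a n)" for \<theta>
  proof -
    have "{..D} = {n. n \<le> D \<and> n \<le> N} \<union> A" "{n. n \<le> D \<and> n \<le> N} \<inter> A = {}" by (auto simp: A_def)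
    then have "(\<Sum>n\<le>D. cos (real n * \<theta>) *\<^sub>R a n) = (\<Sum>n | n \<le> D \<and> n \<le> N. cos (real n * \<theta>) *\<^sub>R a n) + (\<Sum>n\<in>A. cos (real n * \<theta>) *\<^sub>R a n)"
      using \<open>finite A\<close> by (simp add: sum.union_disjoint)
    then show ?thesis
      using Ch(2)[of _ \<theta>] a[of \<theta>] by (simp add: T_def poly_sum scaleR_conv_of_real mult.commute)
  qed
  \<comment> \<open>Differentiation in \<theta> turns cosine coefficients a_n into sine coefficients
    n a_n, up to sign. Both families have the same normalisation, so the two Parseval sums can be
    compared term by term.\<close>
  have deriv: "of_real (c * sin \<theta>) * poly (pderiv S) (of_real (c * cos \<theta>)) = (\<Sum>n\<in>{1..D}. sin (real n * \<theta>) *\<^sub>R (real n *\<^sub>R a n))" for \<theta>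
  proof -
    have 1: "((\<lambda>\<theta>. poly S (of_real (c * cos \<theta>))) has_vector_derivative
        of_real (- c * sin \<theta>) * poly (pderiv S) (of_real (c * cos \<theta>))) (at \<theta>)"
    proof -
      have "((\<lambda>\<theta>. of_real (c * cos \<theta>) :: complex) has_vector_derivative of_real (- c * sin \<theta>)) (at \<theta>)"
        by (intro has_vector_derivative_of_real) (auto intro!: derivative_eq_intros)
      from field_vector_diff_chain_at[OF this, of "poly S" "poly (pderiv S) (of_real (c * cos \<theta>))"]
      show ?thesis by (simp add: o_def poly_DERIV)
    qed
    have 2: "((\<lambda>\<theta>. \<Sum>n\<le>D. cos (real n * \<theta>) *\<^sub>R a n) has_vector_derivative
        (\<Sum>n\<le>D. (- (real n * sin (real n * \<theta>))) *\<^sub>R a n)) (at \<theta>)"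
      by (intro has_vector_derivative_sum has_vector_derivative_scaleR[THEN has_vector_derivative_eq_rhs] derivative_intros)
        (auto simp: has_real_derivative_iff_has_vector_derivative[symmetric] intro!: derivative_eq_intros)
    have "of_real (- c * sin \<theta>) * poly (pderiv S) (of_real (c * cos \<theta>)) = (\<Sum>n\<le>D. (- (real n * sin (real n * \<theta>))) *\<^sub>R a n)"
      by (rule vector_derivative_unique_at[OF 1]) (subst a, rule 2)
    also have "\<dots> = (\<Sum>n\<in>{1..D}. (- (real n * sin (real n * \<theta>))) *\<^sub>R a n)"
      by (rule sum.mono_neutral_right) (auto simp: not_le)
    finally show ?thesis by (simp add: sum_negf mult.commute)
  qed
  have cp: "continuous_on B (\<lambda>t. (cmod (poly P (of_real (f t))))\<^sup>2)" if "continuous_on B f" for P and f :: "real \<Rightarrow> real" and B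
    by (intro continuous_intros that)
  have E: "((\<lambda>\<theta>. (cmod (poly (S - T) (of_real (c * cos \<theta>))))\<^sup>2) has_integral pi / 2 * (\<Sum>n\<in>A. (cmod (a n))\<^sup>2)) {0..pi}"
    unfolding diff by (rule parseval_finite) (use integral_cos_cos_sin_sin in \<open>auto simp: A_def\<close>)
  have F: "((\<lambda>\<theta>. (cmod (of_real (c * sin \<theta>) * poly (pderiv S) (of_real (c * cos \<theta>))))\<^sup>2) has_integral
      pi / 2 * (\<Sum>n\<in>{1..D}. (cmod (real n *\<^sub>R a n))\<^sup>2)) {0..pi}"
    unfolding deriv by (rule parseval_finite) (use integral_cos_cos_sin_sin in auto)
  have "msq (-c) c (\<lambda>t. poly (S - T) (of_real t))
    = integral {0..pi} (\<lambda>\<theta>. c * sin \<theta> * (cmod (poly (S - T) (of_real (c * cos \<theta>))))\<^sup>2)"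
    by (rule integral_cos_substitution[symmetric, OF assms]) (intro continuous_intros)
  also have "\<dots> \<le> integral {0..pi} (\<lambda>\<theta>. c * (cmod (poly (S - T) (of_real (c * cos \<theta>))))\<^sup>2)"
    using assms by (intro integral_le integrable_continuous_real continuous_intros mult_right_mono) (auto simp: mult_left_le)
  also have "\<dots> = c * (pi / 2 * (\<Sum>n\<in>A. (cmod (a n))\<^sup>2))"
    using E by (simp add: integral_unique)
  \<comment> \<open>In the tail n is at least N + 1; this is the whole gain.\<close>
  also have "(\<Sum>n\<in>A. (cmod (a n))\<^sup>2) \<le> (\<Sum>n\<in>A. (cmod (real n *\<^sub>R a n))\<^sup>2 / (real (N + 1))\<^sup>2)"
  proof (rule sum_mono)
    fix n assume "n \<in> A"
    then have "(real (N + 1))\<^sup>2 \<le> (real n)\<^sup>2" by (intro power_mono) (auto simp: A_def)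
    then have "(real (N + 1))\<^sup>2 * (cmod (a n))\<^sup>2 \<le> (real n)\<^sup>2 * (cmod (a n))\<^sup>2" by (rule mult_right_mono) simp
    then show "(cmod (a n))\<^sup>2 \<le> (cmod (real n *\<^sub>R a n))\<^sup>2 / (real (N + 1))\<^sup>2"
      by (simp add: field_simps power_mult_distrib)
  qed
  also have "\<dots> \<le> (\<Sum>n\<in>{1..D}. (cmod (real n *\<^sub>R a n))\<^sup>2 / (real (N + 1))\<^sup>2)"
    by (rule sum_mono2) (auto simp: A_def)
  also have "\<dots> = (\<Sum>n\<in>{1..D}. (cmod (real n *\<^sub>R a n))\<^sup>2) / (real (N + 1))\<^sup>2" by (simp only: sum_divide_distrib)
  finally have "msq (-c) c (\<lambda>t. poly (S - T) (of_real t))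
    \<le> c / (real (N + 1))\<^sup>2 * (pi / 2 * (\<Sum>n\<in>{1..D}. (cmod (real n *\<^sub>R a n))\<^sup>2))"
    using assms by (simp add: mult_left_mono)
  also have "pi / 2 * (\<Sum>n\<in>{1..D}. (cmod (real n *\<^sub>R a n))\<^sup>2)
     = msq 0 pi (\<lambda>\<theta>. of_real (c * sin \<theta>) * poly (pderiv S) (of_real (c * cos \<theta>)))"
    using F by (simp add: integral_unique)
  also have "\<dots> \<le> integral {0..pi} (\<lambda>\<theta>. c * (c * sin \<theta> * (cmod (poly (pderiv S) (of_real (c * cos \<theta>))))\<^sup>2))"
  proof (intro integral_le integrable_continuous_real continuous_intros)
    fix \<theta> assume "\<theta> \<in> {0..pi}"
    then have "0 \<le> sin \<theta>" "sin \<theta> \<le> 1" by (auto intro: sin_ge_zero)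
    then have "(sin \<theta>)\<^sup>2 \<le> sin \<theta>" by (simp add: power2_eq_square mult_left_le)
    then have "c\<^sup>2 * (sin \<theta>)\<^sup>2 * (cmod (poly (pderiv S) (of_real (c * cos \<theta>))))\<^sup>2 \<le> c\<^sup>2 * sin \<theta> * (cmod (poly (pderiv S) (of_real (c * cos \<theta>))))\<^sup>2"
      by (intro mult_right_mono mult_left_mono) auto
    then show "(cmod (of_real (c * sin \<theta>) * poly (pderiv S) (of_real (c * cos \<theta>))))\<^sup>2
      \<le> c * (c * sin \<theta> * (cmod (poly (pderiv S) (of_real (c * cos \<theta>))))\<^sup>2)"
      by (simp only: norm_mult norm_of_real power_mult_distrib power2_abs) (simp add: power2_eq_square mult.assoc)
  qed
  also have "\<dots> = c * msq (-c) c (\<lambda>t. poly (pderiv S) (of_real t))"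
    by (subst integral_cos_substitution[OF assms, symmetric]) (auto intro!: continuous_intros)
  finally have "msq (-c) c (\<lambda>t. poly (S - T) (of_real t))
     \<le> c / (real (N + 1))\<^sup>2 * (c * msq (-c) c (\<lambda>t. poly (pderiv S) (of_real t)))"
    using assms by (simp add: mult_left_mono divide_right_mono)
  then show ?thesis
    using deg by (intro exI[of _ T]) (simp add: power2_eq_square)
qed

section \<open>Uniform and one-sided polynomial approximation\<close>

lemma Weierstrass_complex_poly:
  fixes k :: "real \<Rightarrow> complex"
  assumes "compact S" "continuous_on S k" "e > 0"
  shows "\<exists>R::complex poly. \<forall>t\<in>S. cmod (poly R (of_real t) - k t) \<le> e"
proof -
  have "continuous_on S (\<lambda>t. Re (k t))" "continuous_on S (\<lambda>t. Im (k t))"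
    using assms(2) by (auto intro: continuous_intros)
  then obtain g1 g2 where g: "real_polynomial_function g1" "\<And>t. t \<in> S \<Longrightarrow> \<bar>Re (k t) - g1 t\<bar> < e / 2"
     "real_polynomial_function g2" "\<And>t. t \<in> S \<Longrightarrow> \<bar>Im (k t) - g2 t\<bar> < e / 2"
    using Stone_Weierstrass_real_polynomial_function[OF assms(1), where e="e/2"] assms(3)
    by (metis (no_types, lifting) half_gt_zero)
  then obtain a m c n where ac: "g1 = (\<lambda>x. \<Sum>i\<le>m. a i * x^i)" "g2 = (\<lambda>x. \<Sum>i\<le>n. c i * x^i)"
    by (metis real_polynomial_function_iff_sum)
  define R where "R = (\<Sum>i\<le>m. monom (complex_of_real (a i)) i) + (\<Sum>i\<le>n. monom (\<i> * complex_of_real (c i)) i)"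
  have "poly R (of_real t) = Complex (g1 t) (g2 t)" for t
    by (simp add: R_def ac poly_sum poly_monom Complex_eq sum_distrib_left mult.assoc)
  then have "cmod (poly R (of_real t) - k t) \<le> e" if "t \<in> S" for t
    using cmod_le[of "Complex (g1 t) (g2 t) - k t"] g(2)[OF that] g(4)[OF that]
    by (simp add: abs_minus_commute)
  then show ?thesis by blast
qed

text \<open>The target, h continued by 0 to negative t, may jump at 0, and then no polynomial is
  uniformly close to it. The factor 1 - exp(-n t) removes the jump at the price of a boundary layer
  of width about 1/n, which is harmless in mean square.\<close>

lemma one_sided_L2_poly_approx:
  fixes h :: "real \<Rightarrow> complex"
  assumes "c > 0" and h: "continuous_on {0..c} h" and "\<epsilon> > 0"
  shows "\<exists>R::complex poly. msq (-c) 0 (\<lambda>t. poly R (of_real t)) \<le> \<epsilon>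
     \<and> msq 0 c (\<lambda>t. poly R (of_real t) - h t) \<le> \<epsilon>"
proof -
  obtain M where M: "\<And>t. t \<in> {0..c} \<Longrightarrow> cmod (h t) \<le> M"
    using compact_imp_bounded[OF compact_continuous_image[OF h compact_Icc]] unfolding bounded_iff by blast
  have "0 \<le> M" using order_trans[OF norm_ge_zero M[of 0]] assms(1) by simp
  \<comment> \<open>The boundary layer contributes at most 2 M^2 / n, which is at most \<epsilon> /
    2 for this n; the summand 1 keeps n positive when M = 0.\<close>
  define n where "n = 4 * (M\<^sup>2 + 1) / \<epsilon>"
  have "n > 0" using assms(3) by (simp add: n_def add_nonneg_pos)
  define k where "k t = of_real (1 - exp (- (n * max 0 t))) * h (max 0 t)" for t
  \<comment> \<open>The uniform error contributes 2 c e^2, which is the other \<epsilon> /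
    2.\<close>
  define e where "e = sqrt (\<epsilon> / (4 * c))"
  have e: "e > 0" "e\<^sup>2 = \<epsilon> / (4 * c)" using assms by (auto simp: e_def)
  have "continuous_on {-c..c} k"
    unfolding k_def using assms(1)
    by (intro continuous_intros continuous_on_compose2[OF h]) auto
  then obtain R :: "complex poly" where R: "\<And>t. t \<in> {-c..c} \<Longrightarrow> cmod (poly R (of_real t) - k t) \<le> e"
    using Weierstrass_complex_poly[of "{-c..c}" k e] e(1) by blast
  have neg: "(cmod (poly R (of_real t)))\<^sup>2 \<le> e\<^sup>2" if "t \<in> {-c..0}" for t
  proof -
    have "k t = 0" using that by (simp add: k_def)
    then show ?thesis using R[of t] that assms(1) by (simp add: power_mono)
  qed
  have pos: "(cmod (poly R (of_real t) - h t))\<^sup>2 \<le> 2 * e\<^sup>2 + 2 * M\<^sup>2 * exp (- (n * t))" if t: "t \<in> {0..c}" for t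
  proof -
    have "k t - h t = - (of_real (exp (- (n * t))) * h t)" using t by (simp add: k_def algebra_simps)
    then have "cmod (k t - h t) \<le> exp (- (n * t)) * M"
      using M[OF t] by (simp add: norm_mult)
    then have "(cmod (k t - h t))\<^sup>2 \<le> (exp (- (n * t)) * M)\<^sup>2" by (rule power_mono) simp
    also have "\<dots> = exp (- (n * t)) * (exp (- (n * t)) * M\<^sup>2)" by (simp add: power2_eq_square)
    also have "\<dots> \<le> 1 * (exp (- (n * t)) * M\<^sup>2)"
      using t \<open>n > 0\<close> by (intro mult_right_mono) auto
    finally have 1: "(cmod (k t - h t))\<^sup>2 \<le> M\<^sup>2 * exp (- (n * t))" by (simp add: mult.commute)
    have 2: "(cmod (poly R (of_real t) - k t))\<^sup>2 \<le> e\<^sup>2"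
      using R[of t] t assms(1) by (intro power_mono) auto
    have "cmod (poly R (of_real t) - h t) \<le> cmod (poly R (of_real t) - k t) + cmod (k t - h t)"
      using norm_triangle_ineq[of "poly R (of_real t) - k t" "k t - h t"] by simp
    then have "(cmod (poly R (of_real t) - h t))\<^sup>2 \<le> (cmod (poly R (of_real t) - k t) + cmod (k t - h t))\<^sup>2"
      by (rule power_mono) simp
    also have "\<dots> \<le> 2 * (cmod (poly R (of_real t) - k t))\<^sup>2 + 2 * (cmod (k t - h t))\<^sup>2"
      using sum_squares_bound[of "cmod (poly R (of_real t) - k t)" "cmod (k t - h t)"]
      by (simp add: power2_sum)
    finally show ?thesis using 1 2 by simp
  qed
  have "msq (-c) 0 (\<lambda>t. poly R (of_real t)) \<le> integral {-c..0} (\<lambda>t. e\<^sup>2)"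
    using neg by (intro integral_le integrable_continuous_real continuous_intros) auto
  also have "\<dots> \<le> \<epsilon>" using assms e by simp
  finally have "msq (-c) 0 (\<lambda>t. poly R (of_real t)) \<le> \<epsilon>" .
  moreover have "msq 0 c (\<lambda>t. poly R (of_real t) - h t)
     \<le> integral {0..c} (\<lambda>t. 2 * e\<^sup>2 + 2 * M\<^sup>2 * exp (- (n * t)))"
    using pos by (intro integral_le integrable_continuous_real continuous_intros h) auto
  moreover have "((\<lambda>t. 2 * e\<^sup>2 + 2 * M\<^sup>2 * exp (- (n * t))) has_integral
     (2 * e\<^sup>2 * c - 2 * M\<^sup>2 / n * exp (- (n * c))) - (2 * e\<^sup>2 * 0 - 2 * M\<^sup>2 / n * exp (- (n * 0)))) {0..c}"
    by (rule fundamental_theorem_of_calculus)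
      (use assms(1) \<open>n > 0\<close> in \<open>auto simp: has_real_derivative_iff_has_vector_derivative[symmetric] intro!: derivative_eq_intros\<close>)
  moreover have "2 * e\<^sup>2 * c + 2 * M\<^sup>2 / n \<le> \<epsilon>"
  proof -
    have "M\<^sup>2 * \<epsilon> \<le> (M\<^sup>2 + 1) * \<epsilon>" using assms(3) by (intro mult_right_mono) auto
    then have "2 * M\<^sup>2 / n \<le> \<epsilon> / 2"
      using add_nonneg_pos[of "M\<^sup>2" 1] by (simp add: n_def field_simps)
    moreover have "2 * e\<^sup>2 * c = \<epsilon> / 2" using assms e by (simp add: field_simps)
    ultimately show ?thesis by simp
  qed
  moreover have "0 \<le> 2 * M\<^sup>2 / n * exp (- (n * c))" using \<open>n > 0\<close> by simp
  ultimately have "msq 0 c (\<lambda>t. poly R (of_real t) - h t) \<le> \<epsilon>"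
    by (simp add: integral_unique)
  with \<open>msq (-c) 0 (\<lambda>t. poly R (of_real t)) \<le> \<epsilon>\<close> show ?thesis by blast
qed

section \<open>Hyperbolic systems in characteristic triangles\<close>

text \<open>The triangle has the vertices (0, 0), (0, 2X) and (X, X). Its sides are the
  characteristic t = y of a and the characteristic t = 2X - y of d. The hypotheses live on the
  surrounding rectangle, where one-sided derivatives are easy to state.\<close>

locale hyperbolic_triangle =
  fixes X k :: real and a d at' dt' :: "real \<Rightarrow> real \<Rightarrow> complex" and u v :: "real \<Rightarrow> complex"
  assumes X: "0 \<le> X" and k: "0 \<le> k"
    and ax: "\<And>y t. y \<in> {0..X} \<Longrightarrow> t \<in> {0..2*X} \<Longrightarrow>
      ((\<lambda>y. a y t) has_vector_derivative u y * d y t - at' y t) (at y within {0..X})"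
    and dx: "\<And>y t. y \<in> {0..X} \<Longrightarrow> t \<in> {0..2*X} \<Longrightarrow>
      ((\<lambda>y. d y t) has_vector_derivative v y * a y t + dt' y t) (at y within {0..X})"
    and at: "\<And>y t. y \<in> {0..X} \<Longrightarrow> t \<in> {0..2*X} \<Longrightarrow> (a y has_vector_derivative at' y t) (at t within {0..2*X})"
    and dt: "\<And>y t. y \<in> {0..X} \<Longrightarrow> t \<in> {0..2*X} \<Longrightarrow> (d y has_vector_derivative dt' y t) (at t within {0..2*X})"
    and cont: "continuous_on ({0..X} \<times> {0..2*X}) (\<lambda>(y, t). a y t)" "continuous_on ({0..X} \<times> {0..2*X}) (\<lambda>(y, t). d y t)"
      "continuous_on ({0..X} \<times> {0..2*X}) (\<lambda>(y, t). at' y t)" "continuous_on ({0..X} \<times> {0..2*X}) (\<lambda>(y, t). dt' y t)"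
    and cuv: "continuous_on {0..X} u" "continuous_on {0..X} v"
    and bound: "\<And>y. y \<in> {0..X} \<Longrightarrow> cmod (u y) \<le> k" "\<And>y. y \<in> {0..X} \<Longrightarrow> cmod (v y) \<le> k"
begin

lemma continuous_on_characteristic: "continuous_on {0..X} (\<lambda>s. (cmod (a s (2*X - s)))\<^sup>2)"
  by (intro continuous_intros continuous_on_compose2[OF cont(1)[unfolded split_beta], of _ "\<lambda>s. (s, 2*X - s)", simplified]) auto

text \<open>The energy on the shrinking interval from y to 2X - y loses 2 |a|^2 through the right
  side and 2 |d|^2 through the left side: on each side one component travels along the side and the
  other one crosses it. The coupling adds at most 2 k times the energy. Keeping the loss on the
  right in the balance bounds the mean square of a there.\<close>

lemma energy_estimate:
  "msq 0 X (\<lambda>s. a s (2*X - s))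
    \<le> exp (2 * k * X) * integral {0..2*X} (\<lambda>t. (cmod (a 0 t))\<^sup>2 + (cmod (d 0 t))\<^sup>2)"
proof -
  define e where "e y t = a y t \<bullet> a y t + d y t \<bullet> d y t" for y t
  \<comment> \<open>The flux of the energy: its t-derivative \<open>wt\<close> integrates to
    boundary values, while \<open>cr\<close> collects the coupling terms.\<close>
  define w where "w y t = - (a y t \<bullet> a y t) + d y t \<bullet> d y t" for y t
  define wt where "wt y t = 2 * (- (a y t \<bullet> at' y t) + d y t \<bullet> dt' y t)" for y t
  define cr where "cr y t = 2 * (a y t \<bullet> (u y * d y t) + d y t \<bullet> (v y * a y t))" for y t
  note cont' = cont[unfolded split_beta]
  have cu: "continuous_on ({0..X} \<times> {0..2*X}) (\<lambda>z. u (fst z))" "continuous_on ({0..X} \<times> {0..2*X}) (\<lambda>z. v (fst z))"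
    by (auto intro!: continuous_on_compose2[OF cuv(1)] continuous_on_compose2[OF cuv(2)] continuous_intros)
  have ce: "continuous_on ({0..X} \<times> {0..2*X}) (\<lambda>(y, t). e y t)"
    "continuous_on ({0..X} \<times> {0..2*X}) (\<lambda>(y, t). wt y t)"
    "continuous_on ({0..X} \<times> {0..2*X}) (\<lambda>(y, t). cr y t)"
    "continuous_on ({0..X} \<times> {0..2*X}) (\<lambda>(y, t). wt y t + cr y t)"
    unfolding e_def wt_def cr_def split_beta by (intro continuous_intros cont' cu)+
  have slice: "continuous_on {l..h} (f y)" if "continuous_on ({0..X} \<times> {0..2*X}) (\<lambda>(y, t). f y t)" "y \<in> {0..X}" "0 \<le> l" "h \<le> 2*X"
    for f :: "real \<Rightarrow> real \<Rightarrow> 'b::real_normed_vector" and y l h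
  proof -
    have "continuous_on {l..h} (\<lambda>t. (y, t))" by (intro continuous_intros)
    moreover have "(\<lambda>t. (y, t)) ` {l..h} \<subseteq> {0..X} \<times> {0..2*X}" using that(2-) by auto
    ultimately have "continuous_on {l..h} (\<lambda>t. case (y, t) of (y, t) \<Rightarrow> f y t)"
      by (rule continuous_on_compose2[OF that(1)])
    then show ?thesis by simp
  qed
  define E where "E y = integral {y..2*X - y} (e y)" for y
  have ey: "((\<lambda>y. e y t) has_vector_derivative wt y t + cr y t) (at y within {0..X})"
    if "y \<in> {0..X}" "t \<in> {0..2*X}" for y t
    unfolding e_def has_vector_derivative_def
    by (rule derivative_eq_intros ax[OF that, unfolded has_vector_derivative_def] dx[OF that, unfolded has_vector_derivative_def] refl)+
      (auto simp: wt_def cr_def inner_commute inner_diff_right inner_add_right algebra_simps fun_eq_iff)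
  have wt: "(w y has_vector_derivative wt y t) (at t within {0..2*X})"
    if "y \<in> {0..X}" "t \<in> {0..2*X}" for y t
    unfolding w_def has_vector_derivative_def
    by (rule derivative_eq_intros at[OF that, unfolded has_vector_derivative_def] dt[OF that, unfolded has_vector_derivative_def] refl)+
      (auto simp: wt_def inner_commute algebra_simps fun_eq_iff)
  define E' where "E' s = integral {s..2*X - s} (\<lambda>t. wt s t + cr s t) - e s (2*X - s) - e s s" for s
  have dE: "(E has_vector_derivative E' s) (at s within {0..X})" if s: "s \<in> {0..X}" for s
  proof -
    have "((\<lambda>y. integral {y..2*X - y} (e y)) has_vector_derivative
       integral {s..2*X - s} (\<lambda>t. wt s t + cr s t) + (- 1) *\<^sub>R e s (2*X - s) - 1 *\<^sub>R e s s) (at s within {0..X})"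
      by (rule integral_moving_bounds_derivative[OF ey ce(1) ce(4)])
        (use s in \<open>auto intro!: derivative_eq_intros\<close>)
    then show ?thesis by (simp add: E_def[abs_def] E'_def)
  qed
  have E': "E' s \<le> 2 * k * E s - 2 * (cmod (a s (2*X - s)))\<^sup>2" if s: "s \<in> {0..X}" for s
  proof -
    have ic: "cr s integrable_on {s..2*X - s}" "e s integrable_on {s..2*X - s}"
      using slice[OF ce(3) s, of s "2*X - s"] slice[OF ce(1) s, of s "2*X - s"] s by (auto intro: integrable_continuous_real)
    have iw: "(wt s has_integral w s (2*X - s) - w s s) {s..2*X - s}"
      by (rule fundamental_theorem_of_calculus)
        (use s in \<open>auto intro!: has_vector_derivative_within_subset[OF wt[OF s]]\<close>)
    have "cr s t \<le> 2 * k * e s t" for t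
    proof -
      have 1: "a s t \<bullet> (u s * d s t) \<le> cmod (a s t) * (k * cmod (d s t))"
        by (rule order_trans[OF norm_cauchy_schwarz mult_left_mono])
          (use bound(1)[OF s] in \<open>auto simp: norm_mult mult_right_mono\<close>)
      have 2: "d s t \<bullet> (v s * a s t) \<le> cmod (d s t) * (k * cmod (a s t))"
        by (rule order_trans[OF norm_cauchy_schwarz mult_left_mono])
          (use bound(2)[OF s] in \<open>auto simp: norm_mult mult_right_mono\<close>)
      have "k * (2 * cmod (a s t) * cmod (d s t)) \<le> k * ((cmod (a s t))\<^sup>2 + (cmod (d s t))\<^sup>2)"
        using sum_squares_bound[of "cmod (a s t)" "cmod (d s t)"] k by (rule mult_left_mono)
      with 1 2 show ?thesis
        by (simp add: cr_def e_def power2_norm_eq_inner algebra_simps)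
    qed
    then have "integral {s..2*X - s} (cr s) \<le> integral {s..2*X - s} (\<lambda>t. 2 * k * e s t)"
      using ic(1) integrable_on_mult_right[OF ic(2), of "2 * k"] by (intro integral_le) auto
    then have "integral {s..2*X - s} (cr s) \<le> 2 * k * E s" by (simp add: E_def)
    moreover have "integral {s..2*X - s} (\<lambda>t. wt s t + cr s t) = w s (2*X - s) - w s s + integral {s..2*X - s} (cr s)"
      using integral_add[OF has_integral_integrable[OF iw] ic(1)] integral_unique[OF iw] by simp
    ultimately have "E' s \<le> 2 * k * E s + (w s (2*X - s) - e s (2*X - s)) - (w s s + e s s)"
      by (simp add: E'_def)
    also have "\<dots> \<le> 2 * k * E s - 2 * (cmod (a s (2*X - s)))\<^sup>2"
      by (simp add: w_def e_def power2_norm_eq_inner)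
    finally show ?thesis .
  qed
  have E0: "0 \<le> E s" if s: "s \<in> {0..X}" for s
    unfolding E_def using slice[OF ce(1) s, of s "2*X - s"] s
    by (intro integral_nonneg integrable_continuous_real) (auto simp: e_def)
  define G where "G y = msq 0 y (\<lambda>s. a s (2*X - s))" for y
  have G0: "0 \<le> G y" if "y \<in> {0..X}" for y
    unfolding G_def using that by (intro integral_nonneg integrable_continuous_real continuous_on_subset[OF continuous_on_characteristic]) auto
  \<comment> \<open>Gronwall for the energy together with the part that has already left; G is
    nonnegative, so the rate 2 k may be applied to the sum.\<close>
  have "(E X + 2 * G X) \<le> exp (2 * k * X) * ((E 0 + 2 * G 0) + integral {0..X} (\<lambda>_. 0))"
  proof (rule gronwall_derivative[where \<phi>="\<lambda>y. E y + 2 * G y" and \<phi>'="\<lambda>s. E' s + 2 * (cmod (a s (2*X - s)))\<^sup>2"])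
    show "((\<lambda>y. E y + 2 * G y) has_vector_derivative E' s + 2 * (cmod (a s (2*X - s)))\<^sup>2) (at s within {0..X})"
      if "s \<in> {0..X}" for s
      unfolding G_def
      by (intro has_vector_derivative_add dE that has_vector_derivative_mult_right integral_has_vector_derivative continuous_on_characteristic)
    show "E' s + 2 * (cmod (a s (2*X - s)))\<^sup>2 \<le> 2 * k * (E s + 2 * G s) + 0" if "s \<in> {0..X}" for s
    proof -
      have "2 * k * (E s + 2 * G s) = 2 * k * E s + 4 * (k * G s)" by (simp add: algebra_simps)
      then show ?thesis using E'[OF that] mult_nonneg_nonneg[OF k G0[OF that]] by linarith
    qed
  qed (use X k in auto)
  moreover have "0 \<le> G X" "0 \<le> E X" "G 0 = 0" using G0[of X] E0[of X] X by (auto simp: G_def)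
  ultimately have "G X \<le> exp (2 * k * X) * E 0" by simp
  then show ?thesis by (simp add: G_def E_def e_def[abs_def] power2_norm_eq_inner)
qed

text \<open>Along its own characteristic t = 2X - s, d changes only through v a, and the mean square
  of a on that line is under control. The bound holds at each point although the data enter in mean
  square; this makes the perturbation of Volterra type. In the exponent, 2 k stems from the energy
  and 1 from Gronwall's inequality along the characteristic.\<close>

lemma trace_estimate:
  "(cmod (d X X - d 0 (2*X)))\<^sup>2
    \<le> k\<^sup>2 * exp ((2 * k + 1) * X) * integral {0..2*X} (\<lambda>t. (cmod (a 0 t))\<^sup>2 + (cmod (d 0 t))\<^sup>2)"
proof -
  define y where "y s = d s (2*X - s) - d 0 (2*X)" for s
  define y' where "y' s = v s * a s (2*X - s)" for s
  have dy: "(y has_vector_derivative y' s) (at s within {0..X})" if s: "s \<in> {0..X}" for s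
  proof -
    have "((\<lambda>s. d s (2*X - s)) has_vector_derivative
       (v s * a s (2*X - s) + dt' s (2*X - s)) + (- 1) *\<^sub>R dt' s (2*X - s)) (at s within {0..X})"
    proof (rule has_vector_derivative_along_curve[where T="{0..2*X}" and \<gamma>="\<lambda>s. 2*X - s"])
      show "((-) (2*X) has_vector_derivative - 1) (at s within {0..X})"
        by (auto intro!: derivative_eq_intros)
    qed (use s in \<open>auto intro: dx dt cont(4)\<close>)
    then show ?thesis unfolding y_def y'_def
      by (auto intro!: derivative_eq_intros)
  qed
  have "(cmod (y X))\<^sup>2 \<le> exp (1 * X) * ((cmod (y 0))\<^sup>2 + integral {0..X} (\<lambda>s. k\<^sup>2 * (cmod (a s (2*X - s)))\<^sup>2))"
  proof (rule gronwall_derivative[where \<phi>'="\<lambda>s. 2 * (y s \<bullet> y' s)"])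
    fix s assume s: "s \<in> {0..X}"
    show "((\<lambda>s. (cmod (y s))\<^sup>2) has_vector_derivative 2 * (y s \<bullet> y' s)) (at s within {0..X})"
      unfolding power2_norm_eq_inner has_vector_derivative_def
      by (rule derivative_eq_intros dy[OF s, unfolded has_vector_derivative_def] refl)+ (auto simp: inner_commute fun_eq_iff)
    have "cmod (y' s) \<le> k * cmod (a s (2*X - s))"
      using bound(2)[OF s] by (simp add: y'_def norm_mult mult_right_mono)
    then have "(cmod (y' s))\<^sup>2 \<le> k\<^sup>2 * (cmod (a s (2*X - s)))\<^sup>2"
      by (metis norm_ge_zero power_mono power_mult_distrib)
    moreover have "2 * (y s \<bullet> y' s) \<le> 2 * (cmod (y s) * cmod (y' s))"
      using norm_cauchy_schwarz[of "y s" "y' s"] by simp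
    ultimately show "2 * (y s \<bullet> y' s) \<le> 1 * (cmod (y s))\<^sup>2 + k\<^sup>2 * (cmod (a s (2*X - s)))\<^sup>2"
      using sum_squares_bound[of "cmod (y s)" "cmod (y' s)"] by simp
  qed (use X in \<open>auto intro!: continuous_intros continuous_on_characteristic\<close>)
  also have "\<dots> = exp X * (k\<^sup>2 * msq 0 X (\<lambda>s. a s (2*X - s)))"
    by (simp add: y_def)
  also have "\<dots> \<le> exp X * (k\<^sup>2 * (exp (2 * k * X) * integral {0..2*X} (\<lambda>t. (cmod (a 0 t))\<^sup>2 + (cmod (d 0 t))\<^sup>2)))"
    by (intro mult_left_mono energy_estimate) auto
  also have "\<dots> = k\<^sup>2 * exp ((2 * k + 1) * X) * integral {0..2*X} (\<lambda>t. (cmod (a 0 t))\<^sup>2 + (cmod (d 0 t))\<^sup>2)"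
    by (simp add: algebra_simps exp_add)
  finally show ?thesis by (simp add: y_def)
qed

end

section \<open>Appell sequences\<close>

text \<open>\<open>appell s n\<close> is the image of \<open>t\<^sup>n\<close> under the linear operator that maps each \<open>t\<^sup>m\<close> to the
  polynomial with \<open>s m\<close> as value at \<open>0\<close> and commutes with differentiation.\<close>

definition appell :: "(nat \<Rightarrow> complex) \<Rightarrow> nat \<Rightarrow> real \<Rightarrow> complex" where
  "appell s n t = (\<Sum>k\<le>n. of_nat (n choose k) * of_real t ^ k * s (n - k))"

definition appell_poly :: "(nat \<Rightarrow> complex) \<Rightarrow> complex poly \<Rightarrow> real \<Rightarrow> complex" where
  "appell_poly s P t = (\<Sum>n\<le>degree P. coeff P n * appell s n t)"

lemma appell_poly_altdef:
  assumes "degree P \<le> D" shows "appell_poly s P t = (\<Sum>n\<le>D. coeff P n * appell s n t)"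
  unfolding appell_poly_def
  by (rule sum.mono_neutral_left) (use assms in \<open>auto simp: coeff_eq_0 not_le\<close>)

lemma appell_poly_add: "appell_poly s (P + R) t = appell_poly s P t + appell_poly s R t"
proof -
  define D where "D = max (degree P) (degree R)"
  have "degree (P + R) \<le> D" "degree P \<le> D" "degree R \<le> D"
    unfolding D_def by (simp_all add: degree_add_le_max)
  then show ?thesis
    by (simp add: appell_poly_altdef sum.distrib algebra_simps)
qed

lemma appell_poly_minus: "appell_poly s (- P) t = - appell_poly s P t"
  by (simp add: appell_poly_def sum_negf)

lemma appell_poly_diff: "appell_poly s (P - R) t = appell_poly s P t - appell_poly s R t"
  using appell_poly_add[of s P "- R" t] by (simp add: appell_poly_minus)

lemma appell_poly_0 [simp]: "appell_poly s 0 t = 0"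
  by (simp add: appell_poly_def)

lemma appell_delta:
  assumes "\<And>m. s m = (if m = 0 then 1 else 0)"
  shows "appell s n t = of_real t ^ n"
proof -
  have "appell s n t = (\<Sum>k\<le>n. if k = n then of_real t ^ n else 0)"
    unfolding appell_def by (rule sum.cong) (auto simp: assms)
  then show ?thesis by simp
qed

lemma appell_poly_delta:
  assumes "\<And>m. s m = (if m = 0 then 1 else 0)"
  shows "appell_poly s P t = poly P (of_real t)"
  by (simp add: appell_poly_def appell_delta[OF assms] poly_altdef)

lemma appell_poly_zero_seq:
  assumes "\<And>m. s m = 0"
  shows "appell_poly s P t = 0"
  by (simp add: appell_poly_def appell_def assms)

lemma Suc_choose_minus: "k \<le> n \<Longrightarrow> (Suc n - k) * (Suc n choose k) = Suc n * (n choose k)"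
  by (metis binomial_absorb_comp diff_Suc_1)

lemma appell_shift:
  "appell (\<lambda>m. of_nat m * s (m - 1)) (Suc n) t = of_nat (Suc n) * appell s n t"
proof -
  have "appell (\<lambda>m. of_nat m * s (m - 1)) (Suc n) t
     = (\<Sum>k\<le>n. of_nat (Suc n choose k) * of_real t ^ k * (of_nat (Suc n - k) * s (n - k)))"
    by (simp add: appell_def)
  also have "\<dots> = (\<Sum>k\<le>n. of_nat ((Suc n - k) * (Suc n choose k)) * of_real t ^ k * s (n - k))"
    by (simp add: mult_ac)
  also have "\<dots> = (\<Sum>k\<le>n. of_nat (Suc n * (n choose k)) * of_real t ^ k * s (n - k))"
    by (rule sum.cong) (simp_all only: Suc_choose_minus atMost_iff)
  also have "\<dots> = of_nat (Suc n) * appell s n t"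
    by (simp only: appell_def sum_distrib_left of_nat_mult mult_ac)
  finally show ?thesis .
qed

text \<open>This turns the term with s (m - 1) in a recurrence into differentiation of the
  polynomial, hence into a t-derivative. In this way the ordinary recurrences for the values at t =
  0 become partial differential equations.\<close>

lemma appell_poly_shift: "appell_poly (\<lambda>m. of_nat m * s (m - 1)) P t = appell_poly s (pderiv P) t"
proof -
  have "appell_poly (\<lambda>m. of_nat m * s (m - 1)) P t = (\<Sum>n\<le>Suc (degree P). coeff P n * appell (\<lambda>m. of_nat m * s (m - 1)) n t)"
    by (rule appell_poly_altdef) simp
  also have "\<dots> = (\<Sum>n\<le>degree P. coeff P (Suc n) * appell (\<lambda>m. of_nat m * s (m - 1)) (Suc n) t)"
    by (simp add: sum.atMost_Suc_shift appell_def del: sum.atMost_Suc)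
  also have "\<dots> = (\<Sum>n\<le>degree P. coeff (pderiv P) n * appell s n t)"
    by (simp only: appell_shift coeff_pderiv mult_ac)
  also have "\<dots> = appell_poly s (pderiv P) t"
    by (rule appell_poly_altdef[symmetric]) (simp add: degree_pderiv)
  finally show ?thesis .
qed

lemma has_vector_derivative_appell:
  "(appell s n has_vector_derivative of_nat n * appell s (n - 1) t) (at t within T)"
proof -
  have "((\<lambda>t. \<Sum>k\<le>n. of_nat (n choose k) * of_real t ^ k * s (n - k)) has_vector_derivative
     (\<Sum>k\<le>n. of_nat (n choose k) * (of_nat k * of_real t ^ (k - 1)) * s (n - k))) (at t within T)"
  proof (intro has_vector_derivative_sum has_vector_derivative_mult_left has_vector_derivative_mult_right)
    fix k
    have "((\<lambda>z::complex. z ^ k) has_field_derivative of_nat k * of_real t ^ (k - 1)) (at (of_real t))"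
      by (auto intro!: derivative_eq_intros)
    from has_vector_derivative_real_field[OF this]
    show "((\<lambda>t. complex_of_real t ^ k) has_vector_derivative of_nat k * of_real t ^ (k - 1)) (at t within T)" .
  qed
  moreover have "(\<Sum>k\<le>n. of_nat (n choose k) * (of_nat k * of_real t ^ (k - 1)) * s (n - k)) = of_nat n * appell s (n - 1) t"
  proof (cases n)
    case (Suc m)
    have "(\<Sum>k\<le>Suc m. of_nat (Suc m choose k) * (of_nat k * of_real t ^ (k - 1)) * s (Suc m - k))
       = (\<Sum>k\<le>m. of_nat (Suc k * (Suc m choose Suc k)) * of_real t ^ k * s (m - k))"
      by (subst sum.atMost_Suc_shift) (simp add: mult_ac del: binomial_Suc_Suc of_nat_Suc mult_Suc)
    also have "\<dots> = of_nat (Suc m) * appell s m t"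
      by (simp only: Suc_times_binomial appell_def sum_distrib_left of_nat_mult mult_ac)
    finally show ?thesis using Suc by simp
  qed simp
  ultimately show ?thesis by (simp add: appell_def[abs_def])
qed

lemma has_vector_derivative_appell_poly:
  "(appell_poly s P has_vector_derivative appell_poly s (pderiv P) t) (at t within T)"
proof -
  have "(appell_poly s P has_vector_derivative (\<Sum>n\<le>degree P. coeff P n * (of_nat n * appell s (n - 1) t))) (at t within T)"
    unfolding appell_poly_def[abs_def]
    by (intro has_vector_derivative_sum has_vector_derivative_mult_right has_vector_derivative_appell)
  moreover have "(\<Sum>n\<le>degree P. coeff P n * (of_nat n * appell s (n - 1) t)) = appell_poly s (pderiv P) t"
  proof -
    have "(\<Sum>n\<le>degree P. coeff P n * (of_nat n * appell s (n - 1) t))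
       = (\<Sum>n\<le>Suc (degree P). coeff P n * (of_nat n * appell s (n - 1) t))"
      by (simp add: coeff_eq_0)
    also have "\<dots> = (\<Sum>n\<le>degree P. coeff (pderiv P) n * appell s n t)"
      by (subst sum.atMost_Suc_shift) (simp add: coeff_pderiv mult_ac)
    also have "\<dots> = appell_poly s (pderiv P) t"
      by (rule appell_poly_altdef[symmetric]) (simp add: degree_pderiv)
    finally show ?thesis .
  qed
  ultimately show ?thesis by simp
qed

lemma has_vector_derivative_appell_poly_seq:
  assumes "\<And>m. ((\<lambda>x. s x m) has_vector_derivative s' m) (at x within S)"
  shows "((\<lambda>x. appell_poly (s x) P t) has_vector_derivative appell_poly s' P t) (at x within S)"
  unfolding appell_poly_def appell_def
  by (intro has_vector_derivative_sum has_vector_derivative_mult_right assms)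

lemma appell_poly_linear_seq:
  "appell_poly (\<lambda>m. c * s m + e * r m) P t = c * appell_poly s P t + e * appell_poly r P t"
  by (simp add: appell_poly_def appell_def sum_distrib_left sum.distrib algebra_simps)

lemma continuous_on_appell_poly:
  assumes "\<And>m. continuous_on A (\<lambda>z. s z m)" "continuous_on A f"
  shows "continuous_on A (\<lambda>z. appell_poly (s z) P (f z))"
  unfolding appell_poly_def appell_def by (intro continuous_intros assms)

section \<open>Traces of polynomial solutions\<close>

lemma norm_add_square_le:
  fixes x y :: "'a::real_normed_vector"
  shows "(norm (x + y))\<^sup>2 \<le> 2 * (norm x)\<^sup>2 + 2 * (norm y)\<^sup>2"
proof -
  have "(norm (x + y))\<^sup>2 \<le> (norm x + norm y)\<^sup>2" by (intro power_mono norm_triangle_ineq) auto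
  also have "\<dots> \<le> 2 * (norm x)\<^sup>2 + 2 * (norm y)\<^sup>2"
    using sum_squares_bound[of "norm x" "norm y"] by (simp add: power2_sum)
  finally show ?thesis .
qed

lemma norm_Pair_square: "(norm (x, y))\<^sup>2 = (norm x)\<^sup>2 + (norm y)\<^sup>2"
  by (simp add: norm_Pair)

text \<open>Integrate the derivative of exp(-\<gamma> x) times the primitive of h; the boundary term
  at b is nonnegative. The gain 1/\<gamma> is what makes a Volterra operator small in the weighted
  norm.\<close>

lemma integral_exp_weight_le:
  fixes h :: "real \<Rightarrow> real"
  assumes "0 \<le> b" "\<gamma> > 0" "continuous_on {0..b} h" "\<And>x. x \<in> {0..b} \<Longrightarrow> 0 \<le> h x"
  shows "integral {0..b} (\<lambda>x. exp (- \<gamma> * x) * integral {0..x} h) \<le> integral {0..b} (\<lambda>x. exp (- \<gamma> * x) * h x) / \<gamma>"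
proof -
  define F where "F x = integral {0..x} h" for x
  have F: "(F has_real_derivative h x) (at x within {0..b})" if "x \<in> {0..b}" for x
    unfolding F_def has_real_derivative_iff_has_vector_derivative
    by (rule integral_has_vector_derivative[OF assms(3) that])
  then have cF: "continuous_on {0..b} F" by (rule DERIV_continuous_on)
  have "((\<lambda>x. exp (- \<gamma> * x) * h x - \<gamma> * (exp (- \<gamma> * x) * F x)) has_integral
      exp (- \<gamma> * b) * F b - exp (- \<gamma> * 0) * F 0) {0..b}"
  proof (rule fundamental_theorem_of_calculus[OF assms(1)])
    fix x assume x: "x \<in> {0..b}"
    show "((\<lambda>x. exp (- \<gamma> * x) * F x) has_vector_derivative exp (- \<gamma> * x) * h x - \<gamma> * (exp (- \<gamma> * x) * F x)) (at x within {0..b})"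
      unfolding has_real_derivative_iff_has_vector_derivative[symmetric]
      by (rule derivative_eq_intros F[OF x] refl)+ (simp add: algebra_simps)
  qed
  from integral_unique[OF this]
  have "integral {0..b} (\<lambda>x. exp (- \<gamma> * x) * h x) - \<gamma> * integral {0..b} (\<lambda>x. exp (- \<gamma> * x) * F x) = exp (- \<gamma> * b) * F b"
    by (subst (asm) integral_diff)
      (auto simp: F_def[of 0] intro!: integrable_continuous_real continuous_intros cF assms(3))
  moreover have "0 \<le> F b" unfolding F_def using assms by (intro integral_nonneg integrable_continuous_real) auto
  then have "0 \<le> exp (- \<gamma> * b) * F b" by simp
  ultimately show ?thesis using assms(2) by (simp add: F_def pos_le_divide_eq mult.commute)
qed

text \<open>The solution of \<open>a\<^sub>x = - a\<^sub>t + u d\<close>, \<open>d\<^sub>x = d\<^sub>t + v a\<close> with Cauchy data \<open>(t\<^sup>m, 0)\<close>, respectively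
  \<open>(0, t\<^sup>m)\<close>, on \<open>x = 0\<close> takes the value \<open>(ra m x, rd m x)\<close>, respectively \<open>(sa m x, sd m x)\<close>, at \<open>t = 0\<close>.\<close>

locale wave_system =
  fixes b :: real and u v :: "real \<Rightarrow> complex" and ra rd sa sd :: "nat \<Rightarrow> real \<Rightarrow> complex"
  assumes b: "0 < b" and cont_u: "continuous_on {0..b} u" and cont_v: "continuous_on {0..b} v"
    and ra: "\<And>m x. x \<in> {0..b} \<Longrightarrow> (ra m has_vector_derivative u x * rd m x - of_nat m * ra (m - 1) x) (at x within {0..b})"
    and rd: "\<And>m x. x \<in> {0..b} \<Longrightarrow> (rd m has_vector_derivative v x * ra m x + of_nat m * rd (m - 1) x) (at x within {0..b})"
    and sa: "\<And>m x. x \<in> {0..b} \<Longrightarrow> (sa m has_vector_derivative u x * sd m x - of_nat m * sa (m - 1) x) (at x within {0..b})"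
    and sd: "\<And>m x. x \<in> {0..b} \<Longrightarrow> (sd m has_vector_derivative v x * sa m x + of_nat m * sd (m - 1) x) (at x within {0..b})"
    and init: "\<And>m. ra m 0 = (if m = 0 then 1 else 0)" "\<And>m. rd m 0 = 0" "\<And>m. sa m 0 = 0"
      "\<And>m. sd m 0 = (if m = 0 then 1 else 0)"
begin

definition wa :: "complex poly \<Rightarrow> complex poly \<Rightarrow> real \<Rightarrow> real \<Rightarrow> complex" where
  "wa P R x t = appell_poly (\<lambda>m. ra m x) P t + appell_poly (\<lambda>m. sa m x) R t"

definition wd :: "complex poly \<Rightarrow> complex poly \<Rightarrow> real \<Rightarrow> real \<Rightarrow> complex" where
  "wd P R x t = appell_poly (\<lambda>m. rd m x) P t + appell_poly (\<lambda>m. sd m x) R t"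

lemma w_initial: "wa P R 0 t = poly P (of_real t)" "wd P R 0 t = poly R (of_real t)"
  by (simp_all add: wa_def wd_def appell_poly_delta appell_poly_zero_seq init)

lemma w_dt:
  "(wa P R x has_vector_derivative wa (pderiv P) (pderiv R) x t) (at t within T)"
  "(wd P R x has_vector_derivative wd (pderiv P) (pderiv R) x t) (at t within T)"
  unfolding wa_def[abs_def] wd_def[abs_def]
  by (intro has_vector_derivative_add has_vector_derivative_appell_poly)+

lemma wa_dx:
  assumes "x \<in> {0..b}"
  shows "((\<lambda>x. wa P R x t) has_vector_derivative u x * wd P R x t - wa (pderiv P) (pderiv R) x t) (at x within {0..b})"
proof -
  have "((\<lambda>x. wa P R x t) has_vector_derivative
      appell_poly (\<lambda>m. u x * rd m x + (- 1) * (of_nat m * ra (m - 1) x)) P t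
    + appell_poly (\<lambda>m. u x * sd m x + (- 1) * (of_nat m * sa (m - 1) x)) R t) (at x within {0..b})"
    unfolding wa_def
    by (intro has_vector_derivative_add has_vector_derivative_appell_poly_seq)
      (use ra[OF assms] sa[OF assms] in auto)
  then show ?thesis
    unfolding appell_poly_linear_seq appell_poly_shift[of "\<lambda>m. ra m x"] appell_poly_shift[of "\<lambda>m. sa m x"]
    by (simp add: wa_def wd_def algebra_simps)
qed

lemma wd_dx:
  assumes "x \<in> {0..b}"
  shows "((\<lambda>x. wd P R x t) has_vector_derivative v x * wa P R x t + wd (pderiv P) (pderiv R) x t) (at x within {0..b})"
proof -
  have "((\<lambda>x. wd P R x t) has_vector_derivative
      appell_poly (\<lambda>m. v x * ra m x + 1 * (of_nat m * rd (m - 1) x)) P t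
    + appell_poly (\<lambda>m. v x * sa m x + 1 * (of_nat m * sd (m - 1) x)) R t) (at x within {0..b})"
    unfolding wd_def
    by (intro has_vector_derivative_add has_vector_derivative_appell_poly_seq)
      (use rd[OF assms] sd[OF assms] in auto)
  then show ?thesis
    unfolding appell_poly_linear_seq appell_poly_shift[of "\<lambda>m. rd m x"] appell_poly_shift[of "\<lambda>m. sd m x"]
    by (simp add: wa_def wd_def algebra_simps)
qed

lemma continuous_on_w:
  assumes "continuous_on A f" "continuous_on A h" "f ` A \<subseteq> {0..b}"
  shows "continuous_on A (\<lambda>z. wa P R (f z) (h z))" "continuous_on A (\<lambda>z. wd P R (f z) (h z))"
proof -
  have *: "continuous_on A (\<lambda>z. s m (f z))"
    if "\<And>m x. x \<in> {0..b} \<Longrightarrow> (s m has_vector_derivative s' m x) (at x within {0..b})" for s s' :: "nat \<Rightarrow> real \<Rightarrow> complex" and m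
    using that by (intro continuous_on_compose2[OF _ assms(1,3)] continuous_on_vector_derivative)
  show "continuous_on A (\<lambda>z. wa P R (f z) (h z))" "continuous_on A (\<lambda>z. wd P R (f z) (h z))"
    unfolding wa_def wd_def
    by (intro continuous_on_add continuous_on_appell_poly assms(2) *[OF ra] *[OF rd] *[OF sa] *[OF sd]; assumption)+
qed

text \<open>Fixed by choice, so that \<open>K\<close> and \<open>\<gamma>\<close> are constants of
  the locale.\<close>

definition bound where
  "bound = (SOME k. 0 \<le> k \<and> (\<forall>x\<in>{0..b}. cmod (u x) \<le> k \<and> cmod (v x) \<le> k))"

lemma bound: "0 \<le> bound" "x \<in> {0..b} \<Longrightarrow> cmod (u x) \<le> bound" "x \<in> {0..b} \<Longrightarrow> cmod (v x) \<le> bound"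
proof -
  obtain k1 k2 where "\<forall>x\<in>{0..b}. cmod (u x) \<le> k1" "\<forall>x\<in>{0..b}. cmod (v x) \<le> k2"
    using compact_imp_bounded[OF compact_continuous_image[OF cont_u compact_Icc]]
      compact_imp_bounded[OF compact_continuous_image[OF cont_v compact_Icc]] unfolding bounded_iff by blast
  then have "\<exists>k. 0 \<le> k \<and> (\<forall>x\<in>{0..b}. cmod (u x) \<le> k \<and> cmod (v x) \<le> k)"
    by (intro exI[of _ "max 0 (max k1 k2)"]) (auto simp: max.coboundedI1 max.coboundedI2)
  from someI_ex[OF this] show "0 \<le> bound" "x \<in> {0..b} \<Longrightarrow> cmod (u x) \<le> bound" "x \<in> {0..b} \<Longrightarrow> cmod (v x) \<le> bound"
    unfolding bound_def by blast+
qed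

definition K where "K = bound\<^sup>2 * exp ((2 * bound + 1) * b)"

lemma K_nonneg: "0 \<le> K" by (simp add: K_def)

section \<open>The trace map and its principal part\<close>

definition tr :: "complex poly \<times> complex poly \<Rightarrow> real \<Rightarrow> complex \<times> complex" where
  "tr W x = (wd (fst W) (snd W) x x, wa (fst W) (snd W) x (- x))"

definition cauchy :: "complex poly \<times> complex poly \<Rightarrow> real \<Rightarrow> complex \<times> complex" where
  "cauchy W t = (poly (fst W) (of_real t), poly (snd W) (of_real t))"

text \<open>For \<open>u = v = 0\<close> the trace \<open>tr W\<close> would be \<open>sh W\<close>; \<open>co W\<close> is the part of the Cauchy data that
  does not reach the trace in that case.\<close>

definition sh :: "complex poly \<times> complex poly \<Rightarrow> real \<Rightarrow> complex \<times> complex" where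
  "sh W x = (poly (snd W) (of_real (2 * x)), poly (fst W) (of_real (- 2 * x)))"

definition co :: "complex poly \<times> complex poly \<Rightarrow> real \<Rightarrow> complex \<times> complex" where
  "co W x = (poly (snd W) (of_real (- 2 * x)), poly (fst W) (of_real (2 * x)))"

lemma tr_add: "tr (W + W') x = tr W x + tr W' x"
  by (simp add: tr_def wa_def wd_def appell_poly_add)

lemma tr_diff: "tr (W - W') x = tr W x - tr W' x"
  by (simp add: tr_def wa_def wd_def appell_poly_diff)

lemma tr_0 [simp]: "tr 0 x = 0"
  by (simp add: zero_prod_def tr_def wa_def wd_def)

lemma cauchy_add: "cauchy (W + W') x = cauchy W x + cauchy W' x"
  by (simp add: cauchy_def)

lemma cauchy_0 [simp]: "cauchy 0 x = 0"
  by (simp add: zero_prod_def cauchy_def)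

lemma continuous_on_tr: "continuous_on {0..b} (tr W)"
  unfolding tr_def[abs_def] by (intro continuous_intros continuous_on_w) auto

lemma continuous_on_cauchy: "continuous_on S (cauchy W)"
  and continuous_on_sh: "continuous_on S (sh W)" and continuous_on_co: "continuous_on S (co W)"
  unfolding cauchy_def[abs_def] sh_def[abs_def] co_def[abs_def] by (intro continuous_intros)+

text \<open>The points (x, x) and (x, -x) are the tips of the characteristic triangles over [0, 2x]
  and [-2x, 0]. The reflection of t carries the second triangle to the first and exchanges a with d
  and u with v.\<close>

lemma trace_bounds:
  assumes x: "x \<in> {0..b}"
  shows "(cmod (wd P R x x - poly R (of_real (2 * x))))\<^sup>2 \<le> K * msq 0 (2*x) (cauchy (P, R))"
    and "(cmod (wa P R x (- x) - poly P (of_real (- 2 * x))))\<^sup>2 \<le> K * msq 0 (2*x) (\<lambda>t. cauchy (P, R) (- t))"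
proof -
  have sub: "{0..x} \<subseteq> {0..b}" using x by auto
  interpret R: hyperbolic_triangle x bound "wa P R" "wd P R" "wa (pderiv P) (pderiv R)" "wd (pderiv P) (pderiv R)" u v
    by unfold_locales
      (use x in \<open>auto simp: split_beta intro!: bound has_vector_derivative_within_subset[OF wa_dx sub]
        has_vector_derivative_within_subset[OF wd_dx sub] w_dt continuous_intros continuous_on_w
        continuous_on_subset[OF cont_u] continuous_on_subset[OF cont_v]\<close>)
  have refl: "((\<lambda>t. f (- t)) has_vector_derivative - f') (at t within T)"
    if "(f has_vector_derivative f') (at (- t) within uminus ` T)" for f :: "real \<Rightarrow> complex" and f' t T
  proof -
    have "((\<lambda>t. - t) has_vector_derivative - 1) (at t within T)" by (auto intro!: derivative_eq_intros)
    from vector_diff_chain_within[OF this that] show ?thesis by (simp add: o_def)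
  qed
  interpret L: hyperbolic_triangle x bound "\<lambda>x t. wd P R x (- t)" "\<lambda>x t. wa P R x (- t)"
      "\<lambda>x t. - wd (pderiv P) (pderiv R) x (- t)" "\<lambda>x t. - wa (pderiv P) (pderiv R) x (- t)" v u
    by unfold_locales
      (use x in \<open>auto simp: split_beta intro!: bound has_vector_derivative_within_subset[OF wa_dx sub, THEN has_vector_derivative_eq_rhs]
        has_vector_derivative_within_subset[OF wd_dx sub, THEN has_vector_derivative_eq_rhs] refl w_dt continuous_intros continuous_on_w
        continuous_on_subset[OF cont_u] continuous_on_subset[OF cont_v]\<close>)
  have "bound\<^sup>2 * exp ((2 * bound + 1) * x) \<le> K"
    unfolding K_def using x bound(1) by (intro mult_left_mono) auto
  then have K: "bound\<^sup>2 * exp ((2 * bound + 1) * x) * I \<le> K * I" if "0 \<le> I" for I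
    using that by (rule mult_right_mono)
  have I: "0 \<le> msq 0 (2*x) (cauchy (P, R))" "0 \<le> msq 0 (2*x) (\<lambda>t. cauchy (P, R) (- t))"
    by (intro integral_nonneg integrable_continuous_real continuous_intros continuous_on_cauchy
        continuous_on_compose2[OF continuous_on_cauchy[of UNIV]]; simp)+
  show "(cmod (wd P R x x - poly R (of_real (2 * x))))\<^sup>2 \<le> K * msq 0 (2*x) (cauchy (P, R))"
    using order_trans[OF R.trace_estimate K] I(1) by (simp add: w_initial cauchy_def norm_Pair_square)
  show "(cmod (wa P R x (- x) - poly P (of_real (- 2 * x))))\<^sup>2 \<le> K * msq 0 (2*x) (\<lambda>t. cauchy (P, R) (- t))"
    using order_trans[OF L.trace_estimate K] I(2) by (simp add: w_initial cauchy_def norm_Pair_square add.commute)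
qed

text \<open>With t = 2s, the data at 2s and -2s are exactly the four entries of \<open>sh\<close>
  and \<open>co\<close>; the factor 2 is the Jacobian.\<close>

lemma integral_cauchy_split:
  assumes x: "0 \<le> x"
  shows "msq (-2*x) (2*x) (cauchy W) = 2 * integral {0..x} (\<lambda>s. (norm (sh W s))\<^sup>2 + (norm (co W s))\<^sup>2)"
    and "msq 0 (2*x) (cauchy W) + msq 0 (2*x) (\<lambda>t. cauchy W (- t))
      = msq (-2*x) (2*x) (cauchy W)"
proof -
  define G where "G t = (norm (cauchy W t))\<^sup>2" for t
  have G: "continuous_on S G" for S
    unfolding G_def by (intro continuous_intros continuous_on_cauchy)
  have Gi: "G integrable_on {l..h}" for l h by (rule integrable_continuous_real[OF G])
  have Gm: "(\<lambda>t. G (- t)) integrable_on {l..h}" for l h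
    by (intro integrable_continuous_real continuous_on_compose2[OF G[of UNIV]] continuous_intros) auto
  have "integral {-2*x..2*x} G = integral {-2*x..0} G + integral {0..2*x} G"
    using Henstock_Kurzweil_Integration.integral_combine[of "-2*x" 0 "2*x" G] Gi x by simp
  also have "integral {-2*x..0} G = integral {0..2*x} (\<lambda>t. G (- t))"
    using Henstock_Kurzweil_Integration.integral_reflect_real[of 0 "-2*x" G] by simp
  finally have 1: "integral {-2*x..2*x} G = integral {0..2*x} (\<lambda>t. G (- t)) + integral {0..2*x} G" .
  then show "msq 0 (2*x) (cauchy W) + msq 0 (2*x) (\<lambda>t. cauchy W (- t))
      = msq (-2*x) (2*x) (cauchy W)" by (simp add: G_def[abs_def])
  have "((\<lambda>s. 2 *\<^sub>R (G (- (2 * s)) + G (2 * s))) has_integral integral {2*0..2*x} (\<lambda>t. G (- t) + G t)) {0..x}"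
    by (rule has_integral_substitution[where c="0" and d="2*x"])
      (use x in \<open>auto intro!: derivative_eq_intros continuous_intros continuous_on_compose2[OF G[of UNIV]] G\<close>)
  then have "integral {0..x} (\<lambda>s. 2 * (G (- (2 * s)) + G (2 * s))) = integral {0..2*x} (\<lambda>t. G (- t)) + integral {0..2*x} G"
    using Gi Gm by (simp add: integral_unique integral_add)
  moreover have eq: "G (- (2 * s)) + G (2 * s) = (norm (sh W s))\<^sup>2 + (norm (co W s))\<^sup>2" for s
    by (simp add: G_def cauchy_def sh_def co_def norm_Pair_square)
  have "integral {0..x} (\<lambda>s. 2 * (G (- (2 * s)) + G (2 * s))) = 2 * integral {0..x} (\<lambda>s. (norm (sh W s))\<^sup>2 + (norm (co W s))\<^sup>2)"
    by (simp only: eq integral_mult_right)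
  ultimately show "msq (-2*x) (2*x) (cauchy W) = 2 * integral {0..x} (\<lambda>s. (norm (sh W s))\<^sup>2 + (norm (co W s))\<^sup>2)"
    unfolding G_def[symmetric] using 1 by simp
qed

text \<open>The error at x involves the data on [-2x, 2x] only. The exponential weight exploits this
  causality.\<close>

lemma trace_bound:
  assumes x: "x \<in> {0..b}"
  shows "(norm (tr W x - sh W x))\<^sup>2 \<le> K * msq (-2*x) (2*x) (cauchy W)"
  using trace_bounds[OF x, of "fst W" "snd W"] integral_cauchy_split(2)[of x W, symmetric] x
  by (simp add: tr_def sh_def norm_Pair_square distrib_left)

text \<open>Boundedness of the trace map transfers the truncation error of the data to the traces.
  The Jacobian of the dilation compensates the factor 2 lost when \<open>tr W\<close> is split into
  \<open>sh W\<close> and the remainder.\<close>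

lemma tr_L2_bound:
  "msq 0 b (tr W) \<le> (1 + 2 * b * K) * msq (-2*b) (2*b) (cauchy W)"
proof -
  define I where "I = msq (-2*b) (2*b) (cauchy W)"
  have cc: "continuous_on S (\<lambda>t. (norm (cauchy W t))\<^sup>2)" for S by (intro continuous_intros continuous_on_cauchy)
  have "(norm (tr W x))\<^sup>2 \<le> 2 * (norm (sh W x))\<^sup>2 + 2 * (K * I)" if x: "x \<in> {0..b}" for x
  proof -
    have "msq (-2*x) (2*x) (cauchy W) \<le> I"
      unfolding I_def using x by (intro integral_subset_le integrable_continuous_real cc) auto
    then have "(norm (tr W x - sh W x))\<^sup>2 \<le> K * I"
      using order_trans[OF trace_bound[OF x] mult_left_mono[OF _ K_nonneg]] by blast
    then show ?thesis using norm_add_square_le[of "sh W x" "tr W x - sh W x"] by simp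
  qed
  then have "msq 0 b (tr W) \<le> integral {0..b} (\<lambda>x. 2 * (norm (sh W x))\<^sup>2 + 2 * (K * I))"
    by (intro integral_le integrable_continuous_real continuous_intros continuous_on_tr continuous_on_sh)
  also have "\<dots> = 2 * msq 0 b (sh W) + 2 * b * K * I"
    using b by (subst integral_add) (auto intro!: integrable_continuous_real continuous_intros continuous_on_sh)
  also have "2 * msq 0 b (sh W) \<le> I"
    using integral_cauchy_split(1)[of b W] b unfolding I_def
    by (simp, intro integral_le integrable_continuous_real continuous_intros continuous_on_sh continuous_on_co) auto
  finally show ?thesis by (simp add: I_def algebra_simps)
qed

text \<open>\<open>sh\<close> sees the second polynomial on [0, 2b] and the first on [-2b, 0], and
  \<open>co\<close> sees the opposite halves, so two independent one-sided approximations suffice.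
  The compositions undo the dilations by 2 and -2.\<close>

lemma sh_approx:
  assumes \<tau>: "continuous_on {0..b} \<tau>" and "\<epsilon> > 0"
  shows "\<exists>W. msq 0 b (\<lambda>x. sh W x - \<tau> x) \<le> \<epsilon> \<and> msq 0 b (co W) \<le> \<epsilon>"
proof -
  have c: "continuous_on {0..b} (\<lambda>x. fst (\<tau> x))" "continuous_on {0..b} (\<lambda>x. snd (\<tau> x))"
    by (intro continuous_intros \<tau>)+
  obtain R :: "complex poly" where R: "msq (-b) 0 (\<lambda>t. poly R (of_real t)) \<le> \<epsilon> / 2"
      "msq 0 b (\<lambda>t. poly R (of_real t) - fst (\<tau> t)) \<le> \<epsilon> / 2"
    using one_sided_L2_poly_approx[OF b c(1), of "\<epsilon> / 2"] assms(2) by auto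
  obtain P :: "complex poly" where P: "msq (-b) 0 (\<lambda>t. poly P (of_real t)) \<le> \<epsilon> / 2"
      "msq 0 b (\<lambda>t. poly P (of_real t) - snd (\<tau> t)) \<le> \<epsilon> / 2"
    using one_sided_L2_poly_approx[OF b c(2), of "\<epsilon> / 2"] assms(2) by auto
  define W where "W = (pcompose P [:0, - 1 / 2:], pcompose R [:0, 1 / 2:])"
  have sh: "sh W x = (poly R (of_real x), poly P (of_real x))"
    and co: "co W x = (poly R (of_real (- x)), poly P (of_real (- x)))" for x
    by (simp_all add: sh_def co_def W_def poly_pcompose)
  have "msq 0 b (\<lambda>x. sh W x - \<tau> x)
     = msq 0 b (\<lambda>t. poly R (of_real t) - fst (\<tau> t)) + msq 0 b (\<lambda>t. poly P (of_real t) - snd (\<tau> t))"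
    by (subst integral_add[symmetric])
      (auto simp: sh norm_prod_def intro!: integrable_continuous_real continuous_intros c)
  moreover have "msq 0 b (co W)
     = msq 0 b (\<lambda>t. poly R (of_real (- t))) + msq 0 b (\<lambda>t. poly P (of_real (- t)))"
    by (subst integral_add[symmetric])
      (auto simp: co norm_prod_def intro!: integrable_continuous_real continuous_intros)
  moreover have "msq 0 b (\<lambda>t. poly S (of_real (- t))) = msq (-b) 0 (\<lambda>t. poly S (of_real t))" for S :: "complex poly"
    using Henstock_Kurzweil_Integration.integral_reflect_real[of 0 "-b" "\<lambda>t. (cmod (poly S (of_real t)))\<^sup>2"] by simp
  ultimately show ?thesis using R P by (intro exI[of _ W]) auto
qed


text \<open>In the norm with weight \<open>exp (- \<gamma> x)\<close> the Volterra perturbation \<open>tr W - sh W\<close> is a contraction.\<close>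

definition \<gamma> where "\<gamma> = 64 * K + 1"

definition wnorm :: "(real \<Rightarrow> complex \<times> complex) \<Rightarrow> real" where
  "wnorm \<tau> = integral {0..b} (\<lambda>x. exp (- \<gamma> * x) * (norm (\<tau> x))\<^sup>2)"

lemma wnorm_nonneg: "continuous_on {0..b} \<tau> \<Longrightarrow> 0 \<le> wnorm \<tau>"
  unfolding wnorm_def by (intro integral_nonneg integrable_continuous_real continuous_intros) auto

lemma wnorm_equiv:
  assumes \<tau>: "continuous_on {0..b} \<tau>"
  shows "wnorm \<tau> \<le> msq 0 b \<tau>"
    and "msq 0 b \<tau> \<le> exp (\<gamma> * b) * wnorm \<tau>"
proof -
  have \<gamma>: "0 \<le> \<gamma>" using K_nonneg by (simp add: \<gamma>_def)
  show "wnorm \<tau> \<le> msq 0 b \<tau>"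
    unfolding wnorm_def using \<gamma>
    by (intro integral_le integrable_continuous_real continuous_intros \<tau>) (auto simp: mult_left_le_one_le)
  have "msq 0 b \<tau> \<le> integral {0..b} (\<lambda>x. exp (\<gamma> * b) * (exp (- \<gamma> * x) * (norm (\<tau> x))\<^sup>2))"
  proof (intro integral_le integrable_continuous_real continuous_intros \<tau>)
    fix x assume "x \<in> {0..b}"
    then have "1 \<le> exp (\<gamma> * b + - \<gamma> * x)" using \<gamma> by (simp add: mult_left_mono)
    then have "1 * (norm (\<tau> x))\<^sup>2 \<le> exp (\<gamma> * b + - \<gamma> * x) * (norm (\<tau> x))\<^sup>2" by (rule mult_right_mono) simp
    then show "(norm (\<tau> x))\<^sup>2 \<le> exp (\<gamma> * b) * (exp (- \<gamma> * x) * (norm (\<tau> x))\<^sup>2)"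
      unfolding exp_add by simp
  qed
  then show "msq 0 b \<tau> \<le> exp (\<gamma> * b) * wnorm \<tau>" by (simp add: wnorm_def)
qed

text \<open>If \<open>sh W\<close> is close to \<tau> and \<open>co W\<close> is close to 0, the
  residual is essentially \<open>sh W - tr W\<close>. At x its square is at most a multiple of the
  integral of |\<tau>|^2 over [0, x], which the weight reduces to a fraction of
  \<open>wnorm \<tau>\<close>.\<close>

lemma contraction_step:
  assumes \<tau>: "continuous_on {0..b} \<tau>"
  shows "\<exists>W. msq (-2*b) (2*b) (cauchy W) \<le> (6 + 4 * exp (\<gamma> * b)) * wnorm \<tau>
    \<and> wnorm (\<lambda>x. \<tau> x - tr W x) \<le> wnorm \<tau> / 4"
\<comment> \<open>The tolerance \<epsilon> chosen below is proportional to
  \<open>wnorm \<tau>\<close> and has to be positive.\<close>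
proof (cases "wnorm \<tau> = 0")
  case True
  then show ?thesis by (intro exI[of _ 0]) simp
next
  case False
  then have N: "0 < wnorm \<tau>" using wnorm_nonneg[OF \<tau>] by simp
  have bK: "0 \<le> b * K" using b K_nonneg by simp
  \<comment> \<open>The terms with \<epsilon> in the final estimate add up to (2 + 12 b K)
    \<epsilon>, here 1/8 of \<open>wnorm \<tau>\<close>. Proportionality also lets \<epsilon> be
    absorbed in the bound on the data.\<close>
  define \<epsilon> where "\<epsilon> = wnorm \<tau> / (8 * (2 + 12 * (b * K)))"
  have "0 < 2 + 12 * (b * K)" using bK by simp
  then have \<epsilon>: "0 < \<epsilon>" "(2 + 12 * (b * K)) * \<epsilon> = wnorm \<tau> / 8"
    unfolding \<epsilon>_def using N by (auto simp del: distrib_left_numeral simp: field_simps)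
  have "2 * \<epsilon> \<le> (2 + 12 * (b * K)) * \<epsilon>" using bK \<epsilon>(1) by (intro mult_right_mono) auto
  with \<epsilon>(2) N have \<epsilon>_le: "\<epsilon> \<le> wnorm \<tau>" by simp
  obtain W where W: "msq 0 b (\<lambda>x. sh W x - \<tau> x) \<le> \<epsilon>" "msq 0 b (co W) \<le> \<epsilon>"
    using sh_approx[OF \<tau> \<epsilon>(1)] by blast
  have \<tau>': "continuous_on {0..x} \<tau>" if "x \<in> {0..b}" for x
    using that by (intro continuous_on_subset[OF \<tau>]) auto
  define T where "T x = msq 0 x \<tau>" for x
  have cT: "continuous_on {0..b} T"
    unfolding T_def by (intro indefinite_integral_continuous_1 integrable_continuous_real continuous_intros \<tau>)
  have I: "msq (-2*x) (2*x) (cauchy W) \<le> 6 * \<epsilon> + 4 * T x" if x: "x \<in> {0..b}" for x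
  proof -
    have 1: "msq 0 x (\<lambda>s. sh W s - \<tau> s) \<le> \<epsilon>"
      by (rule order_trans[OF integral_subset_le W(1)])
        (use x in \<open>auto intro!: integrable_continuous_real continuous_intros continuous_on_sh \<tau> \<tau>'\<close>)
    have 2: "msq 0 x (co W) \<le> \<epsilon>"
      by (rule order_trans[OF integral_subset_le W(2)])
        (use x in \<open>auto intro!: integrable_continuous_real continuous_intros continuous_on_co\<close>)
    have "integral {0..x} (\<lambda>s. (norm (sh W s))\<^sup>2 + (norm (co W s))\<^sup>2)
      \<le> integral {0..x} (\<lambda>s. (2 * (norm (sh W s - \<tau> s))\<^sup>2 + 2 * (norm (\<tau> s))\<^sup>2) + (norm (co W s))\<^sup>2)"
    proof (intro integral_le integrable_continuous_real continuous_intros continuous_on_sh continuous_on_co \<tau>'[OF x])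
      fix s show "(norm (sh W s))\<^sup>2 + (norm (co W s))\<^sup>2 \<le> (2 * (norm (sh W s - \<tau> s))\<^sup>2 + 2 * (norm (\<tau> s))\<^sup>2) + (norm (co W s))\<^sup>2"
        using norm_add_square_le[of "sh W s - \<tau> s" "\<tau> s"] by simp
    qed
    also have "\<dots> = 2 * msq 0 x (\<lambda>s. sh W s - \<tau> s) + 2 * T x + msq 0 x (co W)"
      unfolding T_def
      by (simp add: integral_add integrable_continuous_real continuous_intros continuous_on_sh continuous_on_co \<tau>'[OF x])
    finally show ?thesis using 1 2 integral_cauchy_split(1)[of x W] x by simp
  qed
  have pt: "exp (- \<gamma> * x) * (norm (\<tau> x - tr W x))\<^sup>2 \<le> 2 * (norm (sh W x - \<tau> x))\<^sup>2 + 12 * (K * \<epsilon>) + 8 * K * (exp (- \<gamma> * x) * T x)"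
    if x: "x \<in> {0..b}" for x
  proof -
    have "0 \<le> \<gamma> * x" using x K_nonneg by (intro mult_nonneg_nonneg) (auto simp: \<gamma>_def)
    then have e: "exp (- \<gamma> * x) \<le> 1" by simp
    have "(norm (tr W x - sh W x))\<^sup>2 \<le> K * (6 * \<epsilon> + 4 * T x)"
      using trace_bound[OF x, of W] mult_left_mono[OF I[OF x] K_nonneg] by linarith
    moreover have "(norm (tr W x - \<tau> x))\<^sup>2 \<le> 2 * (norm (tr W x - sh W x))\<^sup>2 + 2 * (norm (sh W x - \<tau> x))\<^sup>2"
      using norm_add_square_le[of "tr W x - sh W x" "sh W x - \<tau> x"] by simp
    ultimately have "(norm (\<tau> x - tr W x))\<^sup>2 \<le> 2 * (norm (sh W x - \<tau> x))\<^sup>2 + 12 * (K * \<epsilon>) + 8 * K * T x"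
      by (simp add: norm_minus_commute algebra_simps)
    then have "exp (- \<gamma> * x) * (norm (\<tau> x - tr W x))\<^sup>2
      \<le> exp (- \<gamma> * x) * (2 * (norm (sh W x - \<tau> x))\<^sup>2 + 12 * (K * \<epsilon>) + 8 * K * T x)"
      by (rule mult_left_mono) simp
    also have "\<dots> = exp (- \<gamma> * x) * (2 * (norm (sh W x - \<tau> x))\<^sup>2 + 12 * (K * \<epsilon>)) + 8 * K * (exp (- \<gamma> * x) * T x)"
      by (simp add: algebra_simps)
    also have "exp (- \<gamma> * x) * (2 * (norm (sh W x - \<tau> x))\<^sup>2 + 12 * (K * \<epsilon>)) \<le> 1 * (2 * (norm (sh W x - \<tau> x))\<^sup>2 + 12 * (K * \<epsilon>))"
      using e K_nonneg \<epsilon>(1) by (intro mult_right_mono) auto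
    finally show ?thesis by simp
  qed
  have "wnorm (\<lambda>x. \<tau> x - tr W x)
     \<le> integral {0..b} (\<lambda>x. 2 * (norm (sh W x - \<tau> x))\<^sup>2 + 12 * (K * \<epsilon>) + 8 * K * (exp (- \<gamma> * x) * T x))"
    unfolding wnorm_def
    by (rule integral_le[OF _ _ pt]) (intro integrable_continuous_real continuous_intros \<tau> cT continuous_on_tr continuous_on_sh)+
  also have "\<dots> = 2 * msq 0 b (\<lambda>x. sh W x - \<tau> x) + 12 * (b * K) * \<epsilon> + 8 * K * integral {0..b} (\<lambda>x. exp (- \<gamma> * x) * T x)"
    using b bK by (simp add: integral_add integrable_continuous_real continuous_intros continuous_on_sh \<tau> cT)
  also have "\<dots> \<le> 2 * \<epsilon> + 12 * (b * K) * \<epsilon> + 8 * K * (wnorm \<tau> / \<gamma>)"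
  proof (intro add_mono mult_left_mono W(1) order_refl)
    show "integral {0..b} (\<lambda>x. exp (- \<gamma> * x) * T x) \<le> wnorm \<tau> / \<gamma>"
      unfolding T_def wnorm_def using b K_nonneg
      by (intro integral_exp_weight_le continuous_intros \<tau>) (auto simp: \<gamma>_def)
  qed (use K_nonneg bK in auto)
  also have "\<dots> = wnorm \<tau> / 8 + 8 * K * (wnorm \<tau> / \<gamma>)"
    using \<epsilon>(2) by (simp add: algebra_simps)
  \<comment> \<open>The origin of the 64 in \<gamma>: it makes 8 K / \<gamma> at most 1/8.\<close>
  also have "8 * K * (wnorm \<tau> / \<gamma>) \<le> wnorm \<tau> / 8"
    using N K_nonneg by (simp add: \<gamma>_def field_simps)
  finally have "wnorm (\<lambda>x. \<tau> x - tr W x) \<le> wnorm \<tau> / 4" by simp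
  moreover have "msq (-2*b) (2*b) (cauchy W) \<le> (6 + 4 * exp (\<gamma> * b)) * wnorm \<tau>"
    using I[of b] b \<epsilon>_le wnorm_equiv(2)[OF \<tau>] by (simp add: T_def algebra_simps)
  ultimately show ?thesis by blast
qed

text \<open>A Neumann series: the residual is approximated again and the data are added. Each
  addition doubles mean squares, but the factor 1/4 gained by the residual outweighs this: with c
  the constant of a single step, 2 c + 2 (4 c / 4) = 4 c, so the constant 4 c reproduces
  itself.\<close>

lemma contraction_iterate:
  assumes "continuous_on {0..b} \<tau>"
  shows "\<exists>W. msq (-2*b) (2*b) (cauchy W) \<le> 4 * (6 + 4 * exp (\<gamma> * b)) * wnorm \<tau>
    \<and> wnorm (\<lambda>x. \<tau> x - tr W x) \<le> wnorm \<tau> / 4 ^ n"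
  using assms
proof (induction n arbitrary: \<tau>)
  case 0
  then show ?case using wnorm_nonneg[OF 0] by (intro exI[of _ 0]) (simp add: add_nonneg_nonneg)
next
  case (Suc n)
  define c where "c = 6 + 4 * exp (\<gamma> * b)"
  have "0 \<le> c" by (simp add: c_def)
  obtain W where W: "msq (-2*b) (2*b) (cauchy W) \<le> c * wnorm \<tau>"
    "wnorm (\<lambda>x. \<tau> x - tr W x) \<le> wnorm \<tau> / 4"
    using contraction_step[OF Suc.prems] by (auto simp: c_def)
  have "continuous_on {0..b} (\<lambda>x. \<tau> x - tr W x)" by (intro continuous_intros Suc.prems continuous_on_tr)
  from Suc.IH[OF this] obtain W' where W': "msq (-2*b) (2*b) (cauchy W') \<le> 4 * c * wnorm (\<lambda>x. \<tau> x - tr W x)"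
    "wnorm (\<lambda>x. (\<tau> x - tr W x) - tr W' x) \<le> wnorm (\<lambda>x. \<tau> x - tr W x) / 4 ^ n"
    by (auto simp: c_def)
  have "msq (-2*b) (2*b) (cauchy (W + W'))
     \<le> integral {-2*b..2*b} (\<lambda>t. 2 * (norm (cauchy W t))\<^sup>2 + 2 * (norm (cauchy W' t))\<^sup>2)"
    unfolding cauchy_add
    by (intro integral_le integrable_continuous_real continuous_intros continuous_on_cauchy norm_add_square_le)
  also have "\<dots> = 2 * msq (-2*b) (2*b) (cauchy W) + 2 * msq (-2*b) (2*b) (cauchy W')"
    by (simp add: integral_add integrable_continuous_real continuous_intros continuous_on_cauchy)
  also have "\<dots> \<le> 2 * (c * wnorm \<tau>) + 2 * (4 * c * (wnorm \<tau> / 4))"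
    using W order_trans[OF W'(1) mult_left_mono[OF W(2), of "4 * c"]] \<open>0 \<le> c\<close> by simp
  finally have "msq (-2*b) (2*b) (cauchy (W + W')) \<le> 4 * c * wnorm \<tau>" by simp
  moreover have "wnorm (\<lambda>x. \<tau> x - tr (W + W') x) \<le> wnorm \<tau> / 4 ^ Suc n"
  proof -
    have "wnorm (\<lambda>x. \<tau> x - tr (W + W') x) \<le> wnorm (\<lambda>x. \<tau> x - tr W x) / 4 ^ n"
      using W'(2) by (simp add: tr_add diff_diff_eq)
    also have "\<dots> \<le> (wnorm \<tau> / 4) / 4 ^ n" by (rule divide_right_mono[OF W(2)]) simp
    finally show ?thesis by simp
  qed
  ultimately show ?case unfolding c_def by blast
qed

text \<open>The constant does not depend on \<epsilon>: higher accuracy may require a higher degree,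
  but not larger data.\<close>

lemma trace_density:
  "\<exists>c\<ge>0. \<forall>(\<tau> :: real \<Rightarrow> complex \<times> complex) \<epsilon>. continuous_on {0..b} \<tau> \<longrightarrow> \<epsilon> > 0 \<longrightarrow>
    (\<exists>W. msq (-2*b) (2*b) (cauchy W) \<le> c * msq 0 b \<tau>
     \<and> msq 0 b (\<lambda>x. \<tau> x - tr W x) \<le> \<epsilon>)"
proof (intro exI[of _ "4 * (6 + 4 * exp (\<gamma> * b))"] conjI allI impI)
  fix \<tau> :: "real \<Rightarrow> complex \<times> complex" and \<epsilon> :: real assume \<tau>: "continuous_on {0..b} \<tau>" and "\<epsilon> > 0"
  define e where "e = \<epsilon> / (exp (\<gamma> * b) * (wnorm \<tau> + 1))"
  have "0 < e" using wnorm_nonneg[OF \<tau>] \<open>\<epsilon> > 0\<close> by (simp add: e_def)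
  then obtain n where n: "(1 / 4) ^ n < e" using real_arch_pow_inv[of e "1 / 4"] by auto
  obtain W where W: "msq (-2*b) (2*b) (cauchy W) \<le> 4 * (6 + 4 * exp (\<gamma> * b)) * wnorm \<tau>"
    "wnorm (\<lambda>x. \<tau> x - tr W x) \<le> wnorm \<tau> / 4 ^ n"
    using contraction_iterate[OF \<tau>, of n] by auto
  have "wnorm \<tau> / 4 ^ n = wnorm \<tau> * (1 / 4) ^ n" by (simp add: power_one_over)
  also have "\<dots> \<le> (wnorm \<tau> + 1) * e"
    using n wnorm_nonneg[OF \<tau>] by (intro mult_mono) auto
  finally have "exp (\<gamma> * b) * wnorm (\<lambda>x. \<tau> x - tr W x) \<le> exp (\<gamma> * b) * ((wnorm \<tau> + 1) * e)"
    using W(2) by (intro mult_left_mono) auto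
  also have "\<dots> = \<epsilon>"
  proof -
    have nz: "exp (\<gamma> * b) * (wnorm \<tau> + 1) \<noteq> 0" using wnorm_nonneg[OF \<tau>] by simp
    show ?thesis
      by (simp only: e_def mult.assoc[symmetric] times_divide_eq_right nonzero_mult_div_cancel_left[OF nz])
  qed
  finally have "msq 0 b (\<lambda>x. \<tau> x - tr W x) \<le> \<epsilon>"
    using wnorm_equiv(2)[of "\<lambda>x. \<tau> x - tr W x"] by (simp add: continuous_intros \<tau> continuous_on_tr)
  moreover have "4 * (6 + 4 * exp (\<gamma> * b)) * wnorm \<tau> \<le> 4 * (6 + 4 * exp (\<gamma> * b)) * msq 0 b \<tau>"
    by (intro mult_left_mono wnorm_equiv \<tau>) (simp add: add_nonneg_nonneg)
  ultimately show "\<exists>W. msq (-2*b) (2*b) (cauchy W) \<le> 4 * (6 + 4 * exp (\<gamma> * b)) * msq 0 b \<tau>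
     \<and> msq 0 b (\<lambda>x. \<tau> x - tr W x) \<le> \<epsilon>"
    using W(1) by (intro exI[of _ W]) auto
qed (simp add: add_nonneg_nonneg)

end

section \<open>Differentiated traces and the approximation rate\<close>

lemma coupled_gronwall:
  fixes y z p w \<eta> :: "real \<Rightarrow> complex"
  assumes X: "0 \<le> X" and k: "0 \<le> k"
    and dy: "\<And>s. s \<in> {0..X} \<Longrightarrow> (y has_vector_derivative p s * z s + \<eta> s) (at s within {0..X})"
    and dz: "\<And>s. s \<in> {0..X} \<Longrightarrow> (z has_vector_derivative w s * y s) (at s within {0..X})"
    and bound: "\<And>s. s \<in> {0..X} \<Longrightarrow> cmod (p s) \<le> k" "\<And>s. s \<in> {0..X} \<Longrightarrow> cmod (w s) \<le> k"
    and init: "y 0 = 0" "z 0 = 0" and \<eta>: "continuous_on {0..X} \<eta>"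
  shows "(cmod (y X))\<^sup>2 \<le> exp ((2 * k + 1) * X) * msq 0 X \<eta>"
proof -
  define \<phi> where "\<phi> s = (cmod (y s))\<^sup>2 + (cmod (z s))\<^sup>2" for s
  define \<phi>' where "\<phi>' s = 2 * (y s \<bullet> (p s * z s + \<eta> s)) + 2 * (z s \<bullet> (w s * y s))" for s
  have "\<phi> X \<le> exp ((2 * k + 1) * X) * (\<phi> 0 + msq 0 X \<eta>)"
  proof (rule gronwall_derivative[where \<phi>'=\<phi>'])
    fix s assume s: "s \<in> {0..X}"
    show "(\<phi> has_vector_derivative \<phi>' s) (at s within {0..X})"
      unfolding \<phi>_def[abs_def] \<phi>'_def power2_norm_eq_inner has_vector_derivative_def
      by (rule derivative_eq_intros dy[OF s, unfolded has_vector_derivative_def] dz[OF s, unfolded has_vector_derivative_def] refl)+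
        (auto simp: inner_commute fun_eq_iff algebra_simps)
    have 1: "y s \<bullet> (p s * z s) \<le> cmod (y s) * (k * cmod (z s))"
      by (rule order_trans[OF norm_cauchy_schwarz mult_left_mono])
        (use bound(1)[OF s] in \<open>auto simp: norm_mult mult_right_mono\<close>)
    have 2: "z s \<bullet> (w s * y s) \<le> cmod (z s) * (k * cmod (y s))"
      by (rule order_trans[OF norm_cauchy_schwarz mult_left_mono])
        (use bound(2)[OF s] in \<open>auto simp: norm_mult mult_right_mono\<close>)
    have 3: "k * (2 * cmod (y s) * cmod (z s)) \<le> k * ((cmod (y s))\<^sup>2 + (cmod (z s))\<^sup>2)"
      using sum_squares_bound[of "cmod (y s)" "cmod (z s)"] k by (rule mult_left_mono)
    have 4: "2 * (y s \<bullet> \<eta> s) \<le> (cmod (y s))\<^sup>2 + (cmod (\<eta> s))\<^sup>2"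
      using norm_cauchy_schwarz[of "y s" "\<eta> s"] sum_squares_bound[of "cmod (y s)" "cmod (\<eta> s)"] by simp
    have "\<phi>' s \<le> 2 * (k * ((cmod (y s))\<^sup>2 + (cmod (z s))\<^sup>2)) + (cmod (y s))\<^sup>2 + (cmod (\<eta> s))\<^sup>2"
      using 1 2 3 4 unfolding \<phi>'_def inner_add_right by (simp add: algebra_simps)
    also have "\<dots> \<le> (2 * k + 1) * \<phi> s + (cmod (\<eta> s))\<^sup>2"
      by (simp add: \<phi>_def algebra_simps)
    finally show "\<phi>' s \<le> (2 * k + 1) * \<phi> s + (cmod (\<eta> s))\<^sup>2" .
  qed (use X k in \<open>auto intro!: continuous_intros \<eta>\<close>)
  then have "\<phi> X \<le> exp ((2 * k + 1) * X) * msq 0 X \<eta>"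
    by (simp add: \<phi>_def init)
  moreover have "(cmod (y X))\<^sup>2 \<le> \<phi> X" by (simp add: \<phi>_def)
  ultimately show ?thesis by simp
qed

definition poly_antideriv :: "complex \<Rightarrow> complex poly \<Rightarrow> complex poly" where
  "poly_antideriv c P = [:c:] + (\<Sum>i\<le>degree P. monom (coeff P i / of_nat (Suc i)) (Suc i))"

lemma pderiv_sum: "pderiv (sum f A) = (\<Sum>i\<in>A. pderiv (f i))"
  by (induction A rule: infinite_finite_induct) (simp_all add: pderiv_add)

lemma pderiv_poly_antideriv: "pderiv (poly_antideriv c P) = P"
proof -
  have "pderiv (poly_antideriv c P) = (\<Sum>i\<le>degree P. monom (coeff P i) i)"
    unfolding poly_antideriv_def
    by (simp add: pderiv_add pderiv_sum pderiv_monom pderiv_pCons del: of_nat_Suc)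
  then show ?thesis by (simp add: poly_as_sum_of_monoms)
qed

lemma poly_poly_antideriv_0 [simp]: "poly (poly_antideriv c P) 0 = c"
  by (simp add: poly_antideriv_def poly_sum poly_monom)

lemma degree_poly_antideriv: "degree P \<le> n \<Longrightarrow> degree (poly_antideriv c P) \<le> Suc n"
  unfolding poly_antideriv_def
  by (intro degree_add_le degree_sum_le) (auto intro: order_trans[OF degree_monom_le])

context wave_system begin

text \<open>\<open>derived \<tau> \<tau>'\<close> expresses that if \<open>\<tau>\<close> is the trace of a solution, then \<open>\<tau>'\<close> is the trace of
  its \<open>t\<close>-derivative.  \<open>A\<close> and \<open>D\<close> stand for \<open>a(x,x)\<close> and \<open>d(x,-x)\<close>, which are determined by \<open>\<tau>\<close>
  because the equations are ordinary differential equations along the characteristics.\<close>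

definition derived :: "(real \<Rightarrow> complex \<times> complex) \<Rightarrow> (real \<Rightarrow> complex \<times> complex) \<Rightarrow> bool" where
  "derived \<tau> \<tau>' \<longleftrightarrow> (\<exists>A D. A 0 = snd (\<tau> 0) \<and> D 0 = fst (\<tau> 0) \<and> (\<forall>x\<in>{0..b}.
     ((\<lambda>x. fst (\<tau> x)) has_vector_derivative v x * A x + 2 * fst (\<tau>' x)) (at x within {0..b}) \<and>
     (A has_vector_derivative u x * fst (\<tau> x)) (at x within {0..b}) \<and>
     ((\<lambda>x. snd (\<tau> x)) has_vector_derivative u x * D x - 2 * snd (\<tau>' x)) (at x within {0..b}) \<and>
     (D has_vector_derivative v x * snd (\<tau> x)) (at x within {0..b})))"

lemma derived_continuous:
  assumes "derived \<tau> \<tau>'" shows "continuous_on {0..b} \<tau>"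
proof -
  have "continuous_on {0..b} (\<lambda>x. fst (\<tau> x))" "continuous_on {0..b} (\<lambda>x. snd (\<tau> x))"
    using assms unfolding derived_def by (fast intro: continuous_on_vector_derivative)+
  from continuous_on_Pair[OF this] show ?thesis by simp
qed

lemma derived_diff:
  assumes "derived \<tau> \<tau>'" "derived \<sigma> \<sigma>'"
  shows "derived (\<lambda>x. \<tau> x - \<sigma> x) (\<lambda>x. \<tau>' x - \<sigma>' x)"
proof -
  from assms(1) obtain A D where 1: "A 0 = snd (\<tau> 0)" "D 0 = fst (\<tau> 0)"
     "\<And>x. x \<in> {0..b} \<Longrightarrow> ((\<lambda>x. fst (\<tau> x)) has_vector_derivative v x * A x + 2 * fst (\<tau>' x)) (at x within {0..b})"
     "\<And>x. x \<in> {0..b} \<Longrightarrow> (A has_vector_derivative u x * fst (\<tau> x)) (at x within {0..b})"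
     "\<And>x. x \<in> {0..b} \<Longrightarrow> ((\<lambda>x. snd (\<tau> x)) has_vector_derivative u x * D x - 2 * snd (\<tau>' x)) (at x within {0..b})"
     "\<And>x. x \<in> {0..b} \<Longrightarrow> (D has_vector_derivative v x * snd (\<tau> x)) (at x within {0..b})"
    unfolding derived_def by blast
  from assms(2) obtain A' D' where 2: "A' 0 = snd (\<sigma> 0)" "D' 0 = fst (\<sigma> 0)"
     "\<And>x. x \<in> {0..b} \<Longrightarrow> ((\<lambda>x. fst (\<sigma> x)) has_vector_derivative v x * A' x + 2 * fst (\<sigma>' x)) (at x within {0..b})"
     "\<And>x. x \<in> {0..b} \<Longrightarrow> (A' has_vector_derivative u x * fst (\<sigma> x)) (at x within {0..b})"
     "\<And>x. x \<in> {0..b} \<Longrightarrow> ((\<lambda>x. snd (\<sigma> x)) has_vector_derivative u x * D' x - 2 * snd (\<sigma>' x)) (at x within {0..b})"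
     "\<And>x. x \<in> {0..b} \<Longrightarrow> (D' has_vector_derivative v x * snd (\<sigma> x)) (at x within {0..b})"
    unfolding derived_def by blast
  show ?thesis unfolding derived_def
  proof (rule exI[of _ "\<lambda>x. A x - A' x"], rule exI[of _ "\<lambda>x. D x - D' x"], intro conjI ballI)
    fix x assume x: "x \<in> {0..b}"
    note has_vector_derivative_diff[OF 1(3)[OF x] 2(3)[OF x]] has_vector_derivative_diff[OF 1(4)[OF x] 2(4)[OF x]]
      has_vector_derivative_diff[OF 1(5)[OF x] 2(5)[OF x]] has_vector_derivative_diff[OF 1(6)[OF x] 2(6)[OF x]]
    from this[THEN has_vector_derivative_eq_rhs]
    show "((\<lambda>x. fst (\<tau> x - \<sigma> x)) has_vector_derivative v x * (A x - A' x) + 2 * fst (\<tau>' x - \<sigma>' x)) (at x within {0..b})"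
      "((\<lambda>x. A x - A' x) has_vector_derivative u x * fst (\<tau> x - \<sigma> x)) (at x within {0..b})"
      "((\<lambda>x. snd (\<tau> x - \<sigma> x)) has_vector_derivative u x * (D x - D' x) - 2 * snd (\<tau>' x - \<sigma>' x)) (at x within {0..b})"
      "((\<lambda>x. D x - D' x) has_vector_derivative v x * snd (\<tau> x - \<sigma> x)) (at x within {0..b})"
      by (simp_all add: algebra_simps)
  qed (use 1(1,2) 2(1,2) in simp_all)
qed

text \<open>With a zero trace at 0 the companions A and D vanish there too. So each trace component
  forms with its companion a linear system with zero initial values and a source of modulus twice
  that of a component of \<tau>'. The factor 4 is the square of that 2, and b comes from integrating
  a pointwise bound.\<close>

lemma derived_bound:
  assumes "derived \<tau> \<tau>'" "\<tau> 0 = 0" and \<tau>': "continuous_on {0..b} \<tau>'"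
  shows "msq 0 b \<tau> \<le> 4 * b * exp ((2 * bound + 1) * b) * msq 0 b \<tau>'"
proof -
  from assms(1) obtain A D where 1: "A 0 = snd (\<tau> 0)" "D 0 = fst (\<tau> 0)"
     "\<And>x. x \<in> {0..b} \<Longrightarrow> ((\<lambda>x. fst (\<tau> x)) has_vector_derivative v x * A x + 2 * fst (\<tau>' x)) (at x within {0..b})"
     "\<And>x. x \<in> {0..b} \<Longrightarrow> (A has_vector_derivative u x * fst (\<tau> x)) (at x within {0..b})"
     "\<And>x. x \<in> {0..b} \<Longrightarrow> ((\<lambda>x. snd (\<tau> x)) has_vector_derivative u x * D x - 2 * snd (\<tau>' x)) (at x within {0..b})"
     "\<And>x. x \<in> {0..b} \<Longrightarrow> (D has_vector_derivative v x * snd (\<tau> x)) (at x within {0..b})"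
    unfolding derived_def by blast
  define I where "I = msq 0 b \<tau>'"
  define c where "c = exp ((2 * bound + 1) * b)"
  have "(norm (\<tau> x))\<^sup>2 \<le> c * (4 * I)" if x: "x \<in> {0..b}" for x
  proof -
    have sub: "{0..x} \<subseteq> {0..b}" using x by auto
    note d = 1(3-6)[THEN has_vector_derivative_within_subset[OF _ sub]]
    have in_b: "s \<in> {0..b}" if "s \<in> {0..x}" for s using that x by auto
    have c1: "continuous_on {0..x} \<tau>'" by (rule continuous_on_subset[OF \<tau>' sub])
    have i: "(\<lambda>s. (cmod (2 * fst (\<tau>' s)))\<^sup>2) integrable_on {0..x}" "(\<lambda>s. (cmod (- 2 * snd (\<tau>' s)))\<^sup>2) integrable_on {0..x}"
      by (intro integrable_continuous_real continuous_intros c1)+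
    have "(cmod (fst (\<tau> x)))\<^sup>2 \<le> exp ((2 * bound + 1) * x) * msq 0 x (\<lambda>s. 2 * fst (\<tau>' s))"
      by (rule coupled_gronwall[of x bound "\<lambda>x. fst (\<tau> x)" v A _ u])
        (use x assms(2) 1(1,2) in \<open>auto intro!: d(1,2) in_b bound continuous_intros c1\<close>)
    moreover have "(cmod (snd (\<tau> x)))\<^sup>2 \<le> exp ((2 * bound + 1) * x) * msq 0 x (\<lambda>s. - 2 * snd (\<tau>' s))"
      by (rule coupled_gronwall[of x bound "\<lambda>x. snd (\<tau> x)" u D _ v])
        (use x assms(2) 1(1,2) in \<open>auto intro!: d(3,4)[THEN has_vector_derivative_eq_rhs] in_b bound continuous_intros c1\<close>)
    ultimately have "(norm (\<tau> x))\<^sup>2 \<le> exp ((2 * bound + 1) * x) *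
       (msq 0 x (\<lambda>s. 2 * fst (\<tau>' s)) + msq 0 x (\<lambda>s. - 2 * snd (\<tau>' s)))"
      by (simp add: norm_prod_def distrib_left)
    also have "msq 0 x (\<lambda>s. 2 * fst (\<tau>' s)) + msq 0 x (\<lambda>s. - 2 * snd (\<tau>' s))
       = integral {0..x} (\<lambda>s. 4 * (norm (\<tau>' s))\<^sup>2)"
      by (subst integral_add[OF i, symmetric]) (simp add: norm_mult norm_prod_def power_mult_distrib)
    also have "\<dots> \<le> 4 * I"
      unfolding I_def integral_mult_right[symmetric] using sub
      by (intro integral_subset_le integrable_continuous_real continuous_intros c1 \<tau>') auto
    also have "exp ((2 * bound + 1) * x) * (4 * I) \<le> c * (4 * I)"
      unfolding c_def I_def using x bound(1)
      by (intro mult_right_mono mult_nonneg_nonneg integral_nonneg integrable_continuous_real continuous_intros \<tau>') auto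
    finally show ?thesis by simp
  qed
  then have "msq 0 b \<tau> \<le> integral {0..b} (\<lambda>x. c * (4 * I))"
    by (intro integral_le integrable_continuous_real continuous_intros derived_continuous[OF assms(1)])
  also have "\<dots> = 4 * b * c * I" using b by simp
  finally show ?thesis unfolding I_def c_def .
qed

text \<open>Along the line t = c x the t-derivative enters with the factor c - 1 for a and c + 1 for
  d. For c = 1 and c = -1 one factor vanishes, which gives the companion equations, and the other is
  2 or -2.\<close>

lemma derived_tr: "derived (tr (P, R)) (tr (pderiv P, pderiv R))"
proof -
  have along: "((\<lambda>x. wa P R x (c * x)) has_vector_derivative
      u x * wd P R x (c * x) + (c - 1) *\<^sub>R wa (pderiv P) (pderiv R) x (c * x)) (at x within {0..b})"
    "((\<lambda>x. wd P R x (c * x)) has_vector_derivative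
      v x * wa P R x (c * x) + (c + 1) *\<^sub>R wd (pderiv P) (pderiv R) x (c * x)) (at x within {0..b})"
    if x: "x \<in> {0..b}" for x c
  proof -
    have c: "continuous_on ({0..b} \<times> UNIV) (\<lambda>(x, t). wa (pderiv P) (pderiv R) x t)"
      "continuous_on ({0..b} \<times> UNIV) (\<lambda>(x, t). wd (pderiv P) (pderiv R) x t)"
      unfolding split_beta by (intro continuous_on_w continuous_intros; auto)+
    have l: "((*) c has_vector_derivative c) (at x within {0..b})"
      by (auto intro!: derivative_eq_intros)
    show "((\<lambda>x. wa P R x (c * x)) has_vector_derivative
      u x * wd P R x (c * x) + (c - 1) *\<^sub>R wa (pderiv P) (pderiv R) x (c * x)) (at x within {0..b})"
      by (rule has_vector_derivative_eq_rhs, rule has_vector_derivative_along_curve[where F="wa P R" and Fx="\<lambda>x t. u x * wd P R x t - wa (pderiv P) (pderiv R) x t"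
            and Fy="wa (pderiv P) (pderiv R)" and S="{0..b}" and s=x and \<gamma>="(*) c" and \<gamma>'=c and T=UNIV])
        (use x in \<open>auto simp: algebra_simps intro!: wa_dx w_dt c l\<close>)
    show "((\<lambda>x. wd P R x (c * x)) has_vector_derivative
      v x * wa P R x (c * x) + (c + 1) *\<^sub>R wd (pderiv P) (pderiv R) x (c * x)) (at x within {0..b})"
      by (rule has_vector_derivative_eq_rhs, rule has_vector_derivative_along_curve[where F="wd P R" and Fx="\<lambda>x t. v x * wa P R x t + wd (pderiv P) (pderiv R) x t"
            and Fy="wd (pderiv P) (pderiv R)" and S="{0..b}" and s=x and \<gamma>="(*) c" and \<gamma>'=c and T=UNIV])
        (use x in \<open>auto simp: algebra_simps intro!: wd_dx[unfolded add.commute[of "v _ * _"]] w_dt c l\<close>)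
  qed
  show ?thesis
    unfolding derived_def tr_def
    by (rule exI[of _ "\<lambda>x. wa P R x x"], rule exI[of _ "\<lambda>x. wd P R x (- x)"])
      (use along[where c=1] along[where c="-1"] in \<open>auto simp: scaleR_conv_of_real\<close>)
qed

text \<open>The companions are obtained by integration, and the two remaining equations are solved
  for \<tau>'. This spends one derivative of \<tau>, but none of u and v.\<close>

lemma derived_exists:
  assumes "Cr_on (Suc r) {0..b} \<tau>" "Cr_on r {0..b} u" "Cr_on r {0..b} v"
  shows "\<exists>\<tau>'. derived \<tau> \<tau>' \<and> Cr_on r {0..b} \<tau>'"
proof -
  obtain \<tau>d where \<tau>d: "\<And>x. x \<in> {0..b} \<Longrightarrow> (\<tau> has_vector_derivative \<tau>d x) (at x within {0..b})" "Cr_on r {0..b} \<tau>d"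
    using assms(1) unfolding Cr_on.simps by blast
  have \<tau>: "Cr_on r {0..b} \<tau>" by (rule Cr_on_SucD[OF assms(1)])
  note fs = Cr_on_bounded_linear[OF bounded_linear_fst \<tau>] Cr_on_bounded_linear[OF bounded_linear_snd \<tau>]
  define A where "A x = snd (\<tau> 0) + integral {0..x} (\<lambda>s. u s * fst (\<tau> s))" for x
  define D where "D x = fst (\<tau> 0) + integral {0..x} (\<lambda>s. v s * snd (\<tau> s))" for x
  have cr: "Cr_on r {0..b} (\<lambda>s. u s * fst (\<tau> s))" "Cr_on r {0..b} (\<lambda>s. v s * snd (\<tau> s))"
    by (intro Cr_on_mult assms fs)+
  have dA: "(A has_vector_derivative u x * fst (\<tau> x)) (at x within {0..b})"
    and dD: "(D has_vector_derivative v x * snd (\<tau> x)) (at x within {0..b})" if "x \<in> {0..b}" for x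
    unfolding A_def D_def
    using integral_has_vector_derivative[OF Cr_on_imp_continuous_on[OF cr(1)] that]
      integral_has_vector_derivative[OF Cr_on_imp_continuous_on[OF cr(2)] that]
    by (auto intro!: derivative_eq_intros)
  have "Cr_on (Suc r) {0..b} A"
    unfolding Cr_on.simps by (rule exI[of _ "\<lambda>x. u x * fst (\<tau> x)"], rule conjI) (use dA cr(1) in auto)
  moreover have "Cr_on (Suc r) {0..b} D"
    unfolding Cr_on.simps by (rule exI[of _ "\<lambda>x. v x * snd (\<tau> x)"], rule conjI) (use dD cr(2) in auto)
  ultimately have crAD: "Cr_on r {0..b} A" "Cr_on r {0..b} D" by (simp_all only: Cr_on_SucD)
  have half: "bounded_linear (\<lambda>z. c * z)" for c :: complex by (rule bounded_linear_mult_right)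
  \<comment> \<open>The factors \<open>(- 1)\<close> stand for subtraction, so that the closure
    rules of \<open>Cr_on\<close> for sums and products apply directly.\<close>
  define \<tau>' where "\<tau>' x = ((1/2) * (fst (\<tau>d x) + (- 1) * (v x * A x)), (1/2) * (u x * D x + (- 1) * snd (\<tau>d x)))" for x
  have "Cr_on r {0..b} \<tau>'"
    unfolding \<tau>'_def[abs_def]
    by (intro Cr_on_Pair Cr_on_bounded_linear[OF half] Cr_on_add Cr_on_mult crAD assms
        Cr_on_bounded_linear[OF bounded_linear_fst \<tau>d(2)] Cr_on_bounded_linear[OF bounded_linear_snd \<tau>d(2)])
  moreover have "derived \<tau> \<tau>'"
    unfolding derived_def
  proof (rule exI[of _ A], rule exI[of _ D], intro conjI ballI)
    fix x assume x: "x \<in> {0..b}"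
    show "((\<lambda>x. fst (\<tau> x)) has_vector_derivative v x * A x + 2 * fst (\<tau>' x)) (at x within {0..b})"
      using bounded_linear.has_vector_derivative[OF bounded_linear_fst \<tau>d(1)[OF x]] by (simp add: \<tau>'_def diff_divide_distrib)
    show "((\<lambda>x. snd (\<tau> x)) has_vector_derivative u x * D x - 2 * snd (\<tau>' x)) (at x within {0..b})"
      using bounded_linear.has_vector_derivative[OF bounded_linear_snd \<tau>d(1)[OF x]] by (simp add: \<tau>'_def diff_divide_distrib)
  qed (use dA dD in \<open>auto simp: A_def D_def\<close>)
  ultimately show ?thesis by blast
qed


lemma jackson_cauchy:
  "\<exists>W'. degree (fst W') \<le> N \<and> degree (snd W') \<le> N \<and>
    msq (-2*b) (2*b) (cauchy (W - W'))
    \<le> (2 * b / real (N + 1))\<^sup>2 * msq (-2*b) (2*b) (cauchy (pderiv (fst W), pderiv (snd W)))"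
proof -
  have "0 < 2 * b" using b by simp
  from jackson_L2[OF this, of N "fst W"] jackson_L2[OF this, of N "snd W"]
  obtain P R where *: "degree P \<le> N" "msq (- (2*b)) (2*b) (\<lambda>t. poly (fst W - P) (of_real t))
     \<le> (2 * b / real (N + 1))\<^sup>2 * msq (- (2*b)) (2*b) (\<lambda>t. poly (pderiv (fst W)) (of_real t))"
    "degree R \<le> N" "msq (- (2*b)) (2*b) (\<lambda>t. poly (snd W - R) (of_real t))
     \<le> (2 * b / real (N + 1))\<^sup>2 * msq (- (2*b)) (2*b) (\<lambda>t. poly (pderiv (snd W)) (of_real t))"
    by blast
  have split: "msq (-2*b) (2*b) (cauchy (F, G))
     = msq (- (2*b)) (2*b) (\<lambda>t. poly F (of_real t)) + msq (- (2*b)) (2*b) (\<lambda>t. poly G (of_real t))" for F G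
    unfolding cauchy_def norm_Pair_square fst_conv snd_conv mult_minus_left
    by (intro integral_add integrable_continuous_real continuous_intros)
  have "W - (P, R) = (fst W - P, snd W - R)" by (simp add: prod_eq_iff)
  then have "msq (-2*b) (2*b) (cauchy (W - (P, R)))
    \<le> (2 * b / real (N + 1))\<^sup>2 * msq (-2*b) (2*b) (cauchy (pderiv (fst W), pderiv (snd W)))"
    using add_mono[OF *(2) *(4)] by (simp only: split distrib_left)
  then show ?thesis using *(1,3) by (intro exI[of _ "(P, R)"]) simp
qed

text \<open>Density is applied to \<tau>' rather than to \<tau>. The data found there are bounded in
  terms of \<tau>' and are the derivatives of the integrated data, so their size is exactly the
  right-hand side of the Jackson inequality. The summand \<epsilon> absorbs the density error, and
  the constant is independent of it.\<close>

lemma C1_approx: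
  "\<exists>c\<ge>0. \<forall>\<tau> \<tau>' N \<epsilon>. derived \<tau> \<tau>' \<longrightarrow> \<tau> 0 = 0 \<longrightarrow> continuous_on {0..b} \<tau>' \<longrightarrow> \<epsilon> > 0 \<longrightarrow>
    (\<exists>W. degree (fst W) \<le> N \<and> degree (snd W) \<le> N \<and>
      msq 0 b (\<lambda>x. \<tau> x - tr W x)
      \<le> c / (real (N + 1))\<^sup>2 * msq 0 b \<tau>' + \<epsilon>)"
proof -
  obtain cd where cd: "0 \<le> cd" "\<And>(\<tau> :: real \<Rightarrow> complex \<times> complex) \<epsilon>. continuous_on {0..b} \<tau> \<Longrightarrow> \<epsilon> > 0 \<Longrightarrow>
    (\<exists>W. msq (-2*b) (2*b) (cauchy W) \<le> cd * msq 0 b \<tau>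
     \<and> msq 0 b (\<lambda>x. \<tau> x - tr W x) \<le> \<epsilon>)"
    using trace_density by blast
  define c1 where "c1 = 4 * b * exp ((2 * bound + 1) * b)"
  define c2 where "c2 = 1 + 2 * b * K"
  have c: "0 < c1" "0 \<le> c2" using b K_nonneg by (simp_all add: c1_def c2_def)
  show ?thesis
  proof (intro exI[of _ "2 * c2 * (2 * b)\<^sup>2 * cd"] conjI allI impI)
    show "0 \<le> 2 * c2 * (2 * b)\<^sup>2 * cd" using c cd by simp
    fix \<tau> \<tau>' :: "real \<Rightarrow> complex \<times> complex" and N :: nat and \<epsilon> :: real
    assume \<tau>: "derived \<tau> \<tau>'" "\<tau> 0 = 0" "continuous_on {0..b} \<tau>'" and "\<epsilon> > 0"
    define I where "I = msq 0 b \<tau>'"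
    \<comment> \<open>The error in \<tau>' is amplified by \<open>c1\<close> on integration and
      doubled when the errors are added.\<close>
    have "0 < \<epsilon> / (2 * c1)" using \<open>\<epsilon> > 0\<close> c by simp
    from cd(2)[OF \<tau>(3) this] obtain W1 where W1: "msq (-2*b) (2*b) (cauchy W1) \<le> cd * I"
       "msq 0 b (\<lambda>x. \<tau>' x - tr W1 x) \<le> \<epsilon> / (2 * c1)"
      unfolding I_def by blast
    \<comment> \<open>Zero constants of integration: the trace vanishes at 0, as \<tau>
      does.\<close>
    define W2 where "W2 = (poly_antideriv 0 (fst W1), poly_antideriv 0 (snd W1))"
    have W2': "(pderiv (fst W2), pderiv (snd W2)) = W1" by (simp add: W2_def pderiv_poly_antideriv)
    have d2: "derived (tr W2) (tr W1)"
      using derived_tr[of "fst W2" "snd W2"] by (simp add: W2')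
    have "tr W2 0 = 0" by (simp add: tr_def w_initial W2_def zero_prod_def)
    then have e: "msq 0 b (\<lambda>x. \<tau> x - tr W2 x) \<le> c1 * msq 0 b (\<lambda>x. \<tau>' x - tr W1 x)"
      unfolding c1_def using \<tau>
      by (intro derived_bound derived_diff d2 continuous_intros continuous_on_tr) auto
    also have "\<dots> \<le> c1 * (\<epsilon> / (2 * c1))" using W1(2) c by (intro mult_left_mono) auto
    also have "\<dots> = \<epsilon> / 2" using c by simp
    finally have e: "msq 0 b (\<lambda>x. \<tau> x - tr W2 x) \<le> \<epsilon> / 2" .
    obtain W3 where W3: "degree (fst W3) \<le> N" "degree (snd W3) \<le> N"
      "msq (-2*b) (2*b) (cauchy (W2 - W3)) \<le> (2 * b / real (N + 1))\<^sup>2 * msq (-2*b) (2*b) (cauchy W1)"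
      using jackson_cauchy[of N W2] unfolding W2' by blast
    have "msq 0 b (tr (W2 - W3)) \<le> c2 * ((2 * b / real (N + 1))\<^sup>2 * (cd * I))"
      using order_trans[OF W3(3) mult_left_mono[OF W1(1)]] c(2) unfolding c2_def
      by (intro order_trans[OF tr_L2_bound mult_left_mono]) auto
    moreover have "msq 0 b (\<lambda>x. \<tau> x - tr W3 x)
      \<le> integral {0..b} (\<lambda>x. 2 * (norm (\<tau> x - tr W2 x))\<^sup>2 + 2 * (norm (tr (W2 - W3) x))\<^sup>2)"
    proof (intro integral_le integrable_continuous_real continuous_intros continuous_on_tr derived_continuous[OF \<tau>(1)])
      fix x show "(norm (\<tau> x - tr W3 x))\<^sup>2 \<le> 2 * (norm (\<tau> x - tr W2 x))\<^sup>2 + 2 * (norm (tr (W2 - W3) x))\<^sup>2"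
        using norm_add_square_le[of "\<tau> x - tr W2 x" "tr (W2 - W3) x"] by (simp add: tr_diff)
    qed
    moreover have "\<dots> = 2 * msq 0 b (\<lambda>x. \<tau> x - tr W2 x) + 2 * msq 0 b (tr (W2 - W3))"
      by (simp add: integral_add integrable_continuous_real continuous_intros continuous_on_tr derived_continuous[OF \<tau>(1)])
    ultimately have "msq 0 b (\<lambda>x. \<tau> x - tr W3 x) \<le> 2 * (c2 * ((2 * b / real (N + 1))\<^sup>2 * (cd * I))) + \<epsilon>"
      using e by linarith
    also have "2 * (c2 * ((2 * b / real (N + 1))\<^sup>2 * (cd * I))) = 2 * c2 * (2 * b)\<^sup>2 * cd / (real (N + 1))\<^sup>2 * I"
      by (simp add: power_divide)
    finally show "\<exists>W. degree (fst W) \<le> N \<and> degree (snd W) \<le> N \<and>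
      msq 0 b (\<lambda>x. \<tau> x - tr W x)
      \<le> 2 * c2 * (2 * b)\<^sup>2 * cd / (real (N + 1))\<^sup>2 * msq 0 b \<tau>' + \<epsilon>"
      using W3 unfolding I_def by blast
  qed
qed

text \<open>The induction hypothesis treats the derived trace with degree N - 1. Integrating these
  data stays within degree N and leaves a residual whose derived trace already has mean square of
  order N^(-2r); \<open>C1_approx\<close>, applied to the residual, supplies the missing factor 1/(N
  + 1)^2.\<close>

theorem trace_approximation_rate:
  assumes "Cr_on r {0..b} u" "Cr_on r {0..b} v" "Cr_on r {0..b} \<tau>"
  shows "\<exists>M\<ge>0. \<forall>N. \<exists>W. degree (fst W) \<le> N \<and> degree (snd W) \<le> N \<and>
    msq 0 b (\<lambda>x. \<tau> x - tr W x) \<le> M / (real (N + 1)) ^ (2 * r)"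
  using assms
proof (induction r arbitrary: \<tau>)
  case 0
  then have "continuous_on {0..b} \<tau>" by simp
  then have "0 \<le> msq 0 b \<tau>"
    by (intro integral_nonneg integrable_continuous_real continuous_intros) auto
  then show ?case
    by (intro exI[of _ "msq 0 b \<tau>"] conjI allI exI[of _ 0]) auto
next
  case (Suc r)
  have cr: "Cr_on r {0..b} u" "Cr_on r {0..b} v" using Suc.prems by (simp_all only: Cr_on_SucD)
  obtain \<tau>' where \<tau>': "derived \<tau> \<tau>'" "Cr_on r {0..b} \<tau>'"
    using derived_exists[OF Suc.prems(3) cr] by blast
  obtain M where M: "0 \<le> M" "\<And>N. \<exists>W. degree (fst W) \<le> N \<and> degree (snd W) \<le> N \<and>
    msq 0 b (\<lambda>x. \<tau>' x - tr W x) \<le> M / (real (N + 1)) ^ (2 * r)"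
    using Suc.IH[OF cr \<tau>'(2)] by blast
  obtain c where c: "0 \<le> c" "\<And>\<tau> \<tau>' N \<epsilon>. derived \<tau> \<tau>' \<Longrightarrow> \<tau> 0 = 0 \<Longrightarrow> continuous_on {0..b} \<tau>' \<Longrightarrow> \<epsilon> > 0 \<Longrightarrow>
    (\<exists>W. degree (fst W) \<le> N \<and> degree (snd W) \<le> N \<and>
      msq 0 b (\<lambda>x. \<tau> x - tr W x)
      \<le> c / (real (N + 1))\<^sup>2 * msq 0 b \<tau>' + \<epsilon>)"
    using C1_approx by blast
  define M0 where "M0 = msq 0 b \<tau>"
  have "0 \<le> M0" unfolding M0_def
    by (intro integral_nonneg integrable_continuous_real continuous_intros derived_continuous[OF \<tau>'(1)]) auto
  show ?case
  \<comment> \<open>\<open>M0\<close> serves N = 0, where the zero solution is taken; the power of 2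
    comes from N + 1 \<le> 2 (n + 1) for N = n + 1; the last 1 pays for \<epsilon>.\<close>
  proof (intro exI[of _ "M0 + c * M * 2 ^ (2 * r) + 1"] conjI allI)
    show "0 \<le> M0 + c * M * 2 ^ (2 * r) + 1" using \<open>0 \<le> M0\<close> M c by simp
    fix N :: nat
    show "\<exists>W. degree (fst W) \<le> N \<and> degree (snd W) \<le> N \<and>
      msq 0 b (\<lambda>x. \<tau> x - tr W x) \<le> (M0 + c * M * 2 ^ (2 * r) + 1) / (real (N + 1)) ^ (2 * Suc r)"
    proof (cases N)
      case 0
      then show ?thesis using M(1) c(1) by (intro exI[of _ 0]) (simp add: M0_def)
    next
      case (Suc n)
      obtain W1 where W1: "degree (fst W1) \<le> n" "degree (snd W1) \<le> n"
        "msq 0 b (\<lambda>x. \<tau>' x - tr W1 x) \<le> M / (real (n + 1)) ^ (2 * r)"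
        using M(2) by blast
      \<comment> \<open>The constants are crossed because the first polynomial is the data of a,
        whose trace is the second component. With them the residual vanishes at 0, as
        \<open>C1_approx\<close> demands.\<close>
      define W2 where "W2 = (poly_antideriv (snd (\<tau> 0)) (fst W1), poly_antideriv (fst (\<tau> 0)) (snd W1))"
      have W2': "(pderiv (fst W2), pderiv (snd W2)) = W1" by (simp add: W2_def pderiv_poly_antideriv)
      have d2: "derived (tr W2) (tr W1)"
        using derived_tr[of "fst W2" "snd W2"] by (simp add: W2')
      have z: "\<tau> 0 - tr W2 0 = 0" by (simp add: tr_def w_initial W2_def prod_eq_iff)
      define \<epsilon> where "\<epsilon> = 1 / (real (N + 1)) ^ (2 * Suc r)"
      have "0 < \<epsilon>" by (simp add: \<epsilon>_def)
      have "continuous_on {0..b} (\<lambda>x. \<tau>' x - tr W1 x)"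
        by (intro continuous_intros continuous_on_tr Cr_on_imp_continuous_on[OF \<tau>'(2)])
      from c(2)[OF derived_diff[OF \<tau>'(1) d2] z this \<open>0 < \<epsilon>\<close>, of N]
      obtain W3 where W3: "degree (fst W3) \<le> N" "degree (snd W3) \<le> N"
        "msq 0 b (\<lambda>x. \<tau> x - tr W2 x - tr W3 x)
        \<le> c / (real (N + 1))\<^sup>2 * msq 0 b (\<lambda>x. \<tau>' x - tr W1 x) + \<epsilon>" by blast
      have "degree (fst (W2 + W3)) \<le> N" "degree (snd (W2 + W3)) \<le> N"
        using W3 W1 by (auto simp: W2_def Suc intro!: degree_add_le degree_poly_antideriv)
      moreover have "msq 0 b (\<lambda>x. \<tau> x - tr (W2 + W3) x) \<le> (M0 + c * M * 2 ^ (2 * r) + 1) / (real (N + 1)) ^ (2 * Suc r)"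
      proof -
        have "real (N + 1) ^ (2 * r) \<le> (2 * real (n + 1)) ^ (2 * r)"
          by (rule power_mono) (simp_all add: Suc)
        then have "M * real (N + 1) ^ (2 * r) \<le> M * (2 ^ (2 * r) * real (n + 1) ^ (2 * r))"
          using M(1) by (intro mult_left_mono) (simp_all only: power_mult_distrib)
        then have "M / real (n + 1) ^ (2 * r) \<le> M * 2 ^ (2 * r) / real (N + 1) ^ (2 * r)"
          by (simp add: divide_simps mult.assoc)
        then have "c / (real (N + 1))\<^sup>2 * msq 0 b (\<lambda>x. \<tau>' x - tr W1 x)
          \<le> c / (real (N + 1))\<^sup>2 * (M * 2 ^ (2 * r) / real (N + 1) ^ (2 * r))"
          using c(1) W1(3) by (intro mult_left_mono) auto
        also have "\<dots> = c * M * 2 ^ (2 * r) / real (N + 1) ^ (2 * Suc r)"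
          by (simp add: power2_eq_square mult.assoc)
        finally have "msq 0 b (\<lambda>x. \<tau> x - tr (W2 + W3) x) \<le> (c * M * 2 ^ (2 * r) + 1) / real (N + 1) ^ (2 * Suc r)"
          using W3(3) by (simp add: tr_add diff_diff_eq \<epsilon>_def add_divide_distrib)
        also have "\<dots> \<le> (M0 + c * M * 2 ^ (2 * r) + 1) / real (N + 1) ^ (2 * Suc r)"
          using \<open>0 \<le> M0\<close> by (intro divide_right_mono) auto
        finally show ?thesis .
      qed
      ultimately show ?thesis by blast
    qed
  qed
qed

end

section \<open>Two-dimensional linear algebra\<close>

lemma vec2_eq_iff: "(x :: 'a^2) = y \<longleftrightarrow> x $ 1 = y $ 1 \<and> x $ 2 = y $ 2"
  by (simp add: vec_eq_iff forall_2)

lemma mat2_eq_iff: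
  "(x :: 'a^2^2) = y \<longleftrightarrow> x $ 1 $ 1 = y $ 1 $ 1 \<and> x $ 1 $ 2 = y $ 1 $ 2 \<and> x $ 2 $ 1 = y $ 2 $ 1 \<and> x $ 2 $ 2 = y $ 2 $ 2"
  by (auto simp: vec_eq_iff forall_2)

lemma matrix_vector_mult_2:
  "(A *v x) $ i = A $ i $ 1 * x $ 1 + A $ i $ 2 * x $ 2" for A :: "'a::semiring_1^2^'n"
  by (simp add: matrix_vector_mult_def sum_2)

lemma matrix_matrix_mult_2:
  "(A ** B) $ i $ j = A $ i $ 1 * B $ 1 $ j + A $ i $ 2 * B $ 2 $ j" for A :: "'a::semiring_1^2^'n"
  by (simp add: matrix_matrix_mult_def sum_2)

lemma columns2_nth: "columns2 y z $ i $ 1 = y $ i" "columns2 y z $ i $ 2 = z $ i"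
  by (simp_all add: columns2_def transpose_def)

lemma matB_nth: "matB $ 1 $ 1 = 0" "matB $ 1 $ 2 = 1" "matB $ 2 $ 1 = - 1" "matB $ 2 $ 2 = 0"
  by (simp_all add: matB_def)

lemma matQ_nth: "matQ p q x $ 1 $ 1 = p x" "matQ p q x $ 1 $ 2 = q x" "matQ p q x $ 2 $ 1 = q x" "matQ p q x $ 2 $ 2 = - p x"
  by (simp_all add: matQ_def)

lemmas mat2_simps = vec2_eq_iff mat2_eq_iff matrix_vector_mult_2 matrix_matrix_mult_2 columns2_nth matB_nth matQ_nth

lemma norm_vec2_square: "(norm (y :: complex^2))\<^sup>2 = (cmod (y $ 1))\<^sup>2 + (cmod (y $ 2))\<^sup>2"
  by (simp add: norm_vec_def L2_set_def sum_2)

lemma norm_mat2_square: "(norm (A :: complex^2^2))\<^sup>2 = (norm (A $ 1))\<^sup>2 + (norm (A $ 2))\<^sup>2"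
  by (simp add: norm_vec_def[of A] L2_set_def sum_2)

lemma norm_matrix_vector_mult_le: "norm (A *v y) \<le> norm A * norm y" for A :: "complex^2^2"
proof (rule power2_le_imp_le)
  have row: "(cmod ((A *v y) $ i))\<^sup>2 \<le> (norm (A $ i))\<^sup>2 * (norm y)\<^sup>2" for i
  proof -
    have "cmod ((A *v y) $ i) \<le> (\<Sum>j\<in>UNIV. cmod (A $ i $ j) * cmod (y $ j))"
      unfolding matrix_vector_mult_def vec_lambda_beta by (rule order_trans[OF norm_sum]) (simp add: norm_mult)
    also have "\<dots> \<le> norm (A $ i) * norm y"
      using L2_set_mult_ineq[of "\<lambda>j. cmod (A $ i $ j)" "\<lambda>j. cmod (y $ j)" UNIV] by (simp add: norm_vec_def)
    finally show ?thesis by (metis norm_ge_zero power_mono power_mult_distrib)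
  qed
  show "(norm (A *v y))\<^sup>2 \<le> (norm A * norm y)\<^sup>2"
    using row[of 1] row[of 2] by (simp add: norm_vec2_square[of "A *v y"] norm_mat2_square power_mult_distrib algebra_simps)
qed simp

lemma scaleR_nth_complex:
  "(r *\<^sub>R (y :: complex^'n)) $ i = of_real r * y $ i"
  "(r *\<^sub>R (A :: complex^'m^'n)) $ i $ j = of_real r * A $ i $ j"
  using scaleR_conv_of_real[of r "y $ i"] scaleR_conv_of_real[of r "A $ i $ j"] by simp_all

lemma bounded_bilinear_matrix_vector_mult: "bounded_bilinear (\<lambda>(A :: complex^2^2) y. A *v y)"
  unfolding bilinear_conv_bounded_bilinear[symmetric] bilinear_def
  by (intro conjI allI linearI; simp add: mat2_simps scaleR_nth_complex del: vector_scaleR_component; simp add: algebra_simps)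

lemma bounded_bilinear_matrix_matrix_mult: "bounded_bilinear (\<lambda>(A :: complex^2^2) (B :: complex^2^2). A ** B)"
  unfolding bilinear_conv_bounded_bilinear[symmetric] bilinear_def
  by (intro conjI allI linearI; simp add: mat2_simps scaleR_nth_complex del: vector_scaleR_component; simp add: algebra_simps)

lemma bounded_linear_smult: "bounded_linear ((*s) c :: complex^2 \<Rightarrow> _)"
  unfolding linear_conv_bounded_linear[symmetric]
  by (intro linearI; simp add: vec2_eq_iff scaleR_nth_complex del: vector_scaleR_component; simp add: algebra_simps)

lemmas matvec_add_left = bounded_bilinear.add_left[OF bounded_bilinear_matrix_vector_mult]
  and matvec_add_right = bounded_bilinear.add_right[OF bounded_bilinear_matrix_vector_mult]
  and matvec_diff_left = bounded_bilinear.diff_left[OF bounded_bilinear_matrix_vector_mult]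
  and matvec_scaleR_left = bounded_bilinear.scaleR_left[OF bounded_bilinear_matrix_vector_mult]
  and matvec_scaleR_right = bounded_bilinear.scaleR_right[OF bounded_bilinear_matrix_vector_mult]
  and matvec_sum_left = bounded_bilinear.sum_left[OF bounded_bilinear_matrix_vector_mult]
  and matvec_sum_right = bounded_bilinear.sum_right[OF bounded_bilinear_matrix_vector_mult]
  and matvec_zero_left = bounded_bilinear.zero_left[OF bounded_bilinear_matrix_vector_mult]

lemmas matmul_add_left = bounded_bilinear.add_left[OF bounded_bilinear_matrix_matrix_mult]
  and matmul_add_right = bounded_bilinear.add_right[OF bounded_bilinear_matrix_matrix_mult]
  and matmul_bounded_linear_left = bounded_bilinear.bounded_linear_left[OF bounded_bilinear_matrix_matrix_mult]
  and matmul_diff_left = bounded_bilinear.diff_left[OF bounded_bilinear_matrix_matrix_mult]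
  and matmul_minus_left = bounded_bilinear.minus_left[OF bounded_bilinear_matrix_matrix_mult]
  and matmul_minus_right = bounded_bilinear.minus_right[OF bounded_bilinear_matrix_matrix_mult]
  and matmul_scaleR_left = bounded_bilinear.scaleR_left[OF bounded_bilinear_matrix_matrix_mult]
  and matmul_scaleR_right = bounded_bilinear.scaleR_right[OF bounded_bilinear_matrix_matrix_mult]
  and matmul_sum_left = bounded_bilinear.sum_left[OF bounded_bilinear_matrix_matrix_mult]
  and matmul_sum_right = bounded_bilinear.sum_right[OF bounded_bilinear_matrix_matrix_mult]
  and matmul_zero_left = bounded_bilinear.zero_left[OF bounded_bilinear_matrix_matrix_mult]
  and matmul_zero_right = bounded_bilinear.zero_right[OF bounded_bilinear_matrix_matrix_mult]

lemma has_vector_derivative_vector2: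
  fixes y z :: "real \<Rightarrow> complex"
  assumes "(y has_vector_derivative y') F" "(z has_vector_derivative z') F"
  shows "((\<lambda>x. vector [y x, z x] :: complex^2) has_vector_derivative vector [y', z']) F"
proof -
  have 1: "bounded_linear (\<lambda>w. vector [w, 0] :: complex^2)" and 2: "bounded_linear (\<lambda>w. vector [0, w] :: complex^2)"
    unfolding linear_conv_bounded_linear[symmetric] by (intro linearI; simp add: vec2_eq_iff)+
  have *: "vector [w, w'] = (vector [w, 0] :: complex^2) + vector [0, w']" for w w'
    by (simp add: vec2_eq_iff)
  show ?thesis
    using has_vector_derivative_add[OF bounded_linear.has_vector_derivative[OF 1 assms(1)]
        bounded_linear.has_vector_derivative[OF 2 assms(2)]]
    by (simp only: *[symmetric])
qed

lemma has_vector_derivative_columns2: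
  assumes "(y has_vector_derivative y') F" "(z has_vector_derivative z') F"
  shows "((\<lambda>x. columns2 (y x) (z x)) has_vector_derivative columns2 y' z') F"
proof -
  have 1: "bounded_linear (\<lambda>w. columns2 w 0)" and 2: "bounded_linear (\<lambda>w. columns2 0 w)"
    unfolding linear_conv_bounded_linear[symmetric] by (intro linearI; simp add: mat2_simps)+
  have *: "columns2 w w' = columns2 w 0 + columns2 0 w'" for w w'
    by (simp add: mat2_simps)
  show ?thesis
    using has_vector_derivative_add[OF bounded_linear.has_vector_derivative[OF 1 assms(1)]
        bounded_linear.has_vector_derivative[OF 2 assms(2)]]
    by (simp only: *[symmetric])
qed

text \<open>Coordinates with respect to the eigenvectors \<open>(1, \<i>)\<close> and \<open>(1, -\<i>)\<close> of \<open>B\<close>.\<close>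

definition ca :: "complex^2 \<Rightarrow> complex" where "ca y = (y $ 1 - \<i> * y $ 2) / 2"

definition cd :: "complex^2 \<Rightarrow> complex" where "cd y = (y $ 1 + \<i> * y $ 2) / 2"

lemma bounded_linear_ca: "bounded_linear ca" and bounded_linear_cd: "bounded_linear cd"
  unfolding linear_conv_bounded_linear[symmetric] ca_def cd_def
  by (intro linearI; simp add: scaleR_nth_complex del: vector_scaleR_component; simp add: scaleR_conv_of_real field_simps)+

lemma ca_cd_add: "ca (y + z) = ca y + ca z" "cd (y + z) = cd y + cd z"
  and ca_cd_minus: "ca (- y) = - ca y" "cd (- y) = - cd y"
  and ca_cd_scale: "ca (c *s y) = c * ca y" "cd (c *s y) = c * cd y"
  and ca_cd_matB: "ca (matB *v y) = \<i> * ca y" "cd (matB *v y) = - \<i> * cd y"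
  by (simp_all add: ca_def cd_def mat2_simps field_simps)

lemma ca_cd_sum: "ca (\<Sum>i\<in>A. h i) = (\<Sum>i\<in>A. ca (h i))" "cd (\<Sum>i\<in>A. h i) = (\<Sum>i\<in>A. cd (h i))"
  by (simp_all add: linear_sum bounded_linear.linear bounded_linear_ca bounded_linear_cd)

text \<open>Q anticommutes with B, so B Q exchanges the two eigenspaces. This makes the system
  hyperbolic with off-diagonal coupling; the two factors become \<open>u\<close> and
  \<open>v\<close>.\<close>

lemma ca_cd_matBQ:
  "ca (matB *v (matQ p q x *v y)) = (q x + \<i> * p x) * cd y"
  "cd (matB *v (matQ p q x *v y)) = (q x - \<i> * p x) * ca y"
  by (simp_all add: ca_def cd_def mat2_simps field_simps)

lemma norm_square_ca_cd: "(norm y)\<^sup>2 = 2 * ((cmod (ca y))\<^sup>2 + (cmod (cd y))\<^sup>2)"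
  unfolding norm_vec2_square ca_def cd_def norm_divide power_divide cmod_power2
  by (simp add: power2_eq_square field_simps)

text \<open>The eigenvectors are orthogonal and have length sqrt 2.\<close>

lemma norm_mat2_square_eigen:
  fixes G :: "complex^2^2"
  shows "(norm G)\<^sup>2 = ((norm (G *v vector [1, \<i>]))\<^sup>2 + (norm (G *v vector [1, - \<i>]))\<^sup>2) / 2"
  unfolding norm_mat2_square norm_vec2_square matrix_vector_mult_2 vector_2 cmod_power2
  by (simp add: power2_eq_square algebra_simps)

section \<open>Formal powers\<close>

text \<open>An instance of the coupled estimate in which both unknowns are h and the source is
  zero.\<close>

lemma linear_ode_zero:
  fixes h c :: "real \<Rightarrow> complex"
  assumes "continuous_on {0..b} c" "\<And>s. s \<in> {0..b} \<Longrightarrow> (h has_vector_derivative c s * h s) (at s within {0..b})"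
    and "h 0 = 0" "x \<in> {0..b}"
  shows "h x = 0"
proof -
  obtain k where k: "\<forall>s\<in>{0..b}. cmod (c s) \<le> k"
    using compact_imp_bounded[OF compact_continuous_image[OF assms(1) compact_Icc]] unfolding bounded_iff by blast
  then have "0 \<le> k" using assms(4) norm_ge_zero order_trans by blast
  have "(cmod (h x))\<^sup>2 \<le> exp ((2 * k + 1) * x) * msq 0 x (\<lambda>s. 0 :: complex)"
  proof (rule coupled_gronwall[where z=h and p=c and w=c])
    fix s assume "s \<in> {0..x}"
    then have s: "s \<in> {0..b}" using assms(4) by auto
    have "(h has_vector_derivative c s * h s) (at s within {0..x})"
      using assms(4) by (intro has_vector_derivative_within_subset[OF assms(2)[OF s]]) auto
    then show "(h has_vector_derivative c s * h s) (at s within {0..x})"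
      "(h has_vector_derivative c s * h s + 0) (at s within {0..x})" by simp_all
    show "cmod (c s) \<le> k" "cmod (c s) \<le> k" using k s by auto
  qed (use assms \<open>0 \<le> k\<close> in auto)
  then show ?thesis by simp
qed

declare fpX.simps [simp del] fpY.simps [simp del] fpZ.simps [simp del]

locale formal_powers =
  fixes b :: real and p q f g :: "real \<Rightarrow> complex"
  assumes b: "0 < b" and cont_p: "continuous_on {0..b} p" and cont_q: "continuous_on {0..b} q"
    and df: "\<And>x. x \<in> {0..b} \<Longrightarrow> (f has_vector_derivative q x * f x - p x * g x) (at x within {0..b})"
    and dg: "\<And>x. x \<in> {0..b} \<Longrightarrow> (g has_vector_derivative - (p x * f x) - q x * g x) (at x within {0..b})"
    and nz: "\<And>x. x \<in> {0..b} \<Longrightarrow> f x \<noteq> 0" "\<And>x. x \<in> {0..b} \<Longrightarrow> g x \<noteq> 0"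
    and fg0: "f 0 * g 0 = 1"
begin

lemma cont_f: "continuous_on {0..b} f" and cont_g: "continuous_on {0..b} g"
  by (rule continuous_on_vector_derivative, erule df) (rule continuous_on_vector_derivative, erule dg)

text \<open>Direct differentiation of f X and g Y leaves terms with Z. They are removed by the
  identity f g (Y - X) = n Z at level n, with the Z of level n - 1; it holds because the difference
  of the two sides solves a homogeneous linear equation and vanishes at 0. At level 0 the constant s
  takes the place of n Z; it is 1 for the first family of powers and -1 for the one with
  tilde.\<close>

lemma fp_step:
  fixes s :: complex and X0 Y0 :: "real \<Rightarrow> complex"
  defines "X \<equiv> fpX p f g X0 Y0" and "Y \<equiv> fpY p f g X0 Y0"
  assumes dX0: "\<And>x. x \<in> {0..b} \<Longrightarrow> (X0 has_vector_derivative - (s * (p x / (f x)\<^sup>2))) (at x within {0..b})"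
    and dY0: "\<And>x. x \<in> {0..b} \<Longrightarrow> (Y0 has_vector_derivative s * (p x / (g x)\<^sup>2)) (at x within {0..b})"
    and XY0: "X0 0 - Y0 0 = - s" and x: "x \<in> {0..b}"
  shows "((\<lambda>x. vector [f x * X n x, g x * Y n x] :: complex^2) has_vector_derivative
     matB *v (matQ p q x *v vector [f x * X n x, g x * Y n x])
     - of_nat n *s (matB *v vector [f x * X (n - 1) x, g x * Y (n - 1) x])) (at x within {0..b})"
proof -
  define Z where "Z = fpZ p f g X0 Y0"
  have XY_cont: "continuous_on {0..b} (X n) \<and> continuous_on {0..b} (Y n)" for n
  proof (induction n)
    case 0
    show ?case unfolding X_def Y_def fpX.simps fpY.simps
      by (rule conjI; rule continuous_on_vector_derivative) (erule dX0, erule dY0)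
  next
    case (Suc n)
    have Z: "continuous_on {0..b} (fpZ p f g X0 Y0 n)"
      unfolding fpZ.simps using Suc unfolding X_def Y_def
      by (intro indefinite_integral_continuous_1 integrable_continuous_real continuous_intros cont_f cont_g) auto
    show ?case
      unfolding X_def Y_def fpX.simps fpY.simps using Suc nz unfolding X_def Y_def
      by (intro conjI continuous_on_mult continuous_on_const indefinite_integral_continuous_1 integrable_continuous_real
          continuous_on_add continuous_on_divide continuous_on_power Z cont_f cont_g cont_p) auto
  qed
  have dZ: "(Z n has_vector_derivative (f x)\<^sup>2 * X n x + (g x)\<^sup>2 * Y n x) (at x within {0..b})" if "x \<in> {0..b}" for n x
    unfolding Z_def fpZ.simps X_def[symmetric] Y_def[symmetric]
    by (rule integral_has_vector_derivative[OF _ that])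
      (use XY_cont in \<open>intro continuous_intros cont_f cont_g; blast\<close>)
  then have Z_cont: "continuous_on {0..b} (Z n)" for n by (rule continuous_on_vector_derivative)
  have dX: "(X (Suc n) has_vector_derivative - of_nat (Suc n) * (p x / (f x)\<^sup>2 * Z n x + g x / f x * Y n x)) (at x within {0..b})"
    and dY: "(Y (Suc n) has_vector_derivative of_nat (Suc n) * (p x / (g x)\<^sup>2 * Z n x + f x / g x * X n x)) (at x within {0..b})"
    if x: "x \<in> {0..b}" for n x
  proof -
    have c: "continuous_on {0..b} (\<lambda>s. p s / (f s)\<^sup>2 * Z n s + g s / f s * Y n s)"
      "continuous_on {0..b} (\<lambda>s. p s / (g s)\<^sup>2 * Z n s + f s / g s * X n s)"
      using XY_cont[of n] nz Z_cont
      by (auto intro!: continuous_on_mult continuous_on_add continuous_on_divide continuous_on_power cont_f cont_g cont_p)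
    show "(X (Suc n) has_vector_derivative - of_nat (Suc n) * (p x / (f x)\<^sup>2 * Z n x + g x / f x * Y n x)) (at x within {0..b})"
      unfolding X_def fpX.simps Z_def[symmetric] Y_def[symmetric] unfolding Suc_eq_plus1
      by (intro has_vector_derivative_mult_right integral_has_vector_derivative c x)
    show "(Y (Suc n) has_vector_derivative of_nat (Suc n) * (p x / (g x)\<^sup>2 * Z n x + f x / g x * X n x)) (at x within {0..b})"
      unfolding Y_def fpY.simps Z_def[symmetric] X_def[symmetric] unfolding Suc_eq_plus1
      by (intro has_vector_derivative_mult_right integral_has_vector_derivative c x)
  qed
  \<comment> \<open>The logarithmic derivative of f g.\<close>
  define c where "c x = - (p x * ((f x)\<^sup>2 + (g x)\<^sup>2) / (f x * g x))" for x
  have c: "continuous_on {0..b} c"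
    unfolding c_def using nz by (intro continuous_intros cont_f cont_g cont_p) auto
  have dfg: "((\<lambda>x. f x * g x) has_vector_derivative - (p x * ((f x)\<^sup>2 + (g x)\<^sup>2))) (at x within {0..b})" if "x \<in> {0..b}" for x
    using has_vector_derivative_mult[OF df[OF that] dg[OF that]]
    by (rule has_vector_derivative_eq_rhs) (simp add: algebra_simps power2_eq_square)
  have zero: "f x * g x * (X 0 x - Y 0 x) + s = 0" if "x \<in> {0..b}" for x
  proof (rule linear_ode_zero[OF c _ _ that])
    fix x assume x: "x \<in> {0..b}"
    have "((\<lambda>x. f x * g x * (X 0 x - Y 0 x) + s) has_vector_derivative
       f x * g x * (- (s * (p x / (f x)\<^sup>2)) - s * (p x / (g x)\<^sup>2)) + - (p x * ((f x)\<^sup>2 + (g x)\<^sup>2)) * (X 0 x - Y 0 x) + 0) (at x within {0..b})"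
      unfolding X_def Y_def fpX.simps fpY.simps
      by (intro has_vector_derivative_add has_vector_derivative_mult has_vector_derivative_diff dfg dX0 dY0 x has_vector_derivative_const)
    then show "((\<lambda>x. f x * g x * (X 0 x - Y 0 x) + s) has_vector_derivative c x * (f x * g x * (X 0 x - Y 0 x) + s)) (at x within {0..b})"
      by (rule has_vector_derivative_eq_rhs) (use nz[OF x] in \<open>simp add: c_def field_simps power2_eq_square\<close>)
  qed (use XY0 fg0 in \<open>simp add: X_def Y_def fpX.simps fpY.simps\<close>)
  have S: "f x * g x * (X (Suc n) x - Y (Suc n) x) + of_nat (Suc n) * Z n x = 0" if "x \<in> {0..b}" for x n
  proof (rule linear_ode_zero[OF c _ _ that])
    fix x assume x: "x \<in> {0..b}"
    have "((\<lambda>x. f x * g x * (X (Suc n) x - Y (Suc n) x) + of_nat (Suc n) * Z n x) has_vector_derivative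
       f x * g x * (- of_nat (Suc n) * (p x / (f x)\<^sup>2 * Z n x + g x / f x * Y n x) - of_nat (Suc n) * (p x / (g x)\<^sup>2 * Z n x + f x / g x * X n x))
       + - (p x * ((f x)\<^sup>2 + (g x)\<^sup>2)) * (X (Suc n) x - Y (Suc n) x) + of_nat (Suc n) * ((f x)\<^sup>2 * X n x + (g x)\<^sup>2 * Y n x)) (at x within {0..b})"
      by (intro has_vector_derivative_add has_vector_derivative_mult has_vector_derivative_diff dfg dX dY dZ x has_vector_derivative_mult_right)
    then show "((\<lambda>x. f x * g x * (X (Suc n) x - Y (Suc n) x) + of_nat (Suc n) * Z n x) has_vector_derivative
       c x * (f x * g x * (X (Suc n) x - Y (Suc n) x) + of_nat (Suc n) * Z n x)) (at x within {0..b})"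
      by (rule has_vector_derivative_eq_rhs) (use nz[OF x] in \<open>simp add: c_def field_simps power2_eq_square del: of_nat_Suc\<close>)
  qed (simp add: X_def Y_def Z_def fpX.simps fpY.simps fpZ.simps)
  have "((\<lambda>x. f x * X n x) has_vector_derivative
      q x * (f x * X n x) - p x * (g x * Y n x) - of_nat n * (g x * Y (n - 1) x)) (at x within {0..b}) \<and>
    ((\<lambda>x. g x * Y n x) has_vector_derivative
      - (p x * (f x * X n x)) - q x * (g x * Y n x) + of_nat n * (f x * X (n - 1) x)) (at x within {0..b})"
  proof (cases n)
    case 0
    have s: "s = f x * g x * (Y0 x - X0 x)"
      using zero[OF x] by (simp add: X_def Y_def fpX.simps fpY.simps algebra_simps eq_neg_iff_add_eq_0)
    show ?thesis
      using has_vector_derivative_mult[OF df[OF x] dX0[OF x]] has_vector_derivative_mult[OF dg[OF x] dY0[OF x]] nz[OF x] 0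
      unfolding s
      by (auto simp: X_def Y_def fpX.simps fpY.simps field_simps power2_eq_square elim!: has_vector_derivative_eq_rhs)
  next
    case (Suc m)
    have "of_nat (Suc m) * Z m x = f x * g x * (Y n x - X n x)" using S[OF x, of m] Suc
      by (simp add: algebra_simps eq_neg_iff_add_eq_0 del: of_nat_Suc)
    then have Z: "Z m x = f x * g x * (Y n x - X n x) / of_nat (Suc m)"
      by (simp add: field_simps del: of_nat_Suc)
    show ?thesis
      using has_vector_derivative_mult[OF df[OF x] dX[OF x, of m]] has_vector_derivative_mult[OF dg[OF x] dY[OF x, of m]] nz[OF x] Suc
      unfolding Z
      by (auto simp: field_simps power2_eq_square simp del: of_nat_Suc elim!: has_vector_derivative_eq_rhs)
  qed
  then have "((\<lambda>x. vector [f x * X n x, g x * Y n x] :: complex^2) has_vector_derivative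
    vector [q x * (f x * X n x) - p x * (g x * Y n x) - of_nat n * (g x * Y (n - 1) x),
      - (p x * (f x * X n x)) - q x * (g x * Y n x) + of_nat n * (f x * X (n - 1) x)]) (at x within {0..b})"
    by (intro has_vector_derivative_vector2) auto
  then show ?thesis
    by (rule has_vector_derivative_eq_rhs) (simp add: mat2_simps)
qed

definition W :: "nat \<Rightarrow> real \<Rightarrow> complex^2" where
  "W n x = vector [f x * powX p f g n x, g x * powY p f g n x]"

definition W_tilde :: "nat \<Rightarrow> real \<Rightarrow> complex^2" where
  "W_tilde n x = vector [f x * powX_tilde p f g n x, g x * powY_tilde p f g n x]"

lemma W_derivs:
  assumes x: "x \<in> {0..b}"
  shows "(W n has_vector_derivative matB *v (matQ p q x *v W n x) - of_nat n *s (matB *v W (n - 1) x)) (at x within {0..b})"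
    and "(W_tilde n has_vector_derivative matB *v (matQ p q x *v W_tilde n x) - of_nat n *s (matB *v W_tilde (n - 1) x)) (at x within {0..b})"
proof -
  have i: "((\<lambda>x. integral {0..x} (\<lambda>s. p s / (f s)\<^sup>2)) has_vector_derivative p x / (f x)\<^sup>2) (at x within {0..b})"
    "((\<lambda>x. integral {0..x} (\<lambda>s. p s / (g s)\<^sup>2)) has_vector_derivative p x / (g x)\<^sup>2) (at x within {0..b})" if "x \<in> {0..b}" for x
    using nz by (auto intro!: integral_has_vector_derivative that continuous_intros cont_p cont_f cont_g)
  have j: "((\<lambda>x. - integral {0..x} (\<lambda>s. p s / (f s)\<^sup>2)) has_vector_derivative - (1 * (p x / (f x)\<^sup>2))) (at x within {0..b})"
    "((\<lambda>x. 1 + integral {0..x} (\<lambda>s. p s / (g s)\<^sup>2)) has_vector_derivative 1 * (p x / (g x)\<^sup>2)) (at x within {0..b})"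
    "((\<lambda>x. 1 + integral {0..x} (\<lambda>s. p s / (f s)\<^sup>2)) has_vector_derivative - (- 1 * (p x / (f x)\<^sup>2))) (at x within {0..b})"
    "((\<lambda>x. - integral {0..x} (\<lambda>s. p s / (g s)\<^sup>2)) has_vector_derivative - 1 * (p x / (g x)\<^sup>2)) (at x within {0..b})"
    if "x \<in> {0..b}" for x
    using has_vector_derivative_minus[OF i(1)[OF that]] has_vector_derivative_minus[OF i(2)[OF that]]
      has_vector_derivative_add[OF has_vector_derivative_const[of 1] i(1)[OF that]]
      has_vector_derivative_add[OF has_vector_derivative_const[of 1] i(2)[OF that]] by simp_all
  show "(W n has_vector_derivative matB *v (matQ p q x *v W n x) - of_nat n *s (matB *v W (n - 1) x)) (at x within {0..b})"
    unfolding W_def[abs_def] powX_def powY_def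
    by (rule fp_step[where s=1, OF j(1,2) _ x]) auto
  show "(W_tilde n has_vector_derivative matB *v (matQ p q x *v W_tilde n x) - of_nat n *s (matB *v W_tilde (n - 1) x)) (at x within {0..b})"
    unfolding W_tilde_def[abs_def] powX_tilde_def powY_tilde_def
    by (rule fp_step[where s="- 1", OF j(3,4) _ x]) auto
qed

lemma W_0: "W n 0 = (if n = 0 then vector [0, g 0] else 0)" "W_tilde n 0 = (if n = 0 then vector [f 0, 0] else 0)"
  by (cases n; simp add: W_def W_tilde_def powX_def powY_def powX_tilde_def powY_tilde_def fpX.simps fpY.simps vec2_eq_iff)+

lemma Phi_Psi_altdef:
  "Phi p f g k x = (if odd k then ((-1)^((k + 1) div 2) * f 0) *s W k x else ((-1)^(k div 2) * g 0) *s W_tilde k x)"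
  "Psi p f g k x = (if odd k then ((-1)^((k - 1) div 2) * g 0) *s W_tilde k x else ((-1)^(k div 2) * f 0) *s W k x)"
  by (simp_all add: Phi_def Psi_def W_def W_tilde_def)

text \<open>Thanks to f(0) g(0) = 1 the data at x = 0 are the unit vectors, so polynomial
  coefficients can be read as Cauchy data.\<close>

lemma Phi_Psi_0:
  "Phi p f g k 0 = (if k = 0 then vector [1, 0] else 0)" "Psi p f g k 0 = (if k = 0 then vector [0, 1] else 0)"
  using fg0 by (auto simp: Phi_Psi_altdef W_0 vec2_eq_iff mult.commute)

lemma has_vector_derivative_smult:
  fixes y :: "real \<Rightarrow> complex^2"
  assumes "(y has_vector_derivative y') F"
  shows "((\<lambda>x. c *s y x) has_vector_derivative c *s y') F"
  by (rule bounded_linear.has_vector_derivative[OF bounded_linear_smult assms])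

text \<open>The signs in \<open>Phi\<close> and \<open>Psi\<close> are arranged so that one pair of
  recurrences holds for both parities of k. At k = 0 the index k - 1 is again 0, but its coefficient
  vanishes.\<close>

lemma Phi_Psi_derivs:
  assumes x: "x \<in> {0..b}"
  shows "(Phi p f g k has_vector_derivative matB *v (matQ p q x *v Phi p f g k x) + of_nat k *s (matB *v Psi p f g (k - 1) x)) (at x within {0..b})"
    and "(Psi p f g k has_vector_derivative matB *v (matQ p q x *v Psi p f g k x) - of_nat k *s (matB *v Phi p f g (k - 1) x)) (at x within {0..b})"
proof -
  have s1: "((\<lambda>x. c *s w k x) has_vector_derivative matB *v (matQ p q x *v (c *s w k x)) + of_nat k *s (matB *v z)) (at x within {0..b})"
    if "(w k has_vector_derivative matB *v (matQ p q x *v w k x) - of_nat k *s (matB *v w (k - 1) x)) (at x within {0..b})"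
      "k = 0 \<or> z = - c *s w (k - 1) x" for c z and w :: "nat \<Rightarrow> real \<Rightarrow> complex^2"
    using has_vector_derivative_smult[OF that(1), of c] that(2)
    by (elim has_vector_derivative_eq_rhs disjE) (simp_all add: mat2_simps algebra_simps)
  have s2: "((\<lambda>x. c *s w k x) has_vector_derivative matB *v (matQ p q x *v (c *s w k x)) - of_nat k *s (matB *v z)) (at x within {0..b})"
    if "(w k has_vector_derivative matB *v (matQ p q x *v w k x) - of_nat k *s (matB *v w (k - 1) x)) (at x within {0..b})"
      "k = 0 \<or> z = c *s w (k - 1) x" for c z and w :: "nat \<Rightarrow> real \<Rightarrow> complex^2"
    using has_vector_derivative_smult[OF that(1), of c] that(2)
    by (elim has_vector_derivative_eq_rhs disjE) (simp_all add: mat2_simps algebra_simps)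
  consider j where "k = 2 * j + 1" | "k = 0" | j where "k = 2 * j + 2"
    by (metis One_nat_def Suc_eq_plus1 add_2_eq_Suc' evenE mult_Suc_right not0_implies_Suc oddE)
  note cs = this
  show "(Phi p f g k has_vector_derivative matB *v (matQ p q x *v Phi p f g k x) + of_nat k *s (matB *v Psi p f g (k - 1) x)) (at x within {0..b})"
  proof (cases "odd k")
    case True
    define c where "c = (-1)^((k + 1) div 2) * f 0"
    have eq: "Phi p f g k = (\<lambda>x. c *s W k x)"
      using True by (simp add: fun_eq_iff Phi_Psi_altdef c_def)
    have "k = 0 \<or> Psi p f g (k - 1) x = - c *s W (k - 1) x"
      using True by (cases rule: cs) (simp_all add: Phi_Psi_altdef c_def)
    then show ?thesis unfolding eq by (intro s1 W_derivs x)
  next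
    case False
    define c where "c = (-1)^(k div 2) * g 0"
    have eq: "Phi p f g k = (\<lambda>x. c *s W_tilde k x)"
      using False by (simp add: fun_eq_iff Phi_Psi_altdef c_def)
    have "k = 0 \<or> Psi p f g (k - 1) x = - c *s W_tilde (k - 1) x"
      using False by (cases rule: cs) (simp_all add: Phi_Psi_altdef c_def)
    then show ?thesis unfolding eq by (intro s1 W_derivs x)
  qed
  show "(Psi p f g k has_vector_derivative matB *v (matQ p q x *v Psi p f g k x) - of_nat k *s (matB *v Phi p f g (k - 1) x)) (at x within {0..b})"
  proof (cases "odd k")
    case True
    define c where "c = (-1)^((k - 1) div 2) * g 0"
    have eq: "Psi p f g k = (\<lambda>x. c *s W_tilde k x)"
      using True by (simp add: fun_eq_iff Phi_Psi_altdef c_def)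
    have "k = 0 \<or> Phi p f g (k - 1) x = c *s W_tilde (k - 1) x"
      using True by (cases rule: cs) (simp_all add: Phi_Psi_altdef c_def)
    then show ?thesis unfolding eq by (intro s2 W_derivs x)
  next
    case False
    define c where "c = (-1)^(k div 2) * f 0"
    have eq: "Psi p f g k = (\<lambda>x. c *s W k x)"
      using False by (simp add: fun_eq_iff Phi_Psi_altdef c_def)
    have "k = 0 \<or> Phi p f g (k - 1) x = c *s W (k - 1) x"
      using False by (cases rule: cs) (simp_all add: Phi_Psi_altdef c_def)
    then show ?thesis unfolding eq by (intro s2 W_derivs x)
  qed
qed

end

section \<open>Approximation of the Goursat data\<close>

lemma appell_linear:
  "appell (\<lambda>m. c * s m + e * r m) n t = c * appell s n t + e * appell r n t"
  by (simp add: appell_def sum_distrib_left sum.distrib algebra_simps)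

lemma appell_alternate: "appell (\<lambda>m. (-1) ^ m * s m) n t = (-1) ^ n * appell s n (- t)"
proof -
  have "of_nat (n choose k) * of_real t ^ k * ((-1) ^ (n - k) * s (n - k))
    = (-1) ^ n * (of_nat (n choose k) * of_real (- t) ^ k * s (n - k))" if "k \<le> n" for k
  proof -
    have "(-1 :: complex) ^ n = (-1) ^ k * (-1) ^ (n - k)"
      using that by (simp add: power_add[symmetric])
    moreover have "of_real (- t) ^ k = (-1 :: complex) ^ k * of_real t ^ k"
      by (simp add: power_mult_distrib[symmetric])
    moreover have "(-1 :: complex) ^ k * (-1) ^ k = 1"
      by (simp add: power_mult_distrib[symmetric])
    ultimately show ?thesis by (simp add: algebra_simps)
  qed
  then show ?thesis unfolding appell_def sum_distrib_left by (intro sum.cong) auto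
qed

text \<open>L stands for one of the coordinates \<open>ca\<close> and \<open>cd\<close>. Changing
  the sign of t affects the odd part only, so the sum and the difference of the two parts are Appell
  values at t and -t.\<close>

lemma wave_parts:
  assumes add: "\<And>y z. L (y + z) = L y + L z" and scale: "\<And>c y. L (c *s y) = c * L y" and L0: "L 0 = (0 :: complex)"
  shows "L (wave_even F n x t) + L (wave_odd F n x t) = appell (\<lambda>m. L (F m x)) n t"
    and "L (wave_even F n x t) - L (wave_odd F n x t) = appell (\<lambda>m. L (F m x)) n (- t)"
proof -
  have L_sum: "L (\<Sum>k\<in>A. h k) = (\<Sum>k\<in>A. L (h k))" for A :: "nat set" and h
    by (induction A rule: infinite_finite_induct) (simp_all add: add L0)
  have split: "(\<Sum>k\<le>n. h k) = (\<Sum>k | k \<le> n \<and> even k. h k) + (\<Sum>k | k \<le> n \<and> odd k. h k)" for h :: "nat \<Rightarrow> complex"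
  proof -
    have "{..n} = {k. k \<le> n \<and> even k} \<union> {k. k \<le> n \<and> odd k}" by auto
    then show ?thesis by (simp only:) (rule sum.union_disjoint; auto)
  qed
  show "L (wave_even F n x t) + L (wave_odd F n x t) = appell (\<lambda>m. L (F m x)) n t"
    unfolding appell_def split wave_even_def wave_odd_def L_sum scale ..
  have "(\<Sum>k | k \<le> n \<and> even k. of_nat (n choose k) * of_real (- t) ^ k * L (F (n - k) x))
     = (\<Sum>k | k \<le> n \<and> even k. of_nat (n choose k) * of_real t ^ k * L (F (n - k) x))"
    by (intro sum.cong) (auto simp: power_minus_even)
  moreover have "(\<Sum>k | k \<le> n \<and> odd k. of_nat (n choose k) * of_real (- t) ^ k * L (F (n - k) x))
     = - (\<Sum>k | k \<le> n \<and> odd k. of_nat (n choose k) * of_real t ^ k * L (F (n - k) x))"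
    unfolding sum_negf[symmetric] by (intro sum.cong) (auto simp: power_minus_odd)
  ultimately show "L (wave_even F n x t) - L (wave_odd F n x t) = appell (\<lambda>m. L (F m x)) n (- t)"
    unfolding appell_def split wave_even_def wave_odd_def L_sum scale by simp
qed

lemma ca_cd_0: "ca 0 = 0" "cd 0 = 0"
  by (simp_all add: ca_def cd_def)

lemmas ca_parts = wave_parts[of ca, OF ca_cd_add(1) ca_cd_scale(1) ca_cd_0(1)]
  and cd_parts = wave_parts[of cd, OF ca_cd_add(2) ca_cd_scale(2) ca_cd_0(2)]

abbreviation eplus :: "complex^2" where "eplus \<equiv> vector [1, \<i>]"

abbreviation eminus :: "complex^2" where "eminus \<equiv> vector [1, - \<i>]"

lemma columns2_eigen:
  "columns2 y z *v eplus = y + \<i> *s z" "columns2 y z *v eminus = y + (- \<i>) *s z"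
  by (simp_all add: mat2_simps)

definition eigen_matrix :: "complex^2 \<Rightarrow> complex^2 \<Rightarrow> complex^2^2" where
  "eigen_matrix y z = columns2 ((1 / 2) *s (y + z)) ((- \<i> / 2) *s (y - z))"

lemma eigen_matrix: "eigen_matrix y z *v eplus = y" "eigen_matrix y z *v eminus = z"
  by (simp_all add: eigen_matrix_def columns2_eigen vec2_eq_iff algebra_simps)

context formal_powers begin

definition u where "u x = q x + \<i> * p x"

definition v where "v x = q x - \<i> * p x"

text \<open>\<open>rho\<close> and \<open>sigma\<close> are the images of (1, i) and (1, -i) under
  the matrix with columns \<open>Phi\<close> and \<open>Psi\<close>.\<close>

definition rho where "rho k x = Phi p f g k x + \<i> *s Psi p f g k x"

definition sigma where "sigma k x = Phi p f g k x + (- \<i>) *s Psi p f g k x"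

lemma rho_sigma_derivs:
  assumes x: "x \<in> {0..b}"
  shows "((\<lambda>x. ca (rho k x)) has_vector_derivative u x * cd (rho k x) + of_nat k * ca (rho (k - 1) x)) (at x within {0..b})"
    and "((\<lambda>x. cd (rho k x)) has_vector_derivative v x * ca (rho k x) - of_nat k * cd (rho (k - 1) x)) (at x within {0..b})"
    and "((\<lambda>x. ca (sigma k x)) has_vector_derivative u x * cd (sigma k x) - of_nat k * ca (sigma (k - 1) x)) (at x within {0..b})"
    and "((\<lambda>x. cd (sigma k x)) has_vector_derivative v x * ca (sigma k x) + of_nat k * cd (sigma (k - 1) x)) (at x within {0..b})"
proof -
  note P = bounded_linear.has_vector_derivative[OF bounded_linear_ca Phi_Psi_derivs(1)[OF x, of k]]
    bounded_linear.has_vector_derivative[OF bounded_linear_cd Phi_Psi_derivs(1)[OF x, of k]]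
    bounded_linear.has_vector_derivative[OF bounded_linear_ca Phi_Psi_derivs(2)[OF x, of k]]
    bounded_linear.has_vector_derivative[OF bounded_linear_cd Phi_Psi_derivs(2)[OF x, of k]]
  note simps = ca_cd_add ca_cd_scale ca_cd_matB ca_cd_matBQ
  have diff: "ca (y - z) = ca y - ca z" "cd (y - z) = cd y - cd z" for y z
    using ca_cd_add[of y "- z"] by (simp_all add: ca_cd_minus)
  note M = has_vector_derivative_add[OF P(1) has_vector_derivative_mult_right[OF P(3), of \<i>]]
    has_vector_derivative_add[OF P(2) has_vector_derivative_mult_right[OF P(4), of \<i>]]
    has_vector_derivative_add[OF P(1) has_vector_derivative_mult_right[OF P(3), of "- \<i>"]]
    has_vector_derivative_add[OF P(2) has_vector_derivative_mult_right[OF P(4), of "- \<i>"]]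
  note simps = ca_cd_add ca_cd_scale ca_cd_matB ca_cd_matBQ diff u_def v_def
  show "((\<lambda>x. ca (rho k x)) has_vector_derivative u x * cd (rho k x) + of_nat k * ca (rho (k - 1) x)) (at x within {0..b})"
    unfolding rho_def simps(1-4) by (rule has_vector_derivative_eq_rhs[OF M(1)]) (simp only: ca_cd_add ca_cd_scale diff ca_cd_matBQ, simp add: ca_cd_matB u_def v_def algebra_simps)
  show "((\<lambda>x. cd (rho k x)) has_vector_derivative v x * ca (rho k x) - of_nat k * cd (rho (k - 1) x)) (at x within {0..b})"
    unfolding rho_def simps(1-4) by (rule has_vector_derivative_eq_rhs[OF M(2)]) (simp only: ca_cd_add ca_cd_scale diff ca_cd_matBQ, simp add: ca_cd_matB u_def v_def algebra_simps)
  show "((\<lambda>x. ca (sigma k x)) has_vector_derivative u x * cd (sigma k x) - of_nat k * ca (sigma (k - 1) x)) (at x within {0..b})"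
    unfolding sigma_def simps(1-4) by (rule has_vector_derivative_eq_rhs[OF M(3)]) (simp only: ca_cd_add ca_cd_scale diff ca_cd_matBQ, simp add: ca_cd_matB u_def v_def algebra_simps)
  show "((\<lambda>x. cd (sigma k x)) has_vector_derivative v x * ca (sigma k x) + of_nat k * cd (sigma (k - 1) x)) (at x within {0..b})"
    unfolding sigma_def simps(1-4) by (rule has_vector_derivative_eq_rhs[OF M(4)]) (simp only: ca_cd_add ca_cd_scale diff ca_cd_matBQ, simp add: ca_cd_matB u_def v_def algebra_simps)
qed

lemma rho_sigma_0:
  "ca (rho k 0) = (if k = 0 then 1 else 0)" "cd (rho k 0) = 0"
  "ca (sigma k 0) = 0" "cd (sigma k 0) = (if k = 0 then 1 else 0)"
  by (auto simp: rho_def sigma_def Phi_Psi_0 ca_def cd_def)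

lemma alternate_deriv:
  fixes y :: "nat \<Rightarrow> real \<Rightarrow> complex"
  assumes "(y k has_vector_derivative c + e * (of_nat k * z)) F"
  shows "((\<lambda>x. (-1) ^ k * y k x) has_vector_derivative (-1) ^ k * c - e * (of_nat k * ((-1) ^ (k - 1) * z))) F"
  using has_vector_derivative_mult_right[OF assms, of "(-1) ^ k"]
  by (rule has_vector_derivative_eq_rhs) (cases k; simp add: algebra_simps)

lemma cont_uv: "continuous_on {0..b} u" "continuous_on {0..b} v"
  unfolding u_def v_def by (intro continuous_intros cont_p cont_q)+

text \<open>\<open>rho\<close> obeys the recurrences with t reversed, which the factor (-1)^m
  repairs; \<open>sigma\<close> obeys them as they stand. At x = 0 they supply the data (1, 0) and
  (0, 1). This system governs the action on (1, i).\<close>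

sublocale plus: wave_system b u v "\<lambda>m x. (-1) ^ m * ca (rho m x)" "\<lambda>m x. (-1) ^ m * cd (rho m x)"
  "\<lambda>m x. ca (sigma m x)" "\<lambda>m x. cd (sigma m x)"
proof (unfold_locales, goal_cases)
  case (4 m x)
  then have "((\<lambda>x. ca (rho m x)) has_vector_derivative u x * cd (rho m x) + 1 * (of_nat m * ca (rho (m - 1) x))) (at x within {0..b})"
    using rho_sigma_derivs(1)[of x m] by simp
  from alternate_deriv[where y="\<lambda>k x. ca (rho k x)", OF this] show ?case by (simp add: mult.left_commute)
next
  case (5 m x)
  then have "((\<lambda>x. cd (rho m x)) has_vector_derivative v x * ca (rho m x) + (- 1) * (of_nat m * cd (rho (m - 1) x))) (at x within {0..b})"
    using rho_sigma_derivs(2)[of x m] by simp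
  from alternate_deriv[where y="\<lambda>k x. cd (rho k x)", OF this] show ?case by (simp add: mult.left_commute)
qed (use b cont_uv rho_sigma_derivs rho_sigma_0 in auto)

text \<open>Exchanging the coordinates \<open>ca\<close> and \<open>cd\<close> exchanges u with v
  and \<open>rho\<close> with \<open>sigma\<close>. This system governs the action on (1,
  -i).\<close>

sublocale minus: wave_system b v u "\<lambda>m x. (-1) ^ m * cd (sigma m x)" "\<lambda>m x. (-1) ^ m * ca (sigma m x)"
  "\<lambda>m x. cd (rho m x)" "\<lambda>m x. ca (rho m x)"
proof (unfold_locales, goal_cases)
  case (4 m x)
  then have "((\<lambda>x. cd (sigma m x)) has_vector_derivative v x * ca (sigma m x) + 1 * (of_nat m * cd (sigma (m - 1) x))) (at x within {0..b})"
    using rho_sigma_derivs(4)[of x m] by simp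
  from alternate_deriv[where y="\<lambda>k x. cd (sigma k x)", OF this] show ?case by (simp add: mult.left_commute)
next
  case (5 m x)
  then have "((\<lambda>x. ca (sigma m x)) has_vector_derivative u x * cd (sigma m x) + (- 1) * (of_nat m * ca (sigma (m - 1) x))) (at x within {0..b})"
    using rho_sigma_derivs(3)[of x m] by simp
  from alternate_deriv[where y="\<lambda>k x. ca (sigma k x)", OF this] show ?case by (simp add: mult.left_commute)
qed (use b cont_uv rho_sigma_derivs rho_sigma_0 in auto)

text \<open>On an eigenvector of B the even and odd parts in \<open>matN\<close> merge into one
  Appell value. Its argument is x if the coordinate belongs to the same eigenvector and -x if it
  belongs to the other one, so all values lie on characteristics.\<close>

lemma matN_eigen:
  "ca (matN p f g n x *v eplus) = \<i> * appell (\<lambda>m. ca (rho m x)) n x"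
  "cd (matN p f g n x *v eplus) = - \<i> * appell (\<lambda>m. cd (rho m x)) n (- x)"
  "ca (matN p f g n x *v eminus) = \<i> * appell (\<lambda>m. ca (sigma m x)) n (- x)"
  "cd (matN p f g n x *v eminus) = - \<i> * appell (\<lambda>m. cd (sigma m x)) n x"
proof -
  have app: "appell (\<lambda>m. ca (Phi p f g m x) + c * ca (Psi p f g m x)) n t
     = appell (\<lambda>m. ca (Phi p f g m x)) n t + c * appell (\<lambda>m. ca (Psi p f g m x)) n t"
    "appell (\<lambda>m. cd (Phi p f g m x) + c * cd (Psi p f g m x)) n t
     = appell (\<lambda>m. cd (Phi p f g m x)) n t + c * appell (\<lambda>m. cd (Psi p f g m x)) n t" for c t
    using appell_linear[of 1 _ c] by simp_all
  note simps = matN_def columns2_eigen rho_def sigma_def ca_cd_add ca_cd_scale ca_cd_matB ca_cd_minus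
    app ca_parts(1)[where t=x, symmetric] cd_parts(1)[where t=x, symmetric]
    ca_parts(2)[where t=x, symmetric] cd_parts(2)[where t=x, symmetric]
  show "ca (matN p f g n x *v eplus) = \<i> * appell (\<lambda>m. ca (rho m x)) n x"
    unfolding simps by (simp add: algebra_simps)
  show "cd (matN p f g n x *v eplus) = - \<i> * appell (\<lambda>m. cd (rho m x)) n (- x)"
    unfolding simps by (simp add: algebra_simps)
  show "ca (matN p f g n x *v eminus) = \<i> * appell (\<lambda>m. ca (sigma m x)) n (- x)"
    unfolding simps by (simp add: algebra_simps)
  show "cd (matN p f g n x *v eminus) = - \<i> * appell (\<lambda>m. cd (sigma m x)) n x"
    unfolding simps by (simp add: algebra_simps)
qed

section \<open>The least squares integrand in eigencoordinates\<close>

definition goursat :: "nat \<Rightarrow> (nat \<Rightarrow> complex^2^2) \<Rightarrow> real \<Rightarrow> complex^2^2" where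
  "goursat N c x = (1/2) *\<^sub>R matQ p q x + (\<Sum>n=0..N. matN p f g n x ** c n)"

text \<open>V prescribes the image of (1, i) and Z that of (1, -i). The signs (-1)^n cancel the
  alternation built into the first family of each system.\<close>

definition coefficients :: "complex poly \<times> complex poly \<Rightarrow> complex poly \<times> complex poly \<Rightarrow> nat \<Rightarrow> complex^2^2" where
  "coefficients V Z n = eigen_matrix
     (((-1) ^ n * coeff (fst V) n) *s eplus + coeff (snd V) n *s eminus)
     (coeff (snd Z) n *s eplus + ((-1) ^ n * coeff (fst Z) n) *s eminus)"

text \<open>Q maps each eigenvector of B to a multiple of the other one. Therefore only the traces
  on t = x have a nonzero target, v / 2 or u / 2, while those on t = -x should vanish. The factors 2
  and 1/2 of the two norm identities cancel.\<close>

lemma goursat_norm: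
  assumes V: "degree (fst V) \<le> N" "degree (snd V) \<le> N" and Z: "degree (fst Z) \<le> N" "degree (snd Z) \<le> N"
  shows "(norm (goursat N (coefficients V Z) x))\<^sup>2
    = (norm ((v x / 2, 0) - plus.tr V x))\<^sup>2 + (norm ((u x / 2, 0) - minus.tr Z x))\<^sup>2"
proof -
  note parity = mult.assoc[symmetric] power_mult_distrib[symmetric]
  have sgn: "(-1 :: complex) ^ n * ((-1) ^ n * z) = z" for n z
    by (simp add: parity)
  have lin: "ca (goursat N c x *v w) = ca (((1/2) *\<^sub>R matQ p q x) *v w) + (\<Sum>n\<le>N. ca (matN p f g n x *v (c n *v w)))"
    "cd (goursat N c x *v w) = cd (((1/2) *\<^sub>R matQ p q x) *v w) + (\<Sum>n\<le>N. cd (matN p f g n x *v (c n *v w)))" for c w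
  proof -
    have "(\<Sum>n=0..N. matN p f g n x ** c n) *v w = (\<Sum>n\<le>N. matN p f g n x *v (c n *v w))"
      using bounded_bilinear.sum_left[OF bounded_bilinear_matrix_vector_mult, of "\<lambda>n. matN p f g n x ** c n" "{0..N}" w]
      by (simp add: matrix_vector_mul_assoc atLeast0AtMost)
    then show "ca (goursat N c x *v w) = ca (((1/2) *\<^sub>R matQ p q x) *v w) + (\<Sum>n\<le>N. ca (matN p f g n x *v (c n *v w)))"
      "cd (goursat N c x *v w) = cd (((1/2) *\<^sub>R matQ p q x) *v w) + (\<Sum>n\<le>N. cd (matN p f g n x *v (c n *v w)))"
      by (simp_all add: goursat_def matrix_vector_mult_add_rdistrib ca_cd_add ca_cd_sum)
  qed
  have Q: "ca (((1/2) *\<^sub>R matQ p q x) *v eplus) = 0" "cd (((1/2) *\<^sub>R matQ p q x) *v eplus) = \<i> * v x / 2"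
    "ca (((1/2) *\<^sub>R matQ p q x) *v eminus) = - \<i> * u x / 2" "cd (((1/2) *\<^sub>R matQ p q x) *v eminus) = 0"
    by (simp_all add: ca_def cd_def matrix_vector_mult_2 scaleR_nth_complex matQ_nth u_def v_def algebra_simps del: vector_scaleR_component)
  have mv: "A *v (c *s y + e *s z) = c *s (A *v y) + e *s (A *v z)" for A :: "complex^2^2" and c e y z
    by (simp add: mat2_simps algebra_simps)
  note alt = appell_alternate[of "\<lambda>m. ca (rho m x)"] appell_alternate[of "\<lambda>m. cd (rho m x)"]
    appell_alternate[of "\<lambda>m. ca (sigma m x)"] appell_alternate[of "\<lambda>m. cd (sigma m x)"]
  note simps = coefficients_def eigen_matrix mv ca_cd_add ca_cd_scale matN_eigen alt
  have "(\<Sum>n\<le>N. ca (matN p f g n x *v (coefficients V Z n *v eplus))) = \<i> * plus.wa (fst V) (snd V) x (- x)"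
    unfolding plus.wa_def appell_poly_altdef[OF V(1)] appell_poly_altdef[OF V(2)] sum.distrib[symmetric] sum_distrib_left simps
    by (intro sum.cong) (simp_all add: algebra_simps sgn)
  moreover have "(\<Sum>n\<le>N. cd (matN p f g n x *v (coefficients V Z n *v eplus))) = - \<i> * plus.wd (fst V) (snd V) x x"
    unfolding plus.wd_def appell_poly_altdef[OF V(1)] appell_poly_altdef[OF V(2)] sum.distrib[symmetric] sum_distrib_left simps
    by (intro sum.cong) (simp_all add: algebra_simps sgn)
  moreover have "(\<Sum>n\<le>N. ca (matN p f g n x *v (coefficients V Z n *v eminus))) = \<i> * minus.wd (fst Z) (snd Z) x x"
    unfolding minus.wd_def appell_poly_altdef[OF Z(1)] appell_poly_altdef[OF Z(2)] sum.distrib[symmetric] sum_distrib_left simps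
    by (intro sum.cong) (simp_all add: algebra_simps sgn)
  moreover have "(\<Sum>n\<le>N. cd (matN p f g n x *v (coefficients V Z n *v eminus))) = - \<i> * minus.wa (fst Z) (snd Z) x (- x)"
    unfolding minus.wa_def appell_poly_altdef[OF Z(1)] appell_poly_altdef[OF Z(2)] sum.distrib[symmetric] sum_distrib_left simps
    by (intro sum.cong) (simp_all add: algebra_simps sgn)
  ultimately have e: "ca (goursat N (coefficients V Z) x *v eplus) = \<i> * plus.wa (fst V) (snd V) x (- x)"
    "cd (goursat N (coefficients V Z) x *v eplus) = \<i> * (v x / 2 - plus.wd (fst V) (snd V) x x)"
    "ca (goursat N (coefficients V Z) x *v eminus) = - \<i> * (u x / 2 - minus.wd (fst Z) (snd Z) x x)"
    "cd (goursat N (coefficients V Z) x *v eminus) = - \<i> * minus.wa (fst Z) (snd Z) x (- x)"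
    unfolding lin Q by (simp_all add: algebra_simps)
  show ?thesis
    unfolding norm_mat2_square_eigen norm_square_ca_cd e
    by (simp add: plus.tr_def minus.tr_def norm_prod_def norm_mult)
qed

theorem goursat_approximation:
  assumes "Cr_on r {0..b} u" "Cr_on r {0..b} v"
  shows "\<exists>M\<ge>0. \<forall>N. \<exists>c. msq 0 b (goursat N c) \<le> M / (real (N + 1)) ^ (2 * r)"
proof -
  have *: "Cr_on r {0..b} (\<lambda>x. (w x / 2, 0 :: complex))" if "Cr_on r {0..b} w" for w :: "real \<Rightarrow> complex"
    using Cr_on_bounded_linear[OF bounded_linear_divide that, of 2] by (intro Cr_on_Pair Cr_on_const)
  obtain M1 where M1: "0 \<le> M1" "\<And>N. \<exists>Z. degree (fst Z) \<le> N \<and> degree (snd Z) \<le> N \<and>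
    msq 0 b (\<lambda>x. (v x / 2, 0) - plus.tr Z x) \<le> M1 / (real (N + 1)) ^ (2 * r)"
    using plus.trace_approximation_rate[OF assms *[OF assms(2)]] by blast
  obtain M2 where M2: "0 \<le> M2" "\<And>N. \<exists>Z. degree (fst Z) \<le> N \<and> degree (snd Z) \<le> N \<and>
    msq 0 b (\<lambda>x. (u x / 2, 0) - minus.tr Z x) \<le> M2 / (real (N + 1)) ^ (2 * r)"
    using minus.trace_approximation_rate[OF assms(2,1) *[OF assms(1)]] by blast
  show ?thesis
  proof (intro exI[of _ "M1 + M2"] conjI allI)
    fix N
    obtain V where V: "degree (fst V) \<le> N" "degree (snd V) \<le> N"
      "msq 0 b (\<lambda>x. (v x / 2, 0) - plus.tr V x) \<le> M1 / (real (N + 1)) ^ (2 * r)"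
      using M1 by blast
    obtain Z where Z: "degree (fst Z) \<le> N" "degree (snd Z) \<le> N"
      "msq 0 b (\<lambda>x. (u x / 2, 0) - minus.tr Z x) \<le> M2 / (real (N + 1)) ^ (2 * r)"
      using M2 by blast
    have "msq 0 b (goursat N (coefficients V Z))
      = msq 0 b (\<lambda>x. (v x / 2, 0) - plus.tr V x) + msq 0 b (\<lambda>x. (u x / 2, 0) - minus.tr Z x)"
      unfolding goursat_norm[OF V(1,2) Z(1,2)]
      by (intro integral_add integrable_continuous_real continuous_intros plus.continuous_on_tr minus.continuous_on_tr cont_uv) auto
    then show "\<exists>c. msq 0 b (goursat N c) \<le> (M1 + M2) / (real (N + 1)) ^ (2 * r)"
      using V(3) Z(3) by (intro exI[of _ "coefficients V Z"]) (simp add: add_divide_distrib)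
  qed (use M1 M2 in simp)
qed

end

section \<open>The Dirac equation\<close>

lemma absolutely_continuous_fun_imp_continuous_on:
  assumes "absolutely_continuous_fun a b F" shows "continuous_on {a..b} F"
  unfolding continuous_on_iff
proof (intro ballI allI impI)
  fix x and e :: real assume x: "x \<in> {a..b}" and "e > 0"
  obtain \<delta> where \<delta>: "\<delta> > 0" "\<And>(n::nat) u v. (\<forall>i<n. a \<le> u i \<and> u i \<le> v i \<and> v i \<le> b) \<Longrightarrow>
        disjoint_family_on (\<lambda>i. {u i<..<v i}) {..<n} \<Longrightarrow> (\<Sum>i<n. v i - u i) < \<delta> \<Longrightarrow>
        (\<Sum>i<n. norm (F (v i) - F (u i))) < e"
    using assms[unfolded absolutely_continuous_fun_def, rule_format, OF \<open>e > 0\<close>] by auto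
  have "dist (F y) (F x) < e" if y: "y \<in> {a..b}" "dist y x < \<delta>" for y
    using \<delta>(2)[of 1 "\<lambda>_. min x y" "\<lambda>_. max x y"] x y
    by (cases "x \<le> y") (auto simp: disjoint_family_on_def dist_norm norm_minus_commute)
  then show "\<exists>d>0. \<forall>y\<in>{a..b}. dist y x < d \<longrightarrow> dist (F y) (F x) < e"
    using \<delta>(1) by blast
qed

lemma absolutely_continuous_fun_subset:
  assumes "absolutely_continuous_fun a b F" "a \<le> c" "d \<le> b"
  shows "absolutely_continuous_fun c d F"
  unfolding absolutely_continuous_fun_def
proof (intro allI impI)
  fix e :: real assume "e > 0"
  obtain \<delta> where \<delta>: "\<delta> > 0" "\<And>(n::nat) u v. (\<forall>i<n. a \<le> u i \<and> u i \<le> v i \<and> v i \<le> b) \<Longrightarrow>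
        disjoint_family_on (\<lambda>i. {u i<..<v i}) {..<n} \<Longrightarrow> (\<Sum>i<n. v i - u i) < \<delta> \<Longrightarrow>
        (\<Sum>i<n. norm (F (v i) - F (u i))) < e"
    using assms(1)[unfolded absolutely_continuous_fun_def, rule_format, OF \<open>e > 0\<close>] by auto
  show "\<exists>\<delta>>0. \<forall>(n::nat) u v. (\<forall>i<n. c \<le> u i \<and> u i \<le> v i \<and> v i \<le> d) \<longrightarrow>
        disjoint_family_on (\<lambda>i. {u i<..<v i}) {..<n} \<longrightarrow> (\<Sum>i<n. v i - u i) < \<delta> \<longrightarrow>
        (\<Sum>i<n. norm (F (v i) - F (u i))) < e"
  proof (intro exI[of _ \<delta>] conjI allI impI \<delta>(1))
    fix n :: nat and u v :: "nat \<Rightarrow> real"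
    assume "\<forall>i<n. c \<le> u i \<and> u i \<le> v i \<and> v i \<le> d"
      and *: "disjoint_family_on (\<lambda>i. {u i<..<v i}) {..<n}" "(\<Sum>i<n. v i - u i) < \<delta>"
    then have "\<forall>i<n. a \<le> u i \<and> u i \<le> v i \<and> v i \<le> b" using assms(2,3) by force
    then show "(\<Sum>i<n. norm (F (v i) - F (u i))) < e" using \<delta>(2) * by blast
  qed
qed

text \<open>F is the primitive of h up to a constant, and h is continuous, so the exceptional set
  disappears.\<close>

lemma absolutely_continuous_fun_has_vector_derivative:
  fixes F h :: "real \<Rightarrow> 'a::euclidean_space"
  assumes ac: "absolutely_continuous_fun a b F" and E: "negligible E"
    and deriv: "\<And>x. x \<in> {a..b} - E \<Longrightarrow> (F has_vector_derivative h x) (at x within {a..b})"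
    and h: "continuous_on {a..b} h" and x: "x \<in> {a..b}"
  shows "(F has_vector_derivative h x) (at x within {a..b})"
proof -
  have eq: "F y = F a + integral {a..y} h" if y: "y \<in> {a..b}" for y
  proof -
    have "(h has_integral F y - F a) {a..y}"
      by (rule absolutely_continuous_fun_has_integral[OF _ absolutely_continuous_fun_subset[OF ac] E])
        (use y in \<open>auto intro!: has_vector_derivative_within_subset[OF deriv]\<close>)
    then show ?thesis by (simp add: integral_unique)
  qed
  have D: "((\<lambda>y. F a + integral {a..y} h) has_vector_derivative h x) (at x within {a..b})"
    using has_vector_derivative_add[OF has_vector_derivative_const integral_has_vector_derivative[OF h x]] by simp
  show ?thesis
    by (rule has_vector_derivative_transform[OF x _ D]) (rule eq)
qed

lemma bounded_linear_matrix_vector: "bounded_linear ((*v) (A :: complex^2^2))"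
  by (rule bounded_bilinear.bounded_linear_right[OF bounded_bilinear_matrix_vector_mult])

text \<open>The inverse of B is -B, so the equation gives Y' almost everywhere as a continuous
  function of x.\<close>

lemma dirac_solution_derivative:
  assumes Q: "continuous_on {0..b} (matQ p q)" and Y: "dirac_solution b p q lam Y" and x: "x \<in> {0..b}"
  shows "(Y has_vector_derivative matB *v (matQ p q x *v Y x) - lam *s (matB *v Y x)) (at x within {0..b})"
proof -
  have ac: "absolutely_continuous_fun 0 b Y" using Y by (simp add: dirac_solution_def)
  note cY = absolutely_continuous_fun_imp_continuous_on[OF ac]
  have "AE x in lebesgue. x \<in> {0..b} \<longrightarrow> (\<exists>Y'. (Y has_vector_derivative Y') (at x within {0..b}) \<and>
        matB *v Y' + matQ p q x *v Y x = lam *s Y x)"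
    using Y unfolding dirac_solution_def by (simp add: AE_restrict_space_iff)
  then obtain E where E: "E \<in> null_sets lebesgue" "{x. \<not> (x \<in> {0..b} \<longrightarrow> (\<exists>Y'. (Y has_vector_derivative Y') (at x within {0..b}) \<and>
        matB *v Y' + matQ p q x *v Y x = lam *s Y x))} \<subseteq> E"
    unfolding eventually_ae_filter by auto
  show ?thesis
  proof (rule absolutely_continuous_fun_has_vector_derivative[OF ac _ _ _ x])
    show "negligible E" using E(1) by (simp add: negligible_iff_null_sets)
    show "continuous_on {0..b} (\<lambda>x. matB *v (matQ p q x *v Y x) - lam *s (matB *v Y x))"
      by (intro continuous_on_diff bounded_linear.continuous_on[OF bounded_linear_smult]
          bounded_linear.continuous_on[OF bounded_linear_matrix_vector]
          bounded_bilinear.continuous_on[OF bounded_bilinear_matrix_vector_mult] Q cY)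
    fix x assume "x \<in> {0..b} - E"
    with E(2) obtain Y' where Y': "(Y has_vector_derivative Y') (at x within {0..b})" "matB *v Y' + matQ p q x *v Y x = lam *s Y x"
      by blast
    have "Y' = matB *v (matQ p q x *v Y x) - lam *s (matB *v Y x)"
      using Y'(2) by (simp add: mat2_simps algebra_simps eq_neg_iff_add_eq_0)
    with Y'(1) show "(Y has_vector_derivative matB *v (matQ p q x *v Y x) - lam *s (matB *v Y x)) (at x within {0..b})"
      by simp
  qed
qed

lemma norm_matB [simp]: "norm (matB *v y) = norm y"
  by (rule power2_eq_imp_eq) (simp_all add: norm_vec2_square mat2_simps)

section \<open>Moments of free solutions\<close>

definition moment :: "(real \<Rightarrow> complex^2) \<Rightarrow> nat \<Rightarrow> real \<Rightarrow> complex^2" where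
  "moment \<phi> n x = integral {-x..x} (\<lambda>t. t ^ n *\<^sub>R \<phi> t)"

locale free_solution =
  fixes lam :: complex and \<phi> :: "real \<Rightarrow> complex^2"
  assumes \<phi>: "\<And>t. (\<phi> has_vector_derivative - (lam *s (matB *v \<phi> t))) (at t)"
begin

lemma continuous_on_\<phi>: "continuous_on S \<phi>"
  by (rule continuous_on_vector_derivative[OF has_vector_derivative_at_within[OF \<phi>]])

lemma moment_derivative:
  assumes x: "x \<in> {0..b}"
  shows "(moment \<phi> n has_vector_derivative x ^ n *\<^sub>R \<phi> x + (- x) ^ n *\<^sub>R \<phi> (- x)) (at x within {0..b})"
proof -
  have "((\<lambda>y. integral {- y..y} (\<lambda>t. t ^ n *\<^sub>R \<phi> t)) has_vector_derivative
     integral {- x..x} (\<lambda>t. 0) + 1 *\<^sub>R (x ^ n *\<^sub>R \<phi> x) - (- 1) *\<^sub>R ((- x) ^ n *\<^sub>R \<phi> (- x))) (at x within {0..b})"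
  proof (rule integral_moving_bounds_derivative[where e="\<lambda>y t. t ^ n *\<^sub>R \<phi> t" and ex="\<lambda>y t. 0" and L="- b" and U=b])
    show "continuous_on ({0..b} \<times> {- b..b}) (\<lambda>(y, t). t ^ n *\<^sub>R \<phi> t)"
      unfolding split_beta by (intro continuous_intros continuous_on_compose2[OF continuous_on_\<phi>[of UNIV]]) auto
    show "(uminus has_vector_derivative - 1) (at x within {0..b})"
      using has_vector_derivative_minus[OF has_vector_derivative_id[of "at x within {0..b}"]] by simp
  qed (use x in \<open>auto intro!: continuous_intros derivative_intros simp: split_beta\<close>)
  then show ?thesis by (simp add: moment_def[abs_def])
qed

text \<open>Both sides are the integral of the derivative of t^n \<phi> t. The identity trades a
  moment of lower index for a multiple of \<lambda> and boundary terms; for n = 0 the index n - 1 is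
  harmless since its coefficient is 0.\<close>

lemma moment_by_parts:
  assumes x: "0 \<le> x"
  shows "x ^ n *\<^sub>R \<phi> x - (- x) ^ n *\<^sub>R \<phi> (- x) = real n *\<^sub>R moment \<phi> (n - 1) x - lam *s (matB *v moment \<phi> n x)"
proof -
  have i: "(\<lambda>t. t ^ m *\<^sub>R \<phi> t) integrable_on {- x..x}" for m
    by (intro integrable_continuous_real continuous_intros continuous_on_\<phi>)
  have bl: "bounded_linear (\<lambda>y. lam *s (matB *v y))"
    using bounded_linear_compose[OF bounded_linear_smult bounded_linear_matrix_vector] .
  have "((\<lambda>t. real n *\<^sub>R (t ^ (n - 1) *\<^sub>R \<phi> t) - lam *s (matB *v (t ^ n *\<^sub>R \<phi> t))) has_integral
      real n *\<^sub>R moment \<phi> (n - 1) x - lam *s (matB *v moment \<phi> n x)) {- x..x}"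
    unfolding moment_def
    by (intro has_integral_diff has_integral_cmul has_integral_linear[OF _ bl, unfolded o_def] integrable_integral i)
  moreover have "((\<lambda>t. real n *\<^sub>R (t ^ (n - 1) *\<^sub>R \<phi> t) - lam *s (matB *v (t ^ n *\<^sub>R \<phi> t))) has_integral
      x ^ n *\<^sub>R \<phi> x - (- x) ^ n *\<^sub>R \<phi> (- x)) {- x..x}"
  proof (rule fundamental_theorem_of_calculus)
    fix t
    have "((\<lambda>t. t ^ n) has_real_derivative real n * t ^ (n - 1)) (at t within {- x..x})"
      by (auto intro!: derivative_eq_intros)
    from has_vector_derivative_scaleR[OF this has_vector_derivative_at_within[OF \<phi>]]
    show "((\<lambda>t. t ^ n *\<^sub>R \<phi> t) has_vector_derivative real n *\<^sub>R (t ^ (n - 1) *\<^sub>R \<phi> t) - lam *s (matB *v (t ^ n *\<^sub>R \<phi> t))) (at t within {- x..x})"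
      by (rule has_vector_derivative_eq_rhs)
        (simp add: mat2_simps scaleR_nth_complex del: vector_scaleR_component; simp add: algebra_simps)
  qed (use x in simp)
  ultimately show ?thesis by (rule has_integral_unique[symmetric])
qed

end

section \<open>Kernel coefficients and approximate solutions\<close>

context formal_powers begin

definition Theta :: "nat \<Rightarrow> real \<Rightarrow> complex^2^2" where
  "Theta k x = columns2 (Phi p f g k x) (Psi p f g k x)"

lemma Theta_derivative:
  assumes x: "x \<in> {0..b}"
  shows "(Theta k has_vector_derivative matB ** (matQ p q x ** Theta k x) - real k *\<^sub>R (matB ** (Theta (k - 1) x ** matB))) (at x within {0..b})"
  unfolding Theta_def[abs_def]
  by (rule has_vector_derivative_eq_rhs[OF has_vector_derivative_columns2[OF Phi_Psi_derivs(1)[OF x] Phi_Psi_derivs(2)[OF x]]])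
    (simp add: mat2_simps scaleR_nth_complex del: vector_scaleR_component; simp add: algebra_simps)

definition conj_sign :: "nat \<Rightarrow> complex^2^2 \<Rightarrow> complex^2^2" where
  "conj_sign j A = (if even j then A else matB ** A ** matB)"

text \<open>Since B squared is -1, moving B to the other side flips the parity. This matches the
  alternation between even and odd kernel coefficients.\<close>

lemma matB_conj_sign: "matB ** conj_sign j A = - (conj_sign (Suc j) A ** matB)"
  by (auto simp: conj_sign_def mat2_simps)

lemma matK_altdef:
  "matK p f g N c j x = (\<Sum>k\<le>N - j. real ((j + k) choose j) *\<^sub>R (Theta k x ** conj_sign j (c (j + k))))"
  by (simp add: matK_def Theta_def conj_sign_def atLeast0AtMost)

text \<open>The coefficient of t^n in the differential equation of the kernel. The case distinction
  encodes that the coefficient with index N + 1 is 0: by truncated subtraction, \<open>matK\<close>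
  at \<open>Suc N\<close> would still contain the summand k = 0, with the irrelevant matrix
  \<open>c (Suc N)\<close>.\<close>

lemma matK_derivative:
  assumes x: "x \<in> {0..b}" and n: "n \<le> N"
  shows "(matK p f g N c n has_vector_derivative matB ** (matQ p q x ** matK p f g N c n x)
    + real (Suc n) *\<^sub>R (matB ** ((if n < N then matK p f g N c (Suc n) x else 0) ** matB))) (at x within {0..b})"
proof -
  let ?E = "\<lambda>j m. conj_sign j (c m)"
  have "(matK p f g N c n has_vector_derivative (\<Sum>k\<le>N - n. real ((n + k) choose n) *\<^sub>R
     ((matB ** (matQ p q x ** Theta k x) - real k *\<^sub>R (matB ** (Theta (k - 1) x ** matB))) ** ?E n (n + k)))) (at x within {0..b})"
    unfolding matK_altdef[abs_def]
    by (intro has_vector_derivative_sum bounded_linear.has_vector_derivative[OF bounded_linear_scaleR_right]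
        bounded_linear.has_vector_derivative[OF matmul_bounded_linear_left] Theta_derivative x)
  moreover have "(\<Sum>k\<le>N - n. real ((n + k) choose n) *\<^sub>R
     ((matB ** (matQ p q x ** Theta k x) - real k *\<^sub>R (matB ** (Theta (k - 1) x ** matB))) ** ?E n (n + k)))
     = matB ** (matQ p q x ** matK p f g N c n x)
      - (\<Sum>k\<le>N - n. real (k * ((n + k) choose n)) *\<^sub>R (matB ** (Theta (k - 1) x ** (matB ** ?E n (n + k)))))"
    unfolding matK_altdef matmul_sum_right sum_subtractf[symmetric]
    by (intro sum.cong) (simp_all add: matmul_diff_left matmul_scaleR_left matmul_scaleR_right scaleR_diff_right matrix_mul_assoc)
  moreover have "(\<Sum>k\<le>N - n. real (k * ((n + k) choose n)) *\<^sub>R (matB ** (Theta (k - 1) x ** (matB ** ?E n (n + k)))))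
     = - (real (Suc n) *\<^sub>R (matB ** ((if n < N then matK p f g N c (Suc n) x else 0) ** matB)))"
  proof (cases "n < N")
    case True
    then have N: "N - n = Suc (N - Suc n)" by simp
    have bin: "real (Suc k * ((n + Suc k) choose n)) = real (Suc n) * real ((Suc n + k) choose Suc n)" for k
    proof -
      have "Suc n * ((Suc n + k) choose Suc n) = ((Suc n + k) - n) * ((Suc n + k) choose n)"
        by (simp only: binomial_absorption binomial_absorb_comp)
      then have "Suc k * ((n + Suc k) choose n) = Suc n * ((Suc n + k) choose Suc n)" by simp
      then show ?thesis by (simp only: of_nat_mult[symmetric])
    qed
    have "(\<Sum>k\<le>N - n. real (k * ((n + k) choose n)) *\<^sub>R (matB ** (Theta (k - 1) x ** (matB ** ?E n (n + k)))))
      = (\<Sum>k\<le>N - Suc n. real (Suc k * ((n + Suc k) choose n)) *\<^sub>R (matB ** (Theta k x ** (matB ** ?E n (n + Suc k)))))"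
      unfolding N by (subst sum.atMost_Suc_shift) simp
    also have "\<dots> = (\<Sum>k\<le>N - Suc n. - (real (Suc n) *\<^sub>R (real ((Suc n + k) choose Suc n) *\<^sub>R (matB ** ((Theta k x ** ?E (Suc n) (Suc n + k)) ** matB)))))"
      unfolding bin matB_conj_sign by (intro sum.cong) (simp_all add: matmul_minus_right matrix_mul_assoc)
    also have "\<dots> = - (real (Suc n) *\<^sub>R (matB ** (matK p f g N c (Suc n) x ** matB)))"
      unfolding matK_altdef matmul_sum_left matmul_sum_right scaleR_sum_right sum_negf[symmetric]
      by (intro sum.cong) (simp_all add: matmul_scaleR_left matmul_scaleR_right)
    finally show ?thesis using True by simp
  qed (use n in \<open>simp add: matmul_zero_left matmul_zero_right\<close>)
  ultimately show ?thesis by simp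
qed

definition approx :: "nat \<Rightarrow> (nat \<Rightarrow> complex^2^2) \<Rightarrow> (real \<Rightarrow> complex^2) \<Rightarrow> real \<Rightarrow> complex^2" where
  "approx N c \<phi> x = \<phi> x + (\<Sum>n\<le>N. matK p f g N c n x *v moment \<phi> n x)"

definition residual :: "nat \<Rightarrow> (nat \<Rightarrow> complex^2^2) \<Rightarrow> (real \<Rightarrow> complex^2) \<Rightarrow> real \<Rightarrow> complex^2" where
  "residual N c \<phi> x = (goursat N c x + matB ** goursat N c x ** matB) *v \<phi> x
     + (goursat N c x - matB ** goursat N c x ** matB) *v \<phi> (- x)"

text \<open>B is an isometry, so each of the four terms is at most the norm of the Goursat
  matrix.\<close>

lemma norm_residual_le:
  assumes "\<And>t. norm (\<phi> t) \<le> 1"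
  shows "norm (residual N c \<phi> x) \<le> 4 * norm (goursat N c x)"
proof -
  define G where "G = goursat N c x"
  have le: "norm (G *v y) \<le> norm G" if "norm y \<le> 1" for y
    using order_trans[OF norm_matrix_vector_mult_le mult_left_mono[OF that norm_ge_zero]] by simp
  have "residual N c \<phi> x = (G *v \<phi> x + matB *v (G *v (matB *v \<phi> x))) + (G *v \<phi> (- x) - matB *v (G *v (matB *v \<phi> (- x))))"
    by (simp add: residual_def G_def[symmetric] matvec_add_left matvec_diff_left matrix_vector_mul_assoc matrix_mul_assoc)
  also have "norm \<dots> \<le> (norm G + norm G) + (norm G + norm G)"
    by (intro order_trans[OF norm_triangle_ineq add_mono] order_trans[OF norm_triangle_ineq4 add_mono]; simp add: le assms)
  finally show ?thesis by (simp add: G_def)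
qed

text \<open>Summation over the total index m = j + k, which selects the matrix \<open>c m\<close>.
  The parity of the power j of t decides between \<open>c m\<close> and its conjugate by B, whence
  the even and odd wave polynomials.\<close>

lemma kernel_regroup:
  "(\<Sum>n\<le>N. t ^ n *\<^sub>R matK p f g N c n x)
    = (\<Sum>m\<le>N. columns2 (wave_even (Phi p f g) m x t) (wave_even (Psi p f g) m x t) ** c m
        + columns2 (wave_odd (Phi p f g) m x t) (wave_odd (Psi p f g) m x t) ** (matB ** c m ** matB))"
proof -
  define h where "h j k = (t ^ j * real ((j + k) choose j)) *\<^sub>R (Theta k x ** conj_sign j (c (j + k)))" for j k
  have "(\<Sum>n\<le>N. t ^ n *\<^sub>R matK p f g N c n x) = (\<Sum>j\<le>N. \<Sum>k\<le>N - j. h j k)"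
    by (simp add: matK_altdef scaleR_sum_right h_def)
  also have "\<dots> = (\<Sum>m\<le>N. \<Sum>j\<le>m. h j (m - j))"
  proof -
    have "(\<Sum>j\<le>N. \<Sum>k\<le>N - j. h j k) = (\<Sum>(j, k)\<in>{(j, k). j + k \<le> N}. h j k)"
      by (subst sum.Sigma) (auto intro!: sum.cong)
    then show ?thesis by (simp only: sum.triangle_reindex_eq)
  qed
  also have "\<dots> = (\<Sum>m\<le>N. columns2 (wave_even (Phi p f g) m x t) (wave_even (Psi p f g) m x t) ** c m
        + columns2 (wave_odd (Phi p f g) m x t) (wave_odd (Psi p f g) m x t) ** (matB ** c m ** matB))"
  proof (rule sum.cong)
    fix m
    have cols: "columns2 (\<Sum>k\<in>A. (of_nat (r k) * of_real t ^ k) *s F k) (\<Sum>k\<in>A. (of_nat (r k) * of_real t ^ k) *s G k)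
      = (\<Sum>k\<in>A. (t ^ k * real (r k)) *\<^sub>R columns2 (F k) (G k))" for A and r :: "nat \<Rightarrow> nat" and F G :: "nat \<Rightarrow> complex^2"
      by (simp add: mat2_simps scaleR_nth_complex mult_ac del: vector_scaleR_component)
    have "(\<Sum>j\<le>m. h j (m - j)) = (\<Sum>j | j \<le> m \<and> even j. h j (m - j)) + (\<Sum>j | j \<le> m \<and> odd j. h j (m - j))"
    proof -
      have "{..m} = {k. k \<le> m \<and> even k} \<union> {k. k \<le> m \<and> odd k}" by auto
      then show ?thesis by (simp only:) (rule sum.union_disjoint; auto)
    qed
    also have "(\<Sum>j | j \<le> m \<and> even j. h j (m - j)) = columns2 (wave_even (Phi p f g) m x t) (wave_even (Psi p f g) m x t) ** c m"
      unfolding wave_even_def cols matmul_sum_left by (intro sum.cong) (auto simp: h_def conj_sign_def Theta_def matmul_scaleR_left)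
    also have "(\<Sum>j | j \<le> m \<and> odd j. h j (m - j)) = columns2 (wave_odd (Phi p f g) m x t) (wave_odd (Psi p f g) m x t) ** (matB ** c m ** matB)"
      unfolding wave_odd_def cols matmul_sum_left by (intro sum.cong) (auto simp: h_def conj_sign_def Theta_def matmul_scaleR_left)
    finally show "(\<Sum>j\<le>m. h j (m - j)) = columns2 (wave_even (Phi p f g) m x t) (wave_even (Psi p f g) m x t) ** c m
        + columns2 (wave_odd (Phi p f g) m x t) (wave_odd (Psi p f g) m x t) ** (matB ** c m ** matB)" .
  qed simp
  finally show ?thesis .
qed

end

lemma wave_reflect:
  "wave_even F m x (- t) = wave_even F m x t" "wave_odd F m x (- t) = - wave_odd F m x t"
proof -
  show "wave_even F m x (- t) = wave_even F m x t"
    unfolding wave_even_def by (intro sum.cong) (auto simp: power_minus_even)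
  show "wave_odd F m x (- t) = - wave_odd F m x t"
    unfolding wave_odd_def sum_negf[symmetric] by (intro sum.cong) (auto simp: power_minus_odd vec2_eq_iff)
qed

lemma continuous_on_vec2:
  fixes h :: "'b::topological_space \<Rightarrow> 'a::topological_space^2"
  assumes "continuous_on S (\<lambda>x. h x $ 1)" "continuous_on S (\<lambda>x. h x $ 2)"
  shows "continuous_on S h"
proof -
  have "continuous_on S (\<lambda>x. \<chi> i. h x $ i)"
    by (rule continuous_on_vec_lambda) (use assms exhaust_2 in metis)
  then show ?thesis by (simp add: vec_lambda_eta)
qed

section \<open>The residual equation and the error estimate\<close>

context formal_powers begin

definition kernel :: "nat \<Rightarrow> (nat \<Rightarrow> complex^2^2) \<Rightarrow> real \<Rightarrow> real \<Rightarrow> complex^2^2" where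
  "kernel N c x t = (\<Sum>n\<le>N. t ^ n *\<^sub>R matK p f g N c n x)"

text \<open>Adding or subtracting the conjugate by B isolates the kernel on t = x or on t = -x,
  where the odd part has changed sign. As B Q B = Q, the two halves of Q add up in the first
  identity and cancel in the second.\<close>

lemma goursat_kernel:
  "goursat N c x + matB ** goursat N c x ** matB = matQ p q x + (matB ** kernel N c x x - kernel N c x x ** matB)"
  "goursat N c x - matB ** goursat N c x ** matB = matB ** kernel N c x (- x) + kernel N c x (- x) ** matB"
proof -
  define X where "X m = columns2 (wave_even (Phi p f g) m x x) (wave_even (Psi p f g) m x x)" for m
  define Y where "Y m = columns2 (wave_odd (Phi p f g) m x x) (wave_odd (Psi p f g) m x x)" for m
  have N: "matN p f g m x = matB ** X m + Y m ** matB" for m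
    by (simp add: matN_def X_def Y_def mat2_simps)
  have neg: "columns2 (- y) (- z) = - columns2 y z" for y z by (simp add: mat2_simps)
  have K: "kernel N c x x = (\<Sum>m\<le>N. X m ** c m + Y m ** (matB ** c m ** matB))"
    "kernel N c x (- x) = (\<Sum>m\<le>N. X m ** c m - Y m ** (matB ** c m ** matB))"
    unfolding kernel_def kernel_regroup X_def Y_def by (simp_all add: wave_reflect neg matmul_minus_left)
  have Q: "(1/2) *\<^sub>R matQ p q x + matB ** ((1/2) *\<^sub>R matQ p q x) ** matB = matQ p q x"
    "(1/2) *\<^sub>R matQ p q x - matB ** ((1/2) *\<^sub>R matQ p q x) ** matB = 0"
    by (simp_all add: mat2_simps scaleR_nth_complex del: vector_scaleR_component)
  have a: "(matB ** A + D ** matB) ** C + matB ** ((matB ** A + D ** matB) ** C) ** matB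
      = matB ** (A ** C + D ** (matB ** C ** matB)) - (A ** C + D ** (matB ** C ** matB)) ** matB"
    "(matB ** A + D ** matB) ** C - matB ** ((matB ** A + D ** matB) ** C) ** matB
      = matB ** (A ** C - D ** (matB ** C ** matB)) + (A ** C - D ** (matB ** C ** matB)) ** matB" for A C D
    by (simp_all add: mat2_simps algebra_simps)
  have G: "goursat N c x = (1/2) *\<^sub>R matQ p q x + (\<Sum>m\<le>N. (matB ** X m + Y m ** matB) ** c m)"
    by (simp add: goursat_def N atLeast0AtMost)
  have "goursat N c x + matB ** goursat N c x ** matB
    = ((1/2) *\<^sub>R matQ p q x + matB ** ((1/2) *\<^sub>R matQ p q x) ** matB)
      + (\<Sum>m\<le>N. (matB ** X m + Y m ** matB) ** c m + matB ** ((matB ** X m + Y m ** matB) ** c m) ** matB)"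
    unfolding G by (simp only: matmul_add_left matmul_add_right matmul_sum_left matmul_sum_right sum.distrib add_ac)
  then show "goursat N c x + matB ** goursat N c x ** matB = matQ p q x + (matB ** kernel N c x x - kernel N c x x ** matB)"
    unfolding Q a K matmul_sum_left matmul_sum_right sum_subtractf .
  have "goursat N c x - matB ** goursat N c x ** matB
    = ((1/2) *\<^sub>R matQ p q x - matB ** ((1/2) *\<^sub>R matQ p q x) ** matB)
      + (\<Sum>m\<le>N. (matB ** X m + Y m ** matB) ** c m - matB ** ((matB ** X m + Y m ** matB) ** c m) ** matB)"
    unfolding G sum_subtractf matmul_add_left matmul_add_right matmul_sum_left matmul_sum_right by (simp only: add_diff_add)
  then show "goursat N c x - matB ** goursat N c x ** matB = matB ** kernel N c x (- x) + kernel N c x (- x) ** matB"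
    unfolding Q a K matmul_sum_left matmul_sum_right sum.distrib by simp
qed

text \<open>The residual in the form in which differentiation of \<open>approx\<close> produces it:
  boundary terms from the moments and boundary terms from integration by parts.\<close>

lemma matB_residual:
  "matB *v residual N c \<phi> x = matB *v (matQ p q x *v \<phi> x)
    - (\<Sum>n\<le>N. matK p f g N c n x *v (x ^ n *\<^sub>R \<phi> x + (- x) ^ n *\<^sub>R \<phi> (- x))
       + matB *v (matK p f g N c n x *v (matB *v (x ^ n *\<^sub>R \<phi> x - (- x) ^ n *\<^sub>R \<phi> (- x)))))"
proof -
  have a: "matB *v ((matB ** (r *\<^sub>R A) - (r *\<^sub>R A) ** matB) *v y) + matB *v ((matB ** (s *\<^sub>R A) + (s *\<^sub>R A) ** matB) *v z)
    = - (A *v (r *\<^sub>R y + s *\<^sub>R z) + matB *v (A *v (matB *v (r *\<^sub>R y - s *\<^sub>R z))))" for A r s y z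
    by (simp add: mat2_simps scaleR_nth_complex del: vector_scaleR_component; simp add: algebra_simps)
  have "matB *v residual N c \<phi> x = matB *v (matQ p q x *v \<phi> x)
      + (matB *v ((matB ** kernel N c x x - kernel N c x x ** matB) *v \<phi> x)
       + matB *v ((matB ** kernel N c x (- x) + kernel N c x (- x) ** matB) *v \<phi> (- x)))"
    unfolding residual_def goursat_kernel by (simp add: matvec_add_left matvec_add_right add.assoc)
  also have "matB *v ((matB ** kernel N c x x - kernel N c x x ** matB) *v \<phi> x)
       + matB *v ((matB ** kernel N c x (- x) + kernel N c x (- x) ** matB) *v \<phi> (- x))
     = - (\<Sum>n\<le>N. matK p f g N c n x *v (x ^ n *\<^sub>R \<phi> x + (- x) ^ n *\<^sub>R \<phi> (- x))
       + matB *v (matK p f g N c n x *v (matB *v (x ^ n *\<^sub>R \<phi> x - (- x) ^ n *\<^sub>R \<phi> (- x)))))"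
    unfolding kernel_def matmul_sum_left matmul_sum_right sum_subtractf[symmetric] sum.distrib[symmetric] matvec_sum_left matvec_sum_right a
    by (simp only: sum.distrib[symmetric] a sum_negf)
  finally show ?thesis by simp
qed

lemma (in -) sum_shift_truncated:
  fixes h :: "nat \<Rightarrow> 'a::comm_monoid_add"
  assumes "h 0 = 0"
  shows "(\<Sum>n\<le>N. if n < N then h (Suc n) else 0) = (\<Sum>n\<le>N. h n)"
proof -
  have "(\<Sum>n\<le>N. if n < N then h (Suc n) else 0) = (\<Sum>n<N. h (Suc n))"
    by (rule sum.mono_neutral_cong_right) auto
  also have "\<dots> = (\<Sum>n\<le>N. h n)"
    using assms by (simp add: sum.lessThan_Suc_shift lessThan_Suc_atMost[symmetric] del: sum.lessThan_Suc)
  finally show ?thesis .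
qed

text \<open>The derivative of one kernel coefficient contains the next one. After a shift of index
  it meets n times the moment of index n - 1, and integration by parts converts this into boundary
  terms and the \<lambda> B term of the equation.\<close>

lemma approx_derivative:
  assumes "free_solution lam \<phi>" and x: "x \<in> {0..b}"
  shows "(approx N c \<phi> has_vector_derivative matB *v (matQ p q x *v approx N c \<phi> x)
     - lam *s (matB *v approx N c \<phi> x) - matB *v residual N c \<phi> x) (at x within {0..b})"
proof -
  interpret free_solution lam \<phi> by fact
  define K where "K n = matK p f g N c n x" for n
  define J where "J n = moment \<phi> n x" for n
  define s where "s n = x ^ n *\<^sub>R \<phi> x + (- x) ^ n *\<^sub>R \<phi> (- x)" for n
  define d where "d n = x ^ n *\<^sub>R \<phi> x - (- x) ^ n *\<^sub>R \<phi> (- x)" for n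
  \<comment> \<open>The part of the derivative of coefficient n - 1 that contains coefficient n,
    applied to the moment of index n - 1.\<close>
  define h where "h n = matB *v (K n *v (matB *v (real n *\<^sub>R J (n - 1))))" for n
  have D: "((\<lambda>x. \<phi> x + (\<Sum>n\<le>N. matK p f g N c n x *v moment \<phi> n x)) has_vector_derivative
     - (lam *s (matB *v \<phi> x)) + (\<Sum>n\<le>N. K n *v s n + (matB ** (matQ p q x ** K n)
      + real (Suc n) *\<^sub>R (matB ** ((if n < N then K (Suc n) else 0) ** matB))) *v J n)) (at x within {0..b})"
    unfolding K_def J_def s_def
    by (intro has_vector_derivative_add has_vector_derivative_sum bounded_bilinear.has_vector_derivative[OF bounded_bilinear_matrix_vector_mult]
        has_vector_derivative_at_within[OF \<phi>] matK_derivative moment_derivative x) auto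
  have smult_add: "lam *s (y + z) = lam *s y + lam *s z" for y z :: "complex^2"
    by (simp add: vec2_eq_iff algebra_simps)
  have smult_sum: "lam *s (\<Sum>n\<in>A. y n) = (\<Sum>n\<in>A. lam *s y n)" for A and y :: "nat \<Rightarrow> complex^2"
    using linear_sum[OF bounded_linear.linear[OF bounded_linear_smult]] by blast
  have 1: "(matB ** (matQ p q x ** K n) + real (Suc n) *\<^sub>R (matB ** ((if n < N then K (Suc n) else 0) ** matB))) *v J n
     = matB *v (matQ p q x *v (K n *v J n)) + (if n < N then h (Suc n) else 0)" for n
    by (simp add: h_def matvec_add_left matvec_scaleR_left matvec_scaleR_right matrix_vector_mul_assoc matmul_zero_left matmul_zero_right matvec_zero_left)
  have "h 0 = 0" by (simp add: h_def matrix_vector_mult_0_right)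
  have h: "h n = matB *v (K n *v (matB *v d n)) - lam *s (matB *v (K n *v J n))" for n
  proof -
    have eq: "real n *\<^sub>R J (n - 1) = d n + lam *s (matB *v J n)"
      using moment_by_parts[of x n] x by (simp add: d_def J_def)
    show ?thesis unfolding h_def eq by (simp add: mat2_simps algebra_simps)
  qed
  have "- (lam *s (matB *v \<phi> x)) + (\<Sum>n\<le>N. K n *v s n + (matB ** (matQ p q x ** K n)
      + real (Suc n) *\<^sub>R (matB ** ((if n < N then K (Suc n) else 0) ** matB))) *v J n)
    = - (lam *s (matB *v \<phi> x)) + (\<Sum>n\<le>N. K n *v s n) + (\<Sum>n\<le>N. matB *v (matQ p q x *v (K n *v J n))) + (\<Sum>n\<le>N. h n)"
    unfolding 1 sum.distrib sum_shift_truncated[of h, OF \<open>h 0 = 0\<close>] by (simp only: add.assoc)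
  also have "\<dots> = matB *v (matQ p q x *v approx N c \<phi> x) - lam *s (matB *v approx N c \<phi> x) - matB *v residual N c \<phi> x"
    unfolding h sum_subtractf matB_residual approx_def K_def[symmetric] J_def[symmetric] s_def[symmetric] d_def[symmetric]
      matvec_add_right matvec_sum_right smult_add smult_sum sum.distrib by simp
  finally show ?thesis using D by (simp add: approx_def[abs_def])
qed

lemma approx_0: "approx N c \<phi> 0 = \<phi> 0"
  by (simp add: approx_def moment_def matrix_vector_mult_0_right)

lemma continuous_on_goursat: "continuous_on {0..b} (goursat N c)"
proof -
  have c: "continuous_on {0..b} (Phi p f g k)" "continuous_on {0..b} (Psi p f g k)" for k
    by (rule continuous_on_vector_derivative, erule Phi_Psi_derivs)+
  have e: "continuous_on {0..b} (\<lambda>x. wave_even F n x x)" "continuous_on {0..b} (\<lambda>x. wave_odd F n x x)"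
    if F: "\<And>k. continuous_on {0..b} (F k)" for F n
    by (rule continuous_on_vec2; unfold wave_even_def wave_odd_def sum_component vector_smult_component;
        intro continuous_intros F)+
  note e = e[where F="Phi p f g", OF c(1)] e[where F="Psi p f g", OF c(2)]
  show ?thesis
    by (intro continuous_on_vec2;
        simp add: goursat_def matN_def sum_component mat2_simps scaleR_nth_complex del: vector_scaleR_component;
        auto intro!: continuous_intros e cont_p cont_q)
qed

text \<open>The weight x in Young's inequality puts the factor x before the residual and the rate
  1/x into Gronwall's inequality, where it adds only 1 to the exponent. The 16 is the square of the
  factor 4 in the bound on the residual.\<close>

lemma approx_error:
  fixes l k :: real and Y :: "real \<Rightarrow> complex^2"
  assumes \<phi>: "free_solution (of_real l) \<phi>" "\<And>t. norm (\<phi> t) \<le> 1"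
    and Y: "\<And>x. x \<in> {0..b} \<Longrightarrow> (Y has_vector_derivative matB *v (matQ p q x *v Y x) - of_real l *s (matB *v Y x)) (at x within {0..b})"
    and Y0: "Y 0 = \<phi> 0" and k: "0 \<le> k" "\<And>x. x \<in> {0..b} \<Longrightarrow> norm (matQ p q x) \<le> k" and x: "x \<in> {0..b}"
  shows "(norm (Y x - approx N c \<phi> x))\<^sup>2 \<le> exp (2 * k * b + 1) * 16 * x * msq 0 b (goursat N c)"
proof (cases "x = 0")
  case True
  then show ?thesis by (simp add: approx_0 Y0)
next
  case False
  then have X: "0 < x" using x by simp
  have sub: "{0..x} \<subseteq> {0..b}" using x by auto
  define e where "e s = Y s - approx N c \<phi> s" for s
  define e' where "e' s = matB *v (matQ p q s *v e s) - of_real l *s (matB *v e s) + matB *v residual N c \<phi> s" for s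
  define \<psi> where "\<psi> s = x * (4 * norm (goursat N c s))\<^sup>2" for s
  have c\<psi>: "continuous_on {0..b} \<psi>" unfolding \<psi>_def by (intro continuous_intros continuous_on_goursat)
  have "(norm (e x))\<^sup>2 \<le> exp ((2 * k + 1 / x) * x) * ((norm (e 0))\<^sup>2 + integral {0..x} \<psi>)"
  proof (rule gronwall_derivative[where \<phi>'="\<lambda>s. 2 * (e s \<bullet> e' s)"])
    fix s assume "s \<in> {0..x}"
    then have s: "s \<in> {0..b}" using sub by auto
    have smult_diff: "r *s (y - z) = r *s y - r *s z" for r :: complex and y z :: "complex^2"
      by (simp add: vec2_eq_iff algebra_simps)
    have de: "(e has_vector_derivative e' s) (at s within {0..x})"
      unfolding e_def[abs_def] e'_def
      by (rule has_vector_derivative_within_subset[OF has_vector_derivative_eq_rhs[OF has_vector_derivative_diff[OF Y[OF s] approx_derivative[OF \<phi>(1) s]]] sub])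
        (simp add: matrix_vector_mult_diff_distrib smult_diff)
    show "((\<lambda>s. (norm (e s))\<^sup>2) has_vector_derivative 2 * (e s \<bullet> e' s)) (at s within {0..x})"
      unfolding power2_norm_eq_inner has_vector_derivative_def
      by (rule derivative_eq_intros de[unfolded has_vector_derivative_def] refl)+ (auto simp: inner_commute fun_eq_iff)
    have skew: "e s \<bullet> (of_real l *s (matB *v e s)) = 0"
      by (simp add: inner_vec_def sum_2 mat2_simps inner_complex_def algebra_simps)
    have 1: "e s \<bullet> (matB *v (matQ p q s *v e s)) \<le> k * (norm (e s))\<^sup>2"
    proof -
      have "norm (matB *v (matQ p q s *v e s)) \<le> k * norm (e s)"
        using order_trans[OF norm_matrix_vector_mult_le mult_right_mono[OF k(2)[OF s]]] by simp
      then have "norm (e s) * norm (matB *v (matQ p q s *v e s)) \<le> norm (e s) * (k * norm (e s))"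
        by (rule mult_left_mono) simp
      then show ?thesis
        using order_trans[OF norm_cauchy_schwarz[of "e s" "matB *v (matQ p q s *v e s)"]] by (simp add: power2_eq_square mult_ac)
    qed
    have 2: "2 * (e s \<bullet> (matB *v residual N c \<phi> s)) \<le> 1 / x * (norm (e s))\<^sup>2 + \<psi> s"
    proof -
      have n: "norm (residual N c \<phi> s) \<le> 4 * norm (goursat N c s)" by (rule norm_residual_le[OF \<phi>(2)])
      have "2 * (e s \<bullet> (matB *v residual N c \<phi> s)) \<le> 2 * (norm (e s) * (4 * norm (goursat N c s)))"
        using order_trans[OF norm_cauchy_schwarz[of "e s" "matB *v residual N c \<phi> s"] mult_left_mono[of _ "4 * norm (goursat N c s)" "norm (e s)"]] n by simp
      also have "\<dots> = 2 * (norm (e s) / sqrt x) * (sqrt x * (4 * norm (goursat N c s)))"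
        using X by simp
      also have "\<dots> \<le> (norm (e s) / sqrt x)\<^sup>2 + (sqrt x * (4 * norm (goursat N c s)))\<^sup>2"
        by (rule sum_squares_bound)
      also have "\<dots> = 1 / x * (norm (e s))\<^sup>2 + \<psi> s"
        using X by (simp add: power_divide power_mult_distrib \<psi>_def)
      finally show ?thesis .
    qed
    show "2 * (e s \<bullet> e' s) \<le> (2 * k + 1 / x) * (norm (e s))\<^sup>2 + \<psi> s"
      using 1 2 skew unfolding e'_def inner_add_right inner_diff_right by (simp add: distrib_right)
    show "0 \<le> \<psi> s" using X by (simp add: \<psi>_def)
  qed (use X k(1) continuous_on_subset[OF c\<psi> sub] in auto)
  also have "e 0 = 0" by (simp add: e_def approx_0 Y0)
  also have "(2 * k + 1 / x) * x = 2 * k * x + 1" using X by (simp add: algebra_simps)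
  finally have "(norm (e x))\<^sup>2 \<le> exp (2 * k * x + 1) * integral {0..x} \<psi>" by simp
  also have "\<dots> \<le> exp (2 * k * b + 1) * integral {0..b} \<psi>"
  proof (rule mult_mono)
    show "exp (2 * k * x + 1) \<le> exp (2 * k * b + 1)" using x k(1) by (simp add: mult_left_mono)
    show "integral {0..x} \<psi> \<le> integral {0..b} \<psi>"
      using X by (intro integral_subset_le integrable_continuous_real sub c\<psi> continuous_on_subset[OF c\<psi> sub]) (auto simp: \<psi>_def)
    show "0 \<le> integral {0..x} \<psi>"
      using X by (intro integral_nonneg integrable_continuous_real continuous_on_subset[OF c\<psi> sub]) (auto simp: \<psi>_def)
  qed simp
  also have "integral {0..b} \<psi> = 16 * x * msq 0 b (goursat N c)"
    by (simp add: \<psi>_def[abs_def] power_mult_distrib)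
  finally show ?thesis by (simp add: e_def mult.assoc)
qed

end

lemma free_solution_trig:
  "free_solution (of_real l) (\<lambda>t. vector [cos (of_real l * of_real t), sin (of_real l * of_real t)])"
  "free_solution (of_real l) (\<lambda>t. vector [- sin (of_real l * of_real t), cos (of_real l * of_real t)])"
  "norm (vector [cos (complex_of_real l * of_real t), sin (of_real l * of_real t)] :: complex^2) \<le> 1"
  "norm (vector [- sin (complex_of_real l * of_real t), cos (of_real l * of_real t)] :: complex^2) \<le> 1"
proof -
  have d: "((\<lambda>t. cos (of_real l * of_real t) :: complex) has_vector_derivative - (of_real l * sin (of_real l * of_real t))) (at t)"
    "((\<lambda>t. sin (of_real l * of_real t) :: complex) has_vector_derivative of_real l * cos (of_real l * of_real t)) (at t)" for t
    by (rule has_vector_derivative_real_field, auto intro!: derivative_eq_intros)+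
  show "free_solution (of_real l) (\<lambda>t. vector [cos (of_real l * of_real t), sin (of_real l * of_real t)])"
    by (unfold_locales, rule has_vector_derivative_eq_rhs[OF has_vector_derivative_vector2[OF d]]) (simp add: mat2_simps)
  show "free_solution (of_real l) (\<lambda>t. vector [- sin (of_real l * of_real t), cos (of_real l * of_real t)])"
    by (unfold_locales, rule has_vector_derivative_eq_rhs[OF has_vector_derivative_vector2[OF has_vector_derivative_minus[OF d(2)] d(1)]])
      (simp add: mat2_simps)
  have r: "cos (complex_of_real l * of_real t) = of_real (cos (l * t))" "sin (complex_of_real l * of_real t) = of_real (sin (l * t))"
    by (simp_all add: cos_of_real sin_of_real flip: of_real_mult)
  show "norm (vector [cos (complex_of_real l * of_real t), sin (of_real l * of_real t)] :: complex^2) \<le> 1"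
    "norm (vector [- sin (complex_of_real l * of_real t), cos (of_real l * of_real t)] :: complex^2) \<le> 1"
    unfolding r by (rule power2_le_imp_le; simp add: norm_vec2_square)+
qed

section \<open>Trigonometric data and the least squares choice\<close>

context formal_powers begin

lemma approxC_S_altdef:
  "approxC p f g N c x lam = approx N c (\<lambda>t. vector [cos (lam * of_real t), sin (lam * of_real t)]) x"
  "approxS p f g N c x lam = approx N c (\<lambda>t. vector [- sin (lam * of_real t), cos (lam * of_real t)]) x"
proof -
  have "t ^ n *\<^sub>R (vector [y, z] :: complex^2) = vector [of_real t ^ n * y, of_real t ^ n * z]" for t n y z
    by (simp add: vec2_eq_iff scaleR_nth_complex del: vector_scaleR_component)
  then show "approxC p f g N c x lam = approx N c (\<lambda>t. vector [cos (lam * of_real t), sin (lam * of_real t)]) x"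
    "approxS p f g N c x lam = approx N c (\<lambda>t. vector [- sin (lam * of_real t), cos (lam * of_real t)]) x"
    by (simp_all add: approxC_def approxS_def approx_def moment_def atLeast0AtMost)
qed

lemma least_squares_le:
  assumes "least_squares_solution b p q f g N c"
  shows "msq 0 b (goursat N c) \<le> msq 0 b (goursat N c')"
proof -
  have "(L2_norm_on b (goursat N c))\<^sup>2 = msq 0 b (goursat N c)" for c
    unfolding L2_norm_on_def
    by (intro real_sqrt_pow2 integral_nonneg integrable_continuous_real continuous_intros continuous_on_goursat) auto
  then show ?thesis
    using assms by (auto simp: least_squares_solution_def is_arg_min_def goursat_def[abs_def] not_less)
qed

end

theorem proposition7p1:
  fixes b :: real and r :: nat
    and p q f g :: "real \<Rightarrow> complex"
    and C S :: "real \<Rightarrow> complex \<Rightarrow> complex^2"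
  assumes "b > 0"
    and "Cr_on r {0..b} (matQ p q)"
    and "\<And>lam. dirac_solution b p q lam (\<lambda>x. C x lam)"
    and "\<And>lam. C 0 lam = vector [1, 0]"
    and "\<And>lam. dirac_solution b p q lam (\<lambda>x. S x lam)"
    and "\<And>lam. S 0 lam = vector [0, 1]"
    and "dirac_solution b p q 0 (\<lambda>x. vector [f x, g x])"
    and "\<And>x. x \<in> {0..b} \<Longrightarrow> f x \<noteq> 0 \<and> g x \<noteq> 0"
    and "f 0 * g 0 = 1"
  shows "\<exists>M::real. \<forall>N>r. \<forall>c. least_squares_solution b p q f g N c \<longrightarrow>
           (\<forall>x\<in>{0..b}. \<forall>lam::real.
              norm (C x (of_real lam) - approxC p f g N c x (of_real lam)) \<le> 2 * M * sqrt x / real N ^ r \<and>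
              norm (S x (of_real lam) - approxS p f g N c x (of_real lam)) \<le> 2 * M * sqrt x / real N ^ r)"
proof -
  have cQ: "continuous_on {0..b} (matQ p q)" by (rule Cr_on_imp_continuous_on[OF assms(2)])
  have nth: "bounded_linear (\<lambda>A :: complex^2^2. A $ i $ j)" for i j
    using bounded_linear_compose[OF bounded_linear_vec_nth bounded_linear_vec_nth] .
  have Cr: "Cr_on r {0..b} p" "Cr_on r {0..b} q"
    using Cr_on_bounded_linear[OF nth assms(2), of 1 1] Cr_on_bounded_linear[OF nth assms(2), of 1 2]
    by (simp_all add: matQ_nth)
  have fg: "(f has_vector_derivative q x * f x - p x * g x) (at x within {0..b})"
    "(g has_vector_derivative - (p x * f x) - q x * g x) (at x within {0..b})" if x: "x \<in> {0..b}" for x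
  proof -
    note d = dirac_solution_derivative[OF cQ assms(7) x]
    show "(f has_vector_derivative q x * f x - p x * g x) (at x within {0..b})"
      using bounded_linear.has_vector_derivative[OF bounded_linear_vec_nth[of 1] d] by (simp add: mat2_simps)
    show "(g has_vector_derivative - (p x * f x) - q x * g x) (at x within {0..b})"
      using bounded_linear.has_vector_derivative[OF bounded_linear_vec_nth[of 2] d] by (simp add: mat2_simps)
  qed
  interpret formal_powers b p q f g
    by unfold_locales (use assms fg Cr[THEN Cr_on_imp_continuous_on] in auto)
  have "Cr_on r {0..b} u" "Cr_on r {0..b} v"
    using Cr_on_add[OF Cr(2) Cr_on_bounded_linear[OF bounded_linear_mult_right Cr(1), of \<i>]]
      Cr_on_add[OF Cr(2) Cr_on_bounded_linear[OF bounded_linear_mult_right Cr(1), of "- \<i>"]]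
    by (simp_all add: u_def[abs_def] v_def[abs_def])
  from goursat_approximation[OF this] obtain M where M: "0 \<le> M"
    "\<And>N. \<exists>c. msq 0 b (goursat N c) \<le> M / (real (N + 1)) ^ (2 * r)" by blast
  obtain k where k: "\<forall>x\<in>{0..b}. norm (matQ p q x) \<le> k"
    using compact_imp_bounded[OF compact_continuous_image[OF cQ compact_Icc]] unfolding bounded_iff by blast
  have "0 \<in> {0..b}" using assms(1) by simp
  with k have "0 \<le> k" using norm_ge_zero order_trans by blast
  define A where "A = exp (2 * k * b + 1) * 16 * M"
  have "0 \<le> A" using M(1) by (simp add: A_def)
  show ?thesis
  \<comment> \<open>The estimate yields the constant \<open>sqrt A\<close>; halving it fits the
    factor 2 in the claim.\<close>
  proof (rule exI[of _ "sqrt A / 2"], intro allI impI ballI)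
    fix N c x and lam :: real
    assume N: "r < N" and c: "least_squares_solution b p q f g N c" and x: "x \<in> {0..b}"
    obtain c' where "msq 0 b (goursat N c') \<le> M / (real (N + 1)) ^ (2 * r)"
      using M(2) by blast
    with least_squares_le[OF c, of c']
    have "msq 0 b (goursat N c) \<le> M / (real (N + 1)) ^ (2 * r)" by (rule order_trans)
    \<comment> \<open>N is positive because it exceeds r.\<close>
    also have "\<dots> \<le> M / (real N) ^ (2 * r)"
      using M(1) N by (intro divide_left_mono power_mono) auto
    finally have G: "msq 0 b (goursat N c) \<le> M / (real N) ^ (2 * r)" .
    have err: "norm (Y x - approx N c \<phi> x) \<le> 2 * (sqrt A / 2) * sqrt x / real N ^ r"
      if \<phi>: "free_solution (of_real lam) \<phi>" "\<And>t. norm (\<phi> t) \<le> 1" and Y: "dirac_solution b p q (of_real lam) Y" "Y 0 = \<phi> 0"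
      for Y \<phi>
    proof (rule power2_le_imp_le)
      have "(norm (Y x - approx N c \<phi> x))\<^sup>2 \<le> exp (2 * k * b + 1) * 16 * x * msq 0 b (goursat N c)"
        by (rule approx_error[OF \<phi> dirac_solution_derivative[OF cQ Y(1)] Y(2) \<open>0 \<le> k\<close>]) (use k x in auto)
      also have "\<dots> \<le> exp (2 * k * b + 1) * 16 * x * (M / (real N) ^ (2 * r))"
        using G x by (intro mult_left_mono) auto
      also have "\<dots> = (2 * (sqrt A / 2) * sqrt x / real N ^ r)\<^sup>2"
        using \<open>0 \<le> A\<close> x by (simp add: power_divide power_mult_distrib power_mult[symmetric] A_def mult_ac)
      finally show "(norm (Y x - approx N c \<phi> x))\<^sup>2 \<le> (2 * (sqrt A / 2) * sqrt x / real N ^ r)\<^sup>2" .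
      show "0 \<le> 2 * (sqrt A / 2) * sqrt x / real N ^ r" using \<open>0 \<le> A\<close> x by simp
    qed
    show "norm (C x (of_real lam) - approxC p f g N c x (of_real lam)) \<le> 2 * (sqrt A / 2) * sqrt x / real N ^ r \<and>
      norm (S x (of_real lam) - approxS p f g N c x (of_real lam)) \<le> 2 * (sqrt A / 2) * sqrt x / real N ^ r"
      unfolding approxC_S_altdef
      by (intro conjI err free_solution_trig assms(3,5)) (simp_all add: assms(4,6))
  qed
qed

end
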